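(* Let $\theta_0=1$, let $\theta_1,\dots,\theta_q$ be scalars, $\boldsymbol\theta=(\theta_1,\dots,\theta_q)$, and consider the $k$-dimensional vector autoregressive moving-average (VARMA) model (row-vector convention) $$X_t=\mu+X_{t-1}\Phi_1+X_{t-2}\Phi_2+\cdots+X_{t-p}\Phi_p+\epsilon_t+\theta_1\epsilon_{t-1}+\cdots+\theta_q\epsilon_{t-q},$$ where the $\epsilon_t$ are i.i.d. Gaussian random vectors with covariance matrix $\Omega$, and $\Phi=(\Phi_1,\dots,\Phi_p)$. Let $X_1,\dots,X_p,X_{p+1},\dots,X_{T+p}$ be $T+p$ observations. With the notation $\mathbf X$, $L^i\mathbf X$, $\mathbf Z$, $\Theta_T$, $\Theta_{*;T-q}$, $\lambda$, $K$, $\mathbf X_\theta$, $\mathbf X_{\theta,\mathrm{lag}}$, $\Sigma_T$ defined in the context: (1) The conditional log-likelihood function of the model, conditioned on the first $p$ observations $X_1,\dots,X_p$, is $$\mathscr L(\boldsymbol\theta,\mu,\Phi,\Omega,X_{p+1},\dots,X_{T+p}\mid X_1,\dots,X_p)=-\tfrac{Tk}{2}\log(2\pi)-\tfrac T2\log\det\Omega-\tfrac k2\log\det(\lambda'\lambda+I_q)-\tfrac12\operatorname{Tr}\!\big(\mathbf Z'(\Theta_T^{-1})'K\,\Theta_T^{-1}\mathbf Z\,\Omega^{-1}\big),$$ where $$K=K(\boldsymbol\theta,T)=I_T-\lambda(\lambda'\lambda+I_q)^{-1}\lambda'=(I_T+\lambda\lambda')^{-1}.$$ (2) For given $\boldsymbol\theta$,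 the optimal value (in $\mu,\Phi,\Omega$) is obtained at $$\begin{pmatrix}\mu\\ \Phi_1\\ \Phi_2\\ \vdots\\ \Phi_p\end{pmatrix}_{opt}=(\mathbf X_{\theta,\mathrm{lag}}'K\mathbf X_{\theta,\mathrm{lag}})^{-1}\mathbf X_{\theta,\mathrm{lag}}'K\mathbf X_\theta$$ and $$\Omega_{opt}(\boldsymbol\theta)=\tfrac1T\big[\mathbf X_\theta'K\mathbf X_\theta-\mathbf X_\theta'K\mathbf X_{\theta,\mathrm{lag}}(\mathbf X_{\theta,\mathrm{lag}}'K\mathbf X_{\theta,\mathrm{lag}})^{-1}\mathbf X_{\theta,\mathrm{lag}}'K\mathbf X_\theta\big]$$ (where $\mathbf X_{\theta,\mathrm{lag}}'K\mathbf X_{\theta,\mathrm{lag}}$ is assumed invertible). $\Omega_{opt}$ is positive semi-definite regardless of the sample values of $X$ and the choice of $\boldsymbol\theta$. With these values of $(\mu,\Phi)_{opt}$ and $\Omega_{opt}$, the log-likelihood in (1) reduces to $$\bar{\mathscr L}(\boldsymbol\theta,X_{p+1},\dots,X_{T+p}\mid X_1,\dots,X_p)=-\tfrac{Tk}{2}\log(2\pi)-\tfrac T2\log\det\Omega_{opt}(\boldsymbol\theta)-\tfrac k2\log\det(\lambda'\lambda+I_q)-\tfrac{Tk}{2}.$$ (3) Further, $$\Sigma_T^{-1}=(\Theta_T^{-1})'K(\boldsymbol\theta,T)\,\Theta_T^{-1},\qquad\text{or}\qquad \Sigma_T=\Theta_TK(\boldsymbol\theta,T)^{-1}\Theta_T',$$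 and $$\det(\lambda'\lambda+I_q)=\det\Sigma_T=\frac1{\det K(\boldsymbol\theta,T)}.$$
   Context: A prime denotes matrix transpose; all matrices are real. Each $X_t$, each $\epsilon_t$ and $\mu$ is a row vector in $\mathbb R^{1\times k}$; each $\Phi_i$ is $k\times k$. $\mathbf X$ is the $T\times k$ matrix with rows $X_{p+1},\dots,X_{T+p}$; $L^i\mathbf X$ is the $T\times k$ matrix with rows $X_{p-i+1},\dots,X_{T+p-i}$. $\mathbf 1$ is the $T\times 1$ all-ones column. $\mathbf Z=\mathbf X-\mathbf 1\mu-(L\mathbf X)\Phi_1-\cdots-(L^p\mathbf X)\Phi_p$. $\Theta_T$ is the $T\times T$ lower triangular Toeplitz matrix with $(i,j)$ entry $\theta_{i-j}$ if $0\le i-j\le q$ and $0$ otherwise. $\Theta_*$ is the $q\times q$ upper triangular matrix with $(i,j)$ entry $\theta_{q-(j-i)}$ if $j\ge i$ and $0$ otherwise (first row $\theta_q,\theta_{q-1},\dots,\theta_1$; diagonal entries $\theta_q$). $\Theta_{*;T-q}=\begin{pmatrix}\Theta_*\\ 0_{T-q,q}\end{pmatrix}$, of size $T\times q$ (so $T\ge q$), where $0_{a,b}$ is the $a\times b$ zero matrix. $\lambda=\Theta_T^{-1}\Theta_{*;T-q}$, of size $T\times q$. $\mathbf X_\theta=\Theta_T^{-1}\mathbf X$ and $\mathbf X_{\theta,\mathrm{lag}}=\begin{pmatrix}\Theta_T^{-1}\mathbf 1&\Theta_T^{-1}L\mathbf X&\cdots&\Theta_T^{-1}L^p\mathbf X\end{pmatrix}$.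 $\Sigma_T$ is the $T\times T$ symmetric Toeplitz matrix with $(i,j)$ entry $\gamma_{|i-j|}$, where $\gamma_l=\theta_l+\theta_1\theta_{l+1}+\theta_2\theta_{l+2}+\cdots+\theta_{q-l}\theta_q$ for $l=0,1,\dots,q$ and $\gamma_l=0$ for $l>q$.
   Formalization: The errors have mean zero, and the first p observations are assumed independent of the errors ε_{p+1-q},…,ε_{p+T} (fixed initial values included), without which (1) fails; the joint optimum and reduced likelihood in (2) assume Ω_opt nonsingular. *)

theory Defs
  imports "HOL-Probability.Probability" "Jordan_Normal_Form.Gauss_Jordan_Elimination"
    "Jordan_Normal_Form.Determinant"
begin

text \<open>Matrices are those of Jordan_Normal_Form: indices start at 0 and dimensions are arbitrary
  natural numbers, possibly 0.  The names det and trace also exist in HOL-Analysis for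
  type-indexed matrices, hence the qualified determinant below.\<close>

abbreviation mdet :: "real mat \<Rightarrow> real" where
  "mdet \<equiv> Determinant.det"

text \<open>The value is meaningful only if the argument is invertible.\<close>

definition minv :: "real mat \<Rightarrow> real mat" where
  "minv A = the (mat_inverse A)"

definition mtrace :: "real mat \<Rightarrow> real" where
  "mtrace A = (\<Sum>i<dim_row A. A $$ (i, i))"

definition append_columns :: "real mat \<Rightarrow> real mat \<Rightarrow> real mat" (infixl "@\<^sub>c" 65) where
  "A @\<^sub>c B = four_block_mat A B (0\<^sub>m 0 (dim_col A)) (0\<^sub>m 0 (dim_col B))"

definition pos_semidef :: "nat \<Rightarrow> real mat \<Rightarrow> bool" where
  "pos_semidef n A \<longleftrightarrow> A \<in> carrier_mat n n \<and> A\<^sup>T = A \<and>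
     (\<forall>v \<in> carrier_vec n. 0 \<le> scalar_prod v (A *\<^sub>v v))"

definition pos_def :: "nat \<Rightarrow> real mat \<Rightarrow> bool" where
  "pos_def n A \<longleftrightarrow> A \<in> carrier_mat n n \<and> A\<^sup>T = A \<and>
     (\<forall>v \<in> carrier_vec n. v \<noteq> 0\<^sub>v n \<longrightarrow> 0 < scalar_prod v (A *\<^sub>v v))"


text \<open>A sample is a function x of (integer) time and component.  Row i of the matrix
  \<open>lag_mat p k T r x\<close>, for i < T and r \<le> p, is the observation at time p + 1 + i - r;
  r = 0 gives the matrix X itself.\<close>

definition lag_mat :: "nat \<Rightarrow> nat \<Rightarrow> nat \<Rightarrow> nat \<Rightarrow> (int \<Rightarrow> nat \<Rightarrow> real) \<Rightarrow> real mat" where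
  "lag_mat p k T r x = mat T k (\<lambda>(i, j). x (int p + 1 + int i - int r) j)"

definition ones_mat :: "nat \<Rightarrow> real mat" where
  "ones_mat T = mat T 1 (\<lambda>_. 1)"

definition Z_mat :: "nat \<Rightarrow> nat \<Rightarrow> nat \<Rightarrow> real mat \<Rightarrow> (nat \<Rightarrow> real mat) \<Rightarrow>
    (int \<Rightarrow> nat \<Rightarrow> real) \<Rightarrow> real mat" where
  "Z_mat p k T \<mu> \<Phi> x = mat T k (\<lambda>(i, j). lag_mat p k T 0 x $$ (i, j)
     - (ones_mat T * \<mu>) $$ (i, j) - (\<Sum>r = 1..p. (lag_mat p k T r x * \<Phi> r) $$ (i, j)))"

definition Theta :: "nat \<Rightarrow> nat \<Rightarrow> (nat \<Rightarrow> real) \<Rightarrow> real mat" where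
  "Theta q T \<theta> = mat T T (\<lambda>(i, j). if j \<le> i \<and> i - j \<le> q then \<theta> (i - j) else 0)"

definition Theta_star :: "nat \<Rightarrow> (nat \<Rightarrow> real) \<Rightarrow> real mat" where
  "Theta_star q \<theta> = mat q q (\<lambda>(i, j). if i \<le> j then \<theta> (q - (j - i)) else 0)"

definition Theta_star_ext :: "nat \<Rightarrow> nat \<Rightarrow> (nat \<Rightarrow> real) \<Rightarrow> real mat" where
  "Theta_star_ext q T \<theta> = Theta_star q \<theta> @\<^sub>r 0\<^sub>m (T - q) q"

definition lambda_mat :: "nat \<Rightarrow> nat \<Rightarrow> (nat \<Rightarrow> real) \<Rightarrow> real mat" where
  "lambda_mat q T \<theta> = minv (Theta q T \<theta>) * Theta_star_ext q T \<theta>"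

definition gram_lambda :: "nat \<Rightarrow> nat \<Rightarrow> (nat \<Rightarrow> real) \<Rightarrow> real mat" where
  "gram_lambda q T \<theta> = (lambda_mat q T \<theta>)\<^sup>T * lambda_mat q T \<theta> + 1\<^sub>m q"

definition K_mat :: "nat \<Rightarrow> nat \<Rightarrow> (nat \<Rightarrow> real) \<Rightarrow> real mat" where
  "K_mat q T \<theta> =
     1\<^sub>m T - lambda_mat q T \<theta> * minv (gram_lambda q T \<theta>) * (lambda_mat q T \<theta>)\<^sup>T"

definition X_theta :: "nat \<Rightarrow> nat \<Rightarrow> nat \<Rightarrow> nat \<Rightarrow> (nat \<Rightarrow> real) \<Rightarrow>
    (int \<Rightarrow> nat \<Rightarrow> real) \<Rightarrow> real mat" where
  "X_theta p q k T \<theta> x = minv (Theta q T \<theta>) * lag_mat p k T 0 x"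

text \<open>The first n + 1 column blocks of the matrix of lagged regressors, built from left to right.\<close>

primrec lag_blocks :: "nat \<Rightarrow> nat \<Rightarrow> nat \<Rightarrow> nat \<Rightarrow> (nat \<Rightarrow> real) \<Rightarrow>
    (int \<Rightarrow> nat \<Rightarrow> real) \<Rightarrow> nat \<Rightarrow> real mat" where
  "lag_blocks p q k T \<theta> x 0 = minv (Theta q T \<theta>) * ones_mat T"
| "lag_blocks p q k T \<theta> x (Suc n) =
     lag_blocks p q k T \<theta> x n @\<^sub>c (minv (Theta q T \<theta>) * lag_mat p k T (Suc n) x)"

definition X_theta_lag :: "nat \<Rightarrow> nat \<Rightarrow> nat \<Rightarrow> nat \<Rightarrow> (nat \<Rightarrow> real) \<Rightarrow>
    (int \<Rightarrow> nat \<Rightarrow> real) \<Rightarrow> real mat" where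
  "X_theta_lag p q k T \<theta> x = lag_blocks p q k T \<theta> x p"

text \<open>The column of blocks \<mu>, \<Phi> 1, ..., \<Phi> n.\<close>

primrec stack_coeffs :: "real mat \<Rightarrow> (nat \<Rightarrow> real mat) \<Rightarrow> nat \<Rightarrow> real mat" where
  "stack_coeffs \<mu> \<Phi> 0 = \<mu>"
| "stack_coeffs \<mu> \<Phi> (Suc n) = stack_coeffs \<mu> \<Phi> n @\<^sub>r \<Phi> (Suc n)"

text \<open>With \<theta> 0 = 1 the summand for i = 0 is \<theta> l.\<close>

definition gamma_cov :: "nat \<Rightarrow> (nat \<Rightarrow> real) \<Rightarrow> nat \<Rightarrow> real" where
  "gamma_cov q \<theta> l = (if l \<le> q then \<Sum>i = 0..q - l. \<theta> i * \<theta> (l + i) else 0)"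

definition Sigma_mat :: "nat \<Rightarrow> nat \<Rightarrow> (nat \<Rightarrow> real) \<Rightarrow> real mat" where
  "Sigma_mat q T \<theta> = mat T T (\<lambda>(i, j). gamma_cov q \<theta> (if j \<le> i then i - j else j - i))"

definition varma_loglik :: "nat \<Rightarrow> nat \<Rightarrow> nat \<Rightarrow> nat \<Rightarrow> (nat \<Rightarrow> real) \<Rightarrow> real mat \<Rightarrow>
    (nat \<Rightarrow> real mat) \<Rightarrow> real mat \<Rightarrow> (int \<Rightarrow> nat \<Rightarrow> real) \<Rightarrow> real" where
  "varma_loglik p q k T \<theta> \<mu> \<Phi> \<Omega> x =
     - (real (T * k) / 2) * ln (2 * pi) - (real T / 2) * ln (mdet \<Omega>)
     - (real k / 2) * ln (mdet (gram_lambda q T \<theta>))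
     - (1 / 2) * mtrace ((Z_mat p k T \<mu> \<Phi> x)\<^sup>T * (minv (Theta q T \<theta>))\<^sup>T * K_mat q T \<theta>
         * minv (Theta q T \<theta>) * Z_mat p k T \<mu> \<Phi> x * minv \<Omega>)"

definition coeffs_opt :: "nat \<Rightarrow> nat \<Rightarrow> nat \<Rightarrow> nat \<Rightarrow> (nat \<Rightarrow> real) \<Rightarrow>
    (int \<Rightarrow> nat \<Rightarrow> real) \<Rightarrow> real mat" where
  "coeffs_opt p q k T \<theta> x =
     (let K = K_mat q T \<theta>; Y = X_theta p q k T \<theta> x; L = X_theta_lag p q k T \<theta> x
      in minv (L\<^sup>T * K * L) * L\<^sup>T * K * Y)"

definition Omega_opt :: "nat \<Rightarrow> nat \<Rightarrow> nat \<Rightarrow> nat \<Rightarrow> (nat \<Rightarrow> real) \<Rightarrow>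
    (int \<Rightarrow> nat \<Rightarrow> real) \<Rightarrow> real mat" where
  "Omega_opt p q k T \<theta> x =
     (let K = K_mat q T \<theta>; Y = X_theta p q k T \<theta> x; L = X_theta_lag p q k T \<theta> x
      in (1 / real T) \<cdot>\<^sub>m (Y\<^sup>T * K * Y - Y\<^sup>T * K * L * minv (L\<^sup>T * K * L) * L\<^sup>T * K * Y))"

definition coeff_space :: "nat \<Rightarrow> nat \<Rightarrow> (real mat \<times> (nat \<Rightarrow> real mat)) set" where
  "coeff_space p k =
     {(\<mu>, \<Phi>). \<mu> \<in> carrier_mat 1 k \<and> (\<forall>i \<in> {1..p}. \<Phi> i \<in> carrier_mat k k)}"


definition row_mat :: "nat \<Rightarrow> (nat \<Rightarrow> real) \<Rightarrow> real mat" where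
  "row_mat k v = mat 1 k (\<lambda>(_, j). v j)"

text \<open>Euclidean k-space with Lebesgue measure; its points are functions on {..<k}.\<close>

abbreviation lebesgue_space :: "nat \<Rightarrow> (nat \<Rightarrow> real) measure" where
  "lebesgue_space k \<equiv> PiM {..<k} (\<lambda>_. lborel)"

text \<open>Density of the centred Gaussian distribution with positive definite covariance
  matrix \<Omega>.\<close>

definition gaussian_density :: "nat \<Rightarrow> real mat \<Rightarrow> (nat \<Rightarrow> real) \<Rightarrow> real" where
  "gaussian_density k \<Omega> v =
     exp (- ((row_mat k v * minv \<Omega> * (row_mat k v)\<^sup>T) $$ (0, 0)) / 2)
       / sqrt ((2 * pi) ^ k * mdet \<Omega>)"

definition obs_path :: "int set \<Rightarrow> (int \<Rightarrow> 'a \<Rightarrow> nat \<Rightarrow> real) \<Rightarrow> 'a \<Rightarrow> int \<Rightarrow> nat \<Rightarrow> real" where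
  "obs_path I X \<omega> = (\<lambda>t \<in> I. X t \<omega>)"

text \<open>The model equation for the times p + 1, ..., p + T.  The errors that enter it have times
  p + 1 - q, ..., p + T, which may be negative, so time is an integer throughout.  The initial
  observations have an arbitrary joint law (possibly a point mass) and are independent of
  these errors: conditioning on them must leave the errors i.i.d. Gaussian.\<close>

definition varma_model :: "'a measure \<Rightarrow> nat \<Rightarrow> nat \<Rightarrow> nat \<Rightarrow> nat \<Rightarrow> (nat \<Rightarrow> real) \<Rightarrow> real mat \<Rightarrow>
    (nat \<Rightarrow> real mat) \<Rightarrow> real mat \<Rightarrow> (int \<Rightarrow> 'a \<Rightarrow> nat \<Rightarrow> real) \<Rightarrow> (int \<Rightarrow> 'a \<Rightarrow> nat \<Rightarrow> real) \<Rightarrow> bool"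
  where
  "varma_model M p q k T \<theta> \<mu> \<Phi> \<Omega> X \<epsilon> \<longleftrightarrow>
     (let E = {int p + 1 - int q..int p + int T} in
      prob_space M \<and>
      (\<mu>, \<Phi>) \<in> coeff_space p k \<and> pos_def k \<Omega> \<and>
      (\<forall>t \<in> {1..int p + int T}. X t \<in> measurable M (lebesgue_space k)) \<and>
      (\<forall>s \<in> E. distributed M (lebesgue_space k) (\<epsilon> s) (\<lambda>v. ennreal (gaussian_density k \<Omega> v))) \<and>
      prob_space.indep_vars M (\<lambda>_. lebesgue_space k) \<epsilon> E \<and>
      prob_space.indep_var M
        (PiM {1..int p} (\<lambda>_. lebesgue_space k)) (obs_path {1..int p} X)
        (PiM E (\<lambda>_. lebesgue_space k)) (obs_path E \<epsilon>) \<and>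
      (AE \<omega> in M. \<forall>t \<in> {int p + 1..int p + int T}. \<forall>j < k.
         X t \<omega> j = \<mu> $$ (0, j)
           + (\<Sum>i = 1..p. (row_mat k (X (t - int i) \<omega>) * \<Phi> i) $$ (0, j))
           + \<epsilon> t \<omega> j + (\<Sum>i = 1..q. \<theta> i * \<epsilon> (t - int i) \<omega> j)))"

text \<open>\<open>f w y\<close> is the logarithm of a conditional density at y, with respect to the reference
  measure N, of Y given W = w: the joint law of (W, Y) is the measure
  exp (f w y) N(dy) P_W(dw).\<close>

definition is_cond_loglik :: "'a measure \<Rightarrow> 'b measure \<Rightarrow> ('a \<Rightarrow> 'b) \<Rightarrow> 'c measure \<Rightarrow> ('a \<Rightarrow> 'c) \<Rightarrow>
    ('b \<Rightarrow> 'c \<Rightarrow> real) \<Rightarrow> bool" where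
  "is_cond_loglik M S W N Y f \<longleftrightarrow>
     W \<in> measurable M S \<and>
     distributed M (distr M S W \<Otimes>\<^sub>M N) (\<lambda>\<omega>. (W \<omega>, Y \<omega>)) (\<lambda>(w, y). ennreal (exp (f w y)))"

end

theory Submission
  imports Defs
begin

text \<open>In matrix form the model equation reads Z = Theta e + Theta-star-ext e', where the rows of e
  and e' are the errors at the times p + 1, ..., p + T and the q errors before them.  For fixed
  initial observations and fixed e', the map from the observations to e = minv Theta * Z - lambda e'
  is unit lower triangular up to translation, so it preserves Lebesgue measure and the joint density
  of the observations and e' is a product of Gaussian densities.  Completing the square,
  e' has a Gaussian density with precision matrix G = lambda' lambda + 1 (up to the column
  covariance), and with a Cholesky factor of G another triangular change of variables integrates
  it out; this produces the determinant term and K.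

  Writing K = C' C, the likelihood in (mu, Phi) is an ordinary least squares problem, and the maximum
  over Omega follows from ln det A <= tr A - n for positive definite A, which is
  ln x <= x - 1 on the diagonal of a Cholesky factor.\<close>

text \<open>No general Jacobian theorem is used. A time is a coordinate with values in k-dimensional
  space, and both substitutions (observations to errors, pre-sample errors to decorrelated ones) are
  triangular in time. Fubini therefore peels off one time after another, each step is an affine
  substitution in k real variables, and determinants arise only as products of diagonal entries. For
  this reason the Cholesky factor is taken as the lower triangular right factor in
  \<open>L\<^sup>T * L\<close>: the map from \<open>P\<close> to \<open>L * (P - m)\<close> then
  reads only current and earlier times. A second obstacle is that the initial observations are
  random. The conditional density is verified by testing with an arbitrary nonnegative measurable
  function of initial observations and sample, which requires the inverse substitution
  \<open>tri_inv\<close> to be measurable jointly in the initial observations, the pre-sample errors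
  and the errors. The integral of the Gaussian density is never computed; that it equals 1 is read
  off from the assumed law of an error.\<close>

lemma mult_assoc_dim: "dim_col A = dim_row B \<Longrightarrow> dim_col B = dim_row C \<Longrightarrow> (A * B) * C = A * (B * C :: real mat)"
  by (rule assoc_mult_mat[of _ "dim_row A" "dim_row B" _ "dim_row C" _ "dim_col C"]) auto

lemma mult_add_distrib_dim:
  "dim_row B = dim_row C \<Longrightarrow> dim_col B = dim_col C \<Longrightarrow> dim_col A = dim_row B \<Longrightarrow> A * (B + C) = A * B + A * (C :: real mat)"
  by (rule mult_add_distrib_mat[of _ "dim_row A" "dim_row B" _ "dim_col C" _]) auto

lemma add_mult_distrib_dim:
  "dim_row B = dim_row C \<Longrightarrow> dim_col B = dim_col C \<Longrightarrow> dim_col B = dim_row A \<Longrightarrow> (B + C) * A = B * A + C * (A :: real mat)"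
  by (rule add_mult_distrib_mat[of _ "dim_row C" "dim_col C" _ _ "dim_col A"]) auto

lemma mult_minus_distrib_dim:
  "dim_row B = dim_row C \<Longrightarrow> dim_col B = dim_col C \<Longrightarrow> dim_col A = dim_row B \<Longrightarrow> A * (B - C) = A * B - A * (C :: real mat)"
  by (rule mult_minus_distrib_mat[of _ "dim_row A" "dim_row B" _ "dim_col C" _]) auto

lemma minus_mult_distrib_dim:
  "dim_row B = dim_row C \<Longrightarrow> dim_col B = dim_col C \<Longrightarrow> dim_col B = dim_row A \<Longrightarrow> (B - C) * A = B * A - C * (A :: real mat)"
  by (rule minus_mult_distrib_mat[of _ "dim_row C" "dim_col C" _ _ "dim_col A"]) auto

lemma transpose_mult_dim: "dim_col A = dim_row B \<Longrightarrow> (A * B)\<^sup>T = B\<^sup>T * (A :: real mat)\<^sup>T"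
  by (rule transpose_mult[of _ "dim_row A" "dim_row B" _ "dim_col B"]) auto

lemma transpose_add_dim: "dim_row B = dim_row C \<Longrightarrow> dim_col B = dim_col C \<Longrightarrow> (B + C)\<^sup>T = B\<^sup>T + (C :: real mat)\<^sup>T"
  by (rule transpose_add[of _ "dim_row B" "dim_col B"]) auto

lemma transpose_minus_dim: "dim_row B = dim_row C \<Longrightarrow> dim_col B = dim_col C \<Longrightarrow> (B - C)\<^sup>T = B\<^sup>T - (C :: real mat)\<^sup>T"
  by (rule transpose_minus[of _ "dim_row B" "dim_col B"]) auto

text \<open>The side conditions of these rules are equations between dimensions of terms that occur
  in the redex, so conditional rewriting can discharge them; \<open>carrier_mat\<close> premises
  would introduce dimensions that matching does not determine.\<close>

lemmas mat_dim_simps = mult_add_distrib_dim add_mult_distrib_dim mult_minus_distrib_dim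
  minus_mult_distrib_dim transpose_mult_dim transpose_add_dim transpose_minus_dim

lemma left_mult_one_dim: "n = dim_row A \<Longrightarrow> 1\<^sub>m n * A = (A :: real mat)"
  by simp

lemma right_mult_one_dim: "n = dim_col A \<Longrightarrow> A * 1\<^sub>m n = (A :: real mat)"
  by simp

lemma mult_cancel_mid:
  "dim_col A = dim_row B \<Longrightarrow> dim_col B = dim_row C \<Longrightarrow> A * B = 1\<^sub>m (dim_row C) \<Longrightarrow> A * (B * C) = (C :: real mat)"
  by (simp flip: mult_assoc_dim)

subsection \<open>Inverses\<close>

lemma invertible_matI:
  assumes "A \<in> carrier_mat n n" "B \<in> carrier_mat n n" "A * B = 1\<^sub>m n"
  shows "invertible_mat (A :: real mat)"
  using assms mat_mult_left_right_inverse[OF assms]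
  by (auto simp: invertible_mat_def inverts_mat_def intro!: exI[of _ B])

text \<open>\<open>mat_inverse\<close> returns \<open>None\<close> only outside the units of the
  matrix ring, so any two-sided inverse makes \<open>minv\<close> meaningful. Later facts about
  \<open>minv\<close> rest on these three.\<close>

lemma minv_props:
  assumes A: "A \<in> carrier_mat n n" and "invertible_mat A"
  shows minv_carrier: "minv A \<in> carrier_mat n n"
    and mult_minv: "A * minv A = 1\<^sub>m n" and minv_mult: "minv A * A = 1\<^sub>m n"
proof -
  from assms(2) obtain B where B: "inverts_mat A B" "inverts_mat B A"
    by (auto simp: invertible_mat_def)
  have AB: "A * B = 1\<^sub>m n" using A B by (simp add: inverts_mat_def)
  have BA: "B * A = 1\<^sub>m (dim_row B)" using B by (simp add: inverts_mat_def)
  \<comment> \<open>\<open>inverts_mat\<close> leaves the shape of \<open>B\<close> open: the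
    equation for \<open>A * B\<close> gives its number of columns, the one for \<open>B * A\<close>
    its number of rows.\<close>
  have Bc: "B \<in> carrier_mat n n"
    using arg_cong[OF AB, of dim_col] arg_cong[OF BA, of dim_col] A by auto
  have "A \<in> Units (ring_mat TYPE(real) n ())"
    using A AB BA Bc by (auto simp: Units_def ring_mat_def)
  then obtain C where "mat_inverse A = Some C"
    using mat_inverse(1)[OF A, where b = "()"] by (cases "mat_inverse A") auto
  from mat_inverse(2)[OF A this] this show "minv A \<in> carrier_mat n n"
    "A * minv A = 1\<^sub>m n" "minv A * A = 1\<^sub>m n" by (auto simp: minv_def)
qed

lemma minv_eqI:
  assumes A: "A \<in> carrier_mat n n" and B: "B \<in> carrier_mat n n" and AB: "A * B = 1\<^sub>m n"
  shows "minv A = B"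
proof -
  have inv: "invertible_mat A" by (rule invertible_matI[OF assms])
  note m = minv_props[OF A inv]
  have "minv A = minv A * (A * B)" using m AB by simp
  also have "\<dots> = B" using m A B by (intro mult_cancel_mid) auto
  finally show ?thesis .
qed

lemma det_minv:
  assumes "A \<in> carrier_mat n n" "invertible_mat A"
  shows "mdet A * mdet (minv A) = 1"
  using det_mult[OF assms(1) minv_carrier[OF assms]] mult_minv[OF assms] by simp

lemma minv_transpose:
  assumes "A \<in> carrier_mat n n" "invertible_mat A"
  shows "minv (A\<^sup>T) = (minv A)\<^sup>T"
proof (rule minv_eqI[of _ n])
  note m = minv_props[OF assms]
  show "A\<^sup>T * (minv A)\<^sup>T = 1\<^sub>m n"
    using m assms by (subst transpose_mult_dim[symmetric]) auto
qed (use assms minv_carrier[OF assms] in auto)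

lemma invertible_mat_mult:
  assumes A: "A \<in> carrier_mat n n" "invertible_mat A" and B: "B \<in> carrier_mat n n" "invertible_mat B"
  shows "invertible_mat (A * B)" "minv (A * B) = minv B * minv A"
proof -
  note a = minv_props[OF A] and b = minv_props[OF B]
  have "A * B * (minv B * minv A) = A * (B * (minv B * minv A))"
    using a b A B by (subst mult_assoc_dim) auto
  also have "B * (minv B * minv A) = minv A"
    using a b A B by (intro mult_cancel_mid) auto
  finally have *: "A * B * (minv B * minv A) = 1\<^sub>m n" using a by simp
  show "invertible_mat (A * B)"
    by (rule invertible_matI[OF _ _ *]) (use a b A B in auto)
  show "minv (A * B) = minv B * minv A"
    by (rule minv_eqI[OF _ _ *]) (use a b A B in auto)
qed

lemma invertible_mat_if_det:
  assumes "A \<in> carrier_mat n n" "mdet A \<noteq> 0"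
  shows "invertible_mat A"
proof -
  obtain B where "B \<in> carrier_mat n n" "A * B = 1\<^sub>m n"
    using det_non_zero_imp_unit[OF assms, where b = "()"]
    by (auto simp: Units_def ring_mat_def)
  thus ?thesis using invertible_matI[OF assms(1)] by blast
qed

lemma invertible_mat_transpose:
  assumes "A \<in> carrier_mat n n" "invertible_mat A"
  shows "invertible_mat ((A :: real mat)\<^sup>T)"
proof (rule invertible_matI)
  show "A\<^sup>T * (minv A)\<^sup>T = 1\<^sub>m n"
    using minv_props[OF assms] assms by (subst transpose_mult_dim[symmetric]) auto
qed (use assms minv_carrier[OF assms] in auto)

subsection \<open>Positive definite matrices\<close>

lemma scalar_prod_self_sum: "scalar_prod v v = (\<Sum>i<dim_vec v. (v $ i)\<^sup>2)" for v :: "real vec"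
  by (simp add: scalar_prod_def power2_eq_square atLeast0LessThan)

lemma scalar_prod_self_nonneg: "0 \<le> scalar_prod v v" for v :: "real vec"
  by (simp add: scalar_prod_self_sum sum_nonneg)

lemma scalar_prod_self_pos:
  assumes "v \<in> carrier_vec n" "v \<noteq> 0\<^sub>v n"
  shows "0 < scalar_prod v (v :: real vec)"
proof -
  obtain i where "i < n" "v $ i \<noteq> 0" using assms by (metis carrier_vecD eq_vecI index_zero_vec(1) index_zero_vec(2))
  thus ?thesis using assms unfolding scalar_prod_self_sum
    by (intro sum_pos2[of _ i]) auto
qed

lemma scalar_prod_gram:
  assumes "C \<in> carrier_mat m n" "v \<in> carrier_vec n"
  shows "scalar_prod v (C\<^sup>T * C *\<^sub>v v) = scalar_prod (C *\<^sub>v v) (C *\<^sub>v v :: real vec)"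
proof -
  have "C\<^sup>T * C *\<^sub>v v = C\<^sup>T *\<^sub>v (C *\<^sub>v v)"
    using assms by (intro assoc_mult_mat_vec[of _ n m _ n]) auto
  thus ?thesis using assms transpose_vec_mult_scalar[of "C\<^sup>T" n m "C *\<^sub>v v" v] by simp
qed

lemma pos_def_gram:
  assumes C: "C \<in> carrier_mat n n" and inv: "invertible_mat C"
  shows "pos_def n (C\<^sup>T * C)"
  unfolding pos_def_def
proof (intro conjI ballI impI)
  fix v :: "real vec" assume v: "v \<in> carrier_vec n" "v \<noteq> 0\<^sub>v n"
  note m = minv_props[OF assms]
  have "v = minv C * C *\<^sub>v v" using m v by simp
  also have "\<dots> = minv C *\<^sub>v (C *\<^sub>v v)" using m v C by (intro assoc_mult_mat_vec) auto
  finally have "C *\<^sub>v v \<noteq> 0\<^sub>v n" using v m by auto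
  thus "0 < scalar_prod v (C\<^sup>T * C *\<^sub>v v)"
    unfolding scalar_prod_gram[OF C v(1)] using C v by (intro scalar_prod_self_pos) auto
qed (use C in \<open>auto simp: transpose_mult_dim\<close>)

text \<open>Induction by eliminating the last variable. The form \<open>b\<close> is the Schur
  complement of the entry \<open>a n n\<close>, and row \<open>n\<close> of the new factor is row
  \<open>n\<close> of \<open>a\<close> divided by the square root of that entry. Starting from the
  last index, rather than the first, yields the factorization with the lower triangular matrix on
  the right. Functions are used instead of matrices so that the induction needs no block
  decomposition.\<close>

lemma cholesky_fun:
  fixes a :: "nat \<Rightarrow> nat \<Rightarrow> real"
  assumes "\<And>i j. i < n \<Longrightarrow> j < n \<Longrightarrow> a i j = a j i"
    and "\<And>v. \<exists>i<n. v i \<noteq> 0 \<Longrightarrow> 0 < (\<Sum>i<n. \<Sum>j<n. v i * a i j * v j)"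
  shows "\<exists>l. (\<forall>i j. i < j \<longrightarrow> l i j = 0) \<and> (\<forall>i<n. 0 < l i i) \<and>
    (\<forall>i<n. \<forall>j<n. a i j = (\<Sum>m<n. l m i * l m j))"
  using assms
proof (induction n arbitrary: a)
  case 0
  show ?case by (intro exI[of _ "\<lambda>_ _. 0"]) auto
next
  case (Suc n)
  let ?d = "a n n"
  have d: "0 < ?d"
    using Suc.prems(2)[of "\<lambda>i. if i = n then 1 else 0"] by (simp add: if_distrib[of "\<lambda>x. x * _"] if_distrib[of "\<lambda>x. _ * x"] cong: if_cong)
  define b where "b = (\<lambda>i j. a i j - a i n * a n j / ?d)"
  have "\<exists>l. (\<forall>i j. i < j \<longrightarrow> l i j = 0) \<and> (\<forall>i<n. 0 < l i i) \<and>
    (\<forall>i<n. \<forall>j<n. b i j = (\<Sum>m<n. l m i * l m j))"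
  proof (rule Suc.IH)
    show "b i j = b j i" if "i < n" "j < n" for i j
      using Suc.prems(1)[of i j] Suc.prems(1)[of i n] Suc.prems(1)[of n j] that by (simp add: b_def)
  next
    fix v :: "nat \<Rightarrow> real" assume v: "\<exists>i<n. v i \<noteq> 0"
    define c where "c = (\<Sum>j<n. a n j * v j)"
    \<comment> \<open>The value of the last coordinate that minimises the form of \<open>a\<close>
      when the others are given by \<open>v\<close>; the minimum is the value of the form of
      \<open>b\<close> at \<open>v\<close>.\<close>
    define e where "e = - c / ?d"
    define w where "w = (\<lambda>i. if i < n then v i else e)"
    have s: "(\<Sum>i<n. v i * a i n) = c"
      unfolding c_def using Suc.prems(1) by (intro sum.cong) (auto simp: mult.commute)
    have 1: "0 < (\<Sum>i<Suc n. \<Sum>j<Suc n. w i * a i j * w j)"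
    proof (rule Suc.prems(2))
      from v obtain i where "i < n" "v i \<noteq> 0" by blast
      thus "\<exists>i<Suc n. w i \<noteq> 0" by (intro exI[of _ i]) (simp add: w_def)
    qed
    have r1: "(\<Sum>j<Suc n. w i * a i j * w j) = (\<Sum>j<n. v i * a i j * v j) + v i * a i n * e"
      if "i < n" for i using that by (simp add: w_def)
    have r2: "(\<Sum>j<Suc n. w n * a n j * w j) = e * c + e * ?d * e"
      by (simp add: w_def c_def sum_distrib_left mult.assoc)
    have "(\<Sum>i<Suc n. \<Sum>j<Suc n. w i * a i j * w j) =
        (\<Sum>i<n. (\<Sum>j<n. v i * a i j * v j) + v i * a i n * e) + (e * c + e * ?d * e)"
      unfolding sum.lessThan_Suc[of "\<lambda>i. \<Sum>j<Suc n. w i * a i j * w j"] r2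
      by (intro arg_cong2[of _ _ _ _ "(+)"] refl sum.cong) (simp only: r1 lessThan_iff)
    hence 2: "(\<Sum>i<Suc n. \<Sum>j<Suc n. w i * a i j * w j) =
        (\<Sum>i<n. \<Sum>j<n. v i * a i j * v j) + c * e + (e * c + e * ?d * e)"
      by (simp only: sum.distrib sum_distrib_right[symmetric] s)
    have 3: "c * e + (e * c + e * ?d * e) = - (c * c / ?d)"
      using d by (simp add: e_def)
    have 4: "(\<Sum>i<n. \<Sum>j<n. v i * (a i n * a n j / ?d) * v j) = c * c / ?d"
    proof -
      have "c * c / ?d = (\<Sum>i<n. v i * a i n) * (\<Sum>j<n. a n j * v j) / ?d"
        unfolding s c_def[symmetric] by (rule refl)
      also have "\<dots> = (\<Sum>i<n. \<Sum>j<n. v i * (a i n * a n j / ?d) * v j)"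
        unfolding sum_product sum_divide_distrib by (intro sum.cong) auto
      finally show ?thesis ..
    qed
    have "(\<Sum>i<n. \<Sum>j<n. v i * b i j * v j) = (\<Sum>i<n. \<Sum>j<n. v i * a i j * v j) - c * c / ?d"
      by (simp only: b_def right_diff_distrib left_diff_distrib sum_subtractf 4)
    with 1 2 3 show "0 < (\<Sum>i<n. \<Sum>j<n. v i * b i j * v j)" by linarith
  qed
  then obtain l where l: "\<And>i j. i < j \<Longrightarrow> l i j = 0" "\<And>i. i < n \<Longrightarrow> 0 < l i i"
    "\<And>i j. i < n \<Longrightarrow> j < n \<Longrightarrow> b i j = (\<Sum>m<n. l m i * l m j)" by blast
  define l' where "l' = (\<lambda>i j. if j < i \<and> i = n then a n j / sqrt ?d else if i = n \<and> j = n then sqrt ?d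
     else if j < n then l i j else 0)"
  have r: "sqrt ?d * sqrt ?d = ?d" using d by simp
  have E: "a i j = (\<Sum>m<Suc n. l' m i * l' m j)" if ij: "i < Suc n" "j < Suc n" for i j
  proof -
    consider "i < n" "j < n" | "i = n" "j < n" | "i < n" "j = n" | "i = n" "j = n" using ij by linarith
    thus ?thesis
    proof cases
      case 1
      thus ?thesis using l(3)[of i j] Suc.prems(1)[of i n] r d by (simp add: l'_def b_def)
    next
      case 3
      thus ?thesis using Suc.prems(1)[of i n] d by (simp add: l'_def)
    qed (use d in \<open>auto simp: l'_def\<close>)
  qed
  show ?case
  proof (rule exI[of _ l'], intro conjI allI impI)
    show "l' i j = 0" if "i < j" for i j using that l(1) by (simp add: l'_def)
    show "0 < l' i i" if "i < Suc n" for i using that l(2) d by (auto simp: l'_def less_Suc_eq)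
  qed (rule E)
qed

lemma cholesky:
  assumes "pos_def n A"
  obtains L where "L \<in> carrier_mat n n" "A = L\<^sup>T * L"
    "\<And>i j. i < j \<Longrightarrow> j < n \<Longrightarrow> L $$ (i, j) = 0" "\<And>i. i < n \<Longrightarrow> 0 < L $$ (i, i)"
    "invertible_mat L" "mdet L = (\<Prod>i<n. L $$ (i, i))" "0 < mdet L"
proof -
  from assms have A: "A \<in> carrier_mat n n" and sym: "A\<^sup>T = A"
    and pos: "\<And>v. v \<in> carrier_vec n \<Longrightarrow> v \<noteq> 0\<^sub>v n \<Longrightarrow> 0 < scalar_prod v (A *\<^sub>v v)"
    by (auto simp: pos_def_def)
  have "\<exists>l. (\<forall>i j. i < j \<longrightarrow> l i j = 0) \<and> (\<forall>i<n. 0 < l i i) \<and>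
    (\<forall>i<n. \<forall>j<n. A $$ (i, j) = (\<Sum>m<n. l m i * l m j))"
  proof (rule cholesky_fun)
    show "A $$ (i, j) = A $$ (j, i)" if "i < n" "j < n" for i j
      using arg_cong[OF sym, of "\<lambda>A. A $$ (i, j)"] A that by simp
  next
    fix v :: "nat \<Rightarrow> real" assume "\<exists>i<n. v i \<noteq> 0"
    then obtain i where "i < n" "v i \<noteq> 0" by blast
    hence "vec n v \<noteq> 0\<^sub>v n" by (metis index_vec index_zero_vec(1))
    hence "0 < scalar_prod (vec n v) (A *\<^sub>v vec n v)" by (intro pos) auto
    also have "\<dots> = (\<Sum>i<n. \<Sum>j<n. v i * A $$ (i, j) * v j)"
      using A by (simp add: scalar_prod_def atLeast0LessThan sum_distrib_left mult.assoc)
    finally show "0 < (\<Sum>i<n. \<Sum>j<n. v i * A $$ (i, j) * v j)" .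
  qed
  then obtain l where l: "\<And>i j. i < j \<Longrightarrow> l i j = 0" "\<And>i. i < n \<Longrightarrow> 0 < l i i"
    "\<And>i j. i < n \<Longrightarrow> j < n \<Longrightarrow> A $$ (i, j) = (\<Sum>m<n. l m i * l m j)" by blast
  define L where "L = mat n n (\<lambda>(i, j). l i j)"
  have Lc: "L \<in> carrier_mat n n" by (simp add: L_def)
  have det: "mdet L = (\<Prod>i<n. L $$ (i, i))"
    using det_lower_triangular[of n L] l(1) Lc
    by (simp add: prod_list_diag_prod atLeast0LessThan L_def)
  have pos: "0 < mdet L" unfolding det by (rule prod_pos) (use l(2) in \<open>auto simp: L_def\<close>)
  show thesis
  proof (rule that[OF Lc])
    show "A = L\<^sup>T * L"
      using A by (intro eq_matI) (auto simp: L_def scalar_prod_def l(3) atLeast0LessThan)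
    show "invertible_mat L" using pos Lc by (intro invertible_mat_if_det) auto
  qed (use l pos det in \<open>auto simp: L_def\<close>)
qed

lemma pos_def_det_pos: "pos_def n A \<Longrightarrow> 0 < mdet A"
proof -
  assume "pos_def n A"
  from cholesky[OF this] obtain L where L: "L \<in> carrier_mat n n" "A = L\<^sup>T * L" "0 < mdet L" by metis
  thus ?thesis by (simp add: det_mult[of _ n] det_transpose[of _ n])
qed

lemma pos_def_invertible: "pos_def n A \<Longrightarrow> invertible_mat A"
  using pos_def_det_pos[of n A] invertible_mat_if_det[of A n] by (auto simp: pos_def_def)

text \<open>\<open>D\<close> is the inverse of the Cholesky factor. Writing the inverse as
  \<open>D * D\<^sup>T\<close> turns traces against \<open>minv A\<close> into traces of symmetric
  congruences, by cyclicity.\<close>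

lemma pos_def_minv:
  assumes "pos_def n A"
  obtains D where "D \<in> carrier_mat n n" "invertible_mat D" "minv A = D * D\<^sup>T" "A = (minv D)\<^sup>T * minv D"
proof -
  from cholesky[OF assms] obtain L where L: "L \<in> carrier_mat n n" "A = L\<^sup>T * L" "invertible_mat L" by metis
  note m = minv_props[OF L(1,3)]
  have inv: "invertible_mat (minv L)" by (rule invertible_matI[OF m(1) L(1) m(3)])
  have mm: "minv (minv L) = L" by (rule minv_eqI[OF m(1) L(1) m(3)])
  show thesis
  proof (rule that[OF m(1) inv])
    show "minv A = minv L * (minv L)\<^sup>T" unfolding L(2)
      using L by (subst invertible_mat_mult(2)[of _ n]) (auto simp: minv_transpose[of _ n] invertible_mat_transpose)
    show "A = (minv (minv L))\<^sup>T * minv (minv L)" using L by (simp add: mm)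
  qed
qed

subsection \<open>Traces\<close>

lemma mtrace_add: "dim_row A = dim_row B \<Longrightarrow> dim_col A = dim_col B \<Longrightarrow> dim_row B = dim_col B \<Longrightarrow> mtrace (A + B) = mtrace A + mtrace B"
  by (simp add: mtrace_def sum.distrib)

lemma mtrace_comm:
  assumes "dim_col A = dim_row B" "dim_col B = dim_row A"
  shows "mtrace (A * B) = mtrace (B * A)"
proof -
  have "mtrace (A * B) = (\<Sum>i<dim_row A. \<Sum>j<dim_row B. A $$ (i, j) * B $$ (j, i))"
    using assms by (simp add: mtrace_def scalar_prod_def atLeast0LessThan)
  also have "\<dots> = mtrace (B * A)"
    using assms by (subst sum.swap) (simp add: mtrace_def scalar_prod_def atLeast0LessThan mult.commute)
  finally show ?thesis .
qed

lemma mtrace_gram: "mtrace (A\<^sup>T * A) = (\<Sum>j<dim_col A. \<Sum>i<dim_row A. (A $$ (i, j))\<^sup>2)"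
  by (simp add: mtrace_def scalar_prod_def atLeast0LessThan power2_eq_square)

text \<open>With \<open>minv \<Omega> = D * D\<^sup>T\<close> the trace is the squared Frobenius
  norm of \<open>M * D\<close>.\<close>

lemma mtrace_gram_minv_nonneg:
  assumes M: "M \<in> carrier_mat m k" and "pos_def k \<Omega>"
  shows "0 \<le> mtrace (M\<^sup>T * M * minv \<Omega>)"
proof -
  from pos_def_minv[OF assms(2)] obtain D where D: "D \<in> carrier_mat k k" "minv \<Omega> = D * D\<^sup>T" by metis
  have "mtrace (M\<^sup>T * M * minv \<Omega>) = mtrace ((M\<^sup>T * M * D) * D\<^sup>T)"
    using M D by (simp add: mult_assoc_dim)
  also have "\<dots> = mtrace ((M * D)\<^sup>T * (M * D))"
    using M D by (subst mtrace_comm) (simp_all add: mat_dim_simps mult_assoc_dim)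
  also have "\<dots> \<ge> 0" unfolding mtrace_gram by (intro sum_nonneg) auto
  finally show ?thesis .
qed

lemma ln_det_le_mtrace:
  assumes "pos_def n A"
  shows "ln (mdet A) \<le> mtrace A - real n"
proof -
  from cholesky[OF assms] obtain L where L: "L \<in> carrier_mat n n" "A = L\<^sup>T * L"
    "\<And>i. i < n \<Longrightarrow> 0 < L $$ (i, i)" "mdet L = (\<Prod>i<n. L $$ (i, i))" "0 < mdet L" by metis
  have "mdet A = mdet L * mdet L"
    unfolding L(2) using L(1) by (simp add: det_mult[of _ n] det_transpose[of _ n])
  hence "ln (mdet A) = 2 * ln (mdet L)" using L(5) by (simp add: ln_mult)
  also have "\<dots> = (\<Sum>i<n. ln ((L $$ (i, i))\<^sup>2))"
  proof -
    have nz: "L $$ (i, i) \<noteq> 0" if "i < n" for i using L(3)[OF that] by simp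
    have "ln (mdet L) = (\<Sum>i<n. ln (L $$ (i, i)))" unfolding L(4) by (rule ln_prod) (simp_all add: L(3) nz)
    also have "2 * \<dots> = (\<Sum>i<n. ln ((L $$ (i, i))\<^sup>2))"
      unfolding sum_distrib_left by (intro sum.cong) (use L(3) in \<open>auto simp: ln_realpow\<close>)
    finally show ?thesis .
  qed
  also have "\<dots> \<le> (\<Sum>i<n. (L $$ (i, i))\<^sup>2 - 1)"
    by (intro sum_mono ln_le_minus_one) (use L(3) in force)
  also have "\<dots> = (\<Sum>i<n. (L $$ (i, i))\<^sup>2) - n" by (simp add: sum_subtractf)
  \<comment> \<open>The trace of \<open>L\<^sup>T * L\<close> is the sum of the squares of all
    entries of \<open>L\<close>; the off-diagonal ones are dropped.\<close>
  also have "\<dots> \<le> mtrace A - n"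
    unfolding L(2) mtrace_gram using L(1) by (auto intro!: sum_mono member_le_sum)
  finally show ?thesis .
qed

text \<open>\<open>A * minv \<Omega>\<close> need not be symmetric, so the previous bound is applied
  to the congruent matrix \<open>D\<^sup>T * (A * D)\<close>, where
  \<open>minv \<Omega> = D * D\<^sup>T\<close>. It has the same trace, and its determinant is the
  quotient of the two determinants.\<close>

lemma ln_det_diff_le:
  assumes A: "pos_def n A" and W: "pos_def n \<Omega>"
  shows "ln (mdet A) - ln (mdet \<Omega>) \<le> mtrace (A * minv \<Omega>) - real n"
proof -
  from pos_def_minv[OF W] obtain D where D: "D \<in> carrier_mat n n" "invertible_mat D" "minv \<Omega> = D * D\<^sup>T"
     by metis
  from cholesky[OF A] obtain L where L: "L \<in> carrier_mat n n" "invertible_mat L" "A = L\<^sup>T * L" by metis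
  have Wc: "\<Omega> \<in> carrier_mat n n" and Ac: "A \<in> carrier_mat n n" using assms by (auto simp: pos_def_def)
  have pd: "pos_def n ((L * D)\<^sup>T * (L * D))"
    using L D by (intro pos_def_gram invertible_mat_mult) auto
  have eq: "(L * D)\<^sup>T * (L * D) = D\<^sup>T * (A * D)"
    using L D by (simp add: mat_dim_simps mult_assoc_dim)
  have "mtrace (A * minv \<Omega>) = mtrace ((A * D) * D\<^sup>T)"
    using D Ac by (simp add: mult_assoc_dim)
  also have "\<dots> = mtrace ((L * D)\<^sup>T * (L * D))"
    unfolding eq using D Ac by (intro mtrace_comm) auto
  finally have tr: "mtrace (A * minv \<Omega>) = mtrace ((L * D)\<^sup>T * (L * D))" .
  have "mdet ((L * D)\<^sup>T * (L * D)) = mdet A * (mdet D * mdet D)"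
    unfolding eq using D Ac by (simp add: det_mult[of _ n] det_transpose[of _ n])
  also have "mdet D * mdet D = mdet (minv \<Omega>)"
    using D by (simp add: det_mult[of _ n] det_transpose[of _ n])
  also have "mdet (minv \<Omega>) = 1 / mdet \<Omega>"
    using det_minv[OF Wc pos_def_invertible[OF W]] pos_def_det_pos[OF W] by (simp add: field_simps)
  finally have "ln (mdet ((L * D)\<^sup>T * (L * D))) = ln (mdet A) - ln (mdet \<Omega>)"
    using pos_def_det_pos[OF A] pos_def_det_pos[OF W] by (simp add: ln_div)
  thus ?thesis using ln_det_le_mtrace[OF pd] tr by simp
qed


subsection \<open>Generalised least squares\<close>

lemma mat_cancel_simps:
  fixes A B C D :: "real mat"
  assumes "A \<in> carrier_mat n m" "B \<in> carrier_mat n m"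
  shows "A - (A - B) = B" "A - B + B = A" "A + B - B = A" "A - A = 0\<^sub>m n m"
  using assms by (auto intro!: eq_matI)

text \<open>The residual \<open>R\<close> is orthogonal to the columns of \<open>l\<close>, so the
  cross terms vanish and Pythagoras holds. The decomposition is kept as an identity of matrices, not
  of traces, so that it can be traced against the inverse of any covariance matrix.\<close>

lemma normal_equations:
  fixes l y :: "real mat"
  assumes l: "l \<in> carrier_mat T N" and y: "y \<in> carrier_mat T k"
    and inv: "invertible_mat (l\<^sup>T * l)"
  defines "B \<equiv> minv (l\<^sup>T * l) * l\<^sup>T * y"
  defines "R \<equiv> y - l * B"
  shows "B \<in> carrier_mat N k" "R \<in> carrier_mat T k"
    and "R\<^sup>T * R = y\<^sup>T * y - y\<^sup>T * l * minv (l\<^sup>T * l) * l\<^sup>T * y"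
    and "C \<in> carrier_mat N k \<Longrightarrow>
      (y - l * C)\<^sup>T * (y - l * C) = R\<^sup>T * R + (l * (B - C))\<^sup>T * (l * (B - C))"
proof -
  have H: "l\<^sup>T * l \<in> carrier_mat N N" using l by auto
  note m = minv_props[OF H inv]
  show Bc: "B \<in> carrier_mat N k" using m l y by (auto simp: B_def)
  show Rc: "R \<in> carrier_mat T k" using l y Bc by (auto simp: R_def)
  have "(l\<^sup>T * l) * B = l\<^sup>T * y"
    unfolding B_def using m l y by (simp only: mult_assoc_dim[of "minv (l\<^sup>T * l)"] carrier_matD index_transpose_mat)
     (intro mult_cancel_mid, auto)
  hence lR: "l\<^sup>T * R = 0\<^sub>m N k"
    unfolding R_def using l y Bc by (simp add: mat_dim_simps mult_assoc_dim mat_cancel_simps[of _ N k])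
  have Rl: "R\<^sup>T * l = 0\<^sub>m k N"
    using arg_cong[OF lR, of transpose_mat] l Rc by (simp add: transpose_mult_dim)
  have yR: "y = R + l * B" unfolding R_def using l y Bc by (intro eq_matI) auto
  have "R\<^sup>T * R = y\<^sup>T * R"
  proof -
    have "y\<^sup>T * R = R\<^sup>T * R + B\<^sup>T * (l\<^sup>T * R)"
      by (subst (1) yR) (use l Rc Bc in \<open>simp add: mat_dim_simps mult_assoc_dim\<close>)
    thus ?thesis unfolding lR using Bc Rc by simp
  qed
  also have "\<dots> = y\<^sup>T * y - y\<^sup>T * l * minv (l\<^sup>T * l) * l\<^sup>T * y"
    unfolding R_def B_def using l y m by (simp add: mat_dim_simps mult_assoc_dim)
  finally show "R\<^sup>T * R = y\<^sup>T * y - y\<^sup>T * l * minv (l\<^sup>T * l) * l\<^sup>T * y" .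
  assume C: "C \<in> carrier_mat N k"
  define E where "E = B - C"
  have E: "E \<in> carrier_mat N k" using Bc C by (auto simp: E_def)
  have "y - l * C = R + l * E"
    unfolding R_def E_def using l y Bc C
    by (simp add: mult_minus_distrib_dim) (intro eq_matI, auto)
  hence "(y - l * C)\<^sup>T * (y - l * C) = (R\<^sup>T * R + (R\<^sup>T * l) * E) + (E\<^sup>T * (l\<^sup>T * R) + (l * E)\<^sup>T * (l * E))"
    using E l Rc by (simp add: mat_dim_simps mult_assoc_dim)
      (intro eq_matI, auto)
  also have "\<dots> = R\<^sup>T * R + (l * E)\<^sup>T * (l * E)"
  proof -
    have P: "(l * E)\<^sup>T * (l * E) \<in> carrier_mat k k" and Q: "R\<^sup>T * R \<in> carrier_mat k k"
      and "0\<^sub>m k N * E = 0\<^sub>m k k" and "E\<^sup>T * 0\<^sub>m N k = 0\<^sub>m k k"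
      using E Rc l by auto
    thus ?thesis unfolding lR Rl by (simp add: left_add_zero_mat[OF P] right_add_zero_mat[OF Q])
  qed
  finally show "(y - l * C)\<^sup>T * (y - l * C) = R\<^sup>T * R + (l * (B - C))\<^sup>T * (l * (B - C))"
    by (simp add: E_def)
qed

lemma smult_mult_mat_vec:
  "dim_col A = dim_vec v \<Longrightarrow> c \<cdot>\<^sub>m A *\<^sub>v v = c \<cdot>\<^sub>v (A *\<^sub>v (v :: real vec))"
  by (intro eq_vecI) auto

text \<open>A vector annihilated by \<open>R\<close> would be annihilated by the invertible matrix.
  This places an invertible optimal covariance matrix inside the feasible set of the
  maximisation.\<close>

lemma pos_def_if_invertible_gram:
  assumes R: "R \<in> carrier_mat T k" and inv: "invertible_mat (c \<cdot>\<^sub>m (R\<^sup>T * R))" and c: "0 < (c :: real)"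
  shows "pos_def k (c \<cdot>\<^sub>m (R\<^sup>T * R))"
  unfolding pos_def_def
proof (intro conjI ballI impI)
  have Ac: "c \<cdot>\<^sub>m (R\<^sup>T * R) \<in> carrier_mat k k" using R by auto
  note m = minv_props[OF Ac inv]
  show "c \<cdot>\<^sub>m (R\<^sup>T * R) \<in> carrier_mat k k" by fact
  show "(c \<cdot>\<^sub>m (R\<^sup>T * R))\<^sup>T = c \<cdot>\<^sub>m (R\<^sup>T * R)"
  proof -
    have "(c \<cdot>\<^sub>m (R\<^sup>T * R))\<^sup>T = c \<cdot>\<^sub>m (R\<^sup>T * R)\<^sup>T" by (intro eq_matI) auto
    thus ?thesis using R by (simp add: transpose_mult_dim)
  qed
  fix v :: "real vec" assume v: "v \<in> carrier_vec k" "v \<noteq> 0\<^sub>v k"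
  have RRv: "(R\<^sup>T * R) *\<^sub>v v = R\<^sup>T *\<^sub>v (R *\<^sub>v v)" using R v by (intro assoc_mult_mat_vec) auto
  have Av: "c \<cdot>\<^sub>m (R\<^sup>T * R) *\<^sub>v v = c \<cdot>\<^sub>v ((R\<^sup>T * R) *\<^sub>v v)"
    using R v by (intro smult_mult_mat_vec) auto
  have "R *\<^sub>v v \<noteq> 0\<^sub>v T"
  proof
    assume z: "R *\<^sub>v v = 0\<^sub>v T"
    have "v = (minv (c \<cdot>\<^sub>m (R\<^sup>T * R)) * (c \<cdot>\<^sub>m (R\<^sup>T * R))) *\<^sub>v v" using m v by simp
    also have "\<dots> = minv (c \<cdot>\<^sub>m (R\<^sup>T * R)) *\<^sub>v (c \<cdot>\<^sub>m (R\<^sup>T * R) *\<^sub>v v)"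
      using m v Ac by (intro assoc_mult_mat_vec) auto
    also have "c \<cdot>\<^sub>m (R\<^sup>T * R) *\<^sub>v v = 0\<^sub>v k" unfolding Av RRv z using R by (intro eq_vecI) auto
    finally show False using v m by auto
  qed
  hence "0 < scalar_prod (R *\<^sub>v v) (R *\<^sub>v v)" using R v by (intro scalar_prod_self_pos) auto
  thus "0 < scalar_prod v (c \<cdot>\<^sub>m (R\<^sup>T * R) *\<^sub>v v)"
    unfolding Av using R v c scalar_prod_gram[OF R v(1)]
    by (simp del: assoc_mult_mat_vec)
qed

subsection \<open>Rank-q updates of the identity\<close>

text \<open>Sylvester's determinant identity. Both \<open>U * M\<close> and \<open>M * U\<close> are
  block triangular; their diagonal blocks are an identity and one of the two matrices to be
  compared, and the two products have the same determinant.\<close>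

lemma det_one_plus_mult_swap:
  fixes A B :: "real mat"
  assumes A: "A \<in> carrier_mat n m" and B: "B \<in> carrier_mat m n"
  shows "mdet (1\<^sub>m n + A * B) = mdet (1\<^sub>m m + B * A)"
proof -
  define M where "M = four_block_mat (1\<^sub>m n) (- A) B (1\<^sub>m m)"
  define U where "U = four_block_mat (1\<^sub>m n) A (0\<^sub>m m n) (1\<^sub>m m)"
  have Mc: "M \<in> carrier_mat (n + m) (n + m)" and Uc: "U \<in> carrier_mat (n + m) (n + m)"
    using A B by (auto simp: M_def U_def)
  have zero: "A + - A = 0\<^sub>m n m" using A by (intro eq_matI) auto
  have zero': "- A + A = 0\<^sub>m n m" using A by (intro eq_matI) auto
  have comm: "B * A + 1\<^sub>m m = 1\<^sub>m m + B * A" using A B by (intro eq_matI) auto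
  have "U * M = four_block_mat (1\<^sub>m n + A * B) (0\<^sub>m n m) B (1\<^sub>m m)"
    unfolding U_def M_def
    by (subst mult_four_block_mat[of _ n n _ m _ m _ _ n _ m]) (use A B zero' in auto)
  hence 1: "mdet U * mdet M = mdet (1\<^sub>m n + A * B)"
    using det_four_block_mat_upper_right_zero[of "1\<^sub>m n + A * B" n "0\<^sub>m n m" m B "1\<^sub>m m"]
      det_mult[OF Uc Mc] A B by simp
  have "M * U = four_block_mat (1\<^sub>m n) (0\<^sub>m n m) B (1\<^sub>m m + B * A)"
    unfolding U_def M_def
    by (subst mult_four_block_mat[of _ n n _ m _ m _ _ n _ m]) (use A B zero comm in auto)
  hence 2: "mdet M * mdet U = mdet (1\<^sub>m m + B * A)"
    using det_four_block_mat_upper_right_zero[of "1\<^sub>m n" n "0\<^sub>m n m" m B "1\<^sub>m m + B * A"]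
      det_mult[OF Mc Uc] A B by simp
  show ?thesis using 1 2 by (simp add: mult.commute)
qed

lemma pos_def_one_plus_gram:
  assumes A: "A \<in> carrier_mat m n"
  shows "pos_def n (1\<^sub>m n + A\<^sup>T * A)"
  unfolding pos_def_def
proof (intro conjI ballI impI)
  fix v :: "real vec" assume v: "v \<in> carrier_vec n" "v \<noteq> 0\<^sub>v n"
  have "scalar_prod v ((1\<^sub>m n + A\<^sup>T * A) *\<^sub>v v) = scalar_prod v v + scalar_prod v (A\<^sup>T * A *\<^sub>v v)"
    using A v by (subst add_mult_distrib_mat_vec[of _ n n])
      (auto intro!: scalar_prod_add_distrib[of _ n] mult_mat_vec_carrier[of _ n n] simp del: assoc_mult_mat_vec)
  also have "\<dots> > 0"
    using scalar_prod_self_pos[OF v] scalar_prod_gram[OF A v(1)] scalar_prod_self_nonneg[of "A *\<^sub>v v"] by simp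
  finally show "0 < scalar_prod v ((1\<^sub>m n + A\<^sup>T * A) *\<^sub>v v)" .
qed (use A in \<open>auto simp: mat_dim_simps\<close>)

text \<open>In the expanded product the terms containing \<open>minv G\<close> collect to
  \<open>A * (G * minv G) * A\<^sup>T\<close>, which cancels the update
  \<open>A * A\<^sup>T\<close>.\<close>

lemma woodbury:
  fixes A :: "real mat"
  assumes A: "A \<in> carrier_mat n m"
  defines "G \<equiv> A\<^sup>T * A + 1\<^sub>m m"
  shows "(1\<^sub>m n + A * A\<^sup>T) * (1\<^sub>m n - A * minv G * A\<^sup>T) = 1\<^sub>m n" and "pos_def m G"
proof -
  have Gc: "G \<in> carrier_mat m m" using A by (auto simp: G_def)
  have "G = 1\<^sub>m m + A\<^sup>T * A" unfolding G_def using A by (intro eq_matI) auto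
  thus pd: "pos_def m G" using pos_def_one_plus_gram[OF A] by simp
  note m = minv_props[OF Gc pos_def_invertible[OF pd]]
  have "A * A\<^sup>T * (A * minv G * A\<^sup>T) + A * minv G * A\<^sup>T = A * ((G * minv G) * A\<^sup>T)"
    using A m(1) unfolding G_def by (simp add: mat_dim_simps mult_assoc_dim)
  also have "\<dots> = A * A\<^sup>T" using A m by simp
  finally have e: "A * A\<^sup>T * (A * minv G * A\<^sup>T) + A * minv G * A\<^sup>T = A * A\<^sup>T" .
  have "(1\<^sub>m n + A * A\<^sup>T) * (1\<^sub>m n - A * minv G * A\<^sup>T) =
    (1\<^sub>m n + A * A\<^sup>T) - (A * A\<^sup>T * (A * minv G * A\<^sup>T) + A * minv G * A\<^sup>T)"
    using A m by (simp only: mat_dim_simps carrier_matD index_mult_mat index_transpose_mat index_minus_mat index_one_mat index_add_mat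
       left_mult_one_dim right_mult_one_dim)
      (intro eq_matI, auto)
  also have "\<dots> = 1\<^sub>m n" unfolding e using A by (intro eq_matI) auto
  finally show "(1\<^sub>m n + A * A\<^sup>T) * (1\<^sub>m n - A * minv G * A\<^sup>T) = 1\<^sub>m n" .
qed

lemma sum_lessThan_add: "(\<Sum>l<a + b. f l) = (\<Sum>l<a. f l) + (\<Sum>l<b. f (a + l))" for f :: "nat \<Rightarrow> real"
  by (induction b) auto

lemma append_cols_mult_append_rows:
  fixes A B C D :: "real mat"
  assumes "A \<in> carrier_mat n a" "B \<in> carrier_mat n b" "C \<in> carrier_mat a m" "D \<in> carrier_mat b m"
  shows "(A @\<^sub>c B) * (C @\<^sub>r D) = A * C + B * D"
proof (rule eq_matI)
  show "((A @\<^sub>c B) * (C @\<^sub>r D)) $$ (i, j) = (A * C + B * D) $$ (i, j)"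
    if "i < dim_row (A * C + B * D)" "j < dim_col (A * C + B * D)" for i j
  proof -
    have ij: "i < n" "j < m" using that assms by auto
    have "((A @\<^sub>c B) * (C @\<^sub>r D)) $$ (i, j) =
      (\<Sum>l<a + b. (A @\<^sub>c B) $$ (i, l) * (C @\<^sub>r D) $$ (l, j))"
      using assms ij by (simp add: append_columns_def append_rows_def scalar_prod_def atLeast0LessThan)
    also have "\<dots> = (\<Sum>l<a. A $$ (i, l) * C $$ (l, j)) + (\<Sum>l<b. B $$ (i, l) * D $$ (l, j))"
      unfolding sum_lessThan_add using assms ij by (simp add: append_columns_def append_rows_def)
    also have "\<dots> = (A * C + B * D) $$ (i, j)"
      using assms ij by (simp add: scalar_prod_def atLeast0LessThan)
    finally show ?thesis .
  qed
qed (use assms in \<open>auto simp: append_columns_def append_rows_def\<close>)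

subsection \<open>The moving average matrices\<close>

lemma Theta_carrier [simp]: "Theta q T \<theta> \<in> carrier_mat T T"
  by (simp add: Theta_def)

lemma Theta_dim [simp]: "dim_row (Theta q T \<theta>) = T" "dim_col (Theta q T \<theta>) = T"
  by (simp_all add: Theta_def)

lemma Theta_star_ext_carrier: "q \<le> T \<Longrightarrow> Theta_star_ext q T \<theta> \<in> carrier_mat T q"
  using carrier_append_rows[of "Theta_star q \<theta>" q q "0\<^sub>m (T - q) q" "T - q"]
  by (simp add: Theta_star_ext_def Theta_star_def)

lemma Theta_star_ext_index:
  assumes "q \<le> T" "i < T" "j < q"
  shows "Theta_star_ext q T \<theta> $$ (i, j) = (if i \<le> j then \<theta> (q - (j - i)) else 0)"
  using assms by (auto simp: Theta_star_ext_def Theta_star_def append_rows_def)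

lemma det_Theta:
  assumes "\<theta> 0 = 1"
  shows "mdet (Theta q T \<theta>) = 1"
  using det_lower_triangular[of T "Theta q T \<theta>"] assms
  by (simp add: prod_list_diag_prod Theta_def)

lemma invertible_Theta: "\<theta> 0 = 1 \<Longrightarrow> invertible_mat (Theta q T \<theta>)"
  by (rule invertible_mat_if_det[of _ T]) (simp_all add: det_Theta)

text \<open>Strong induction on the row. In entry (i, j) of \<open>Theta\<close> times its inverse,
  a factor with index l < i meets an entry of the inverse that vanishes by induction, one with l > i
  meets a zero of \<open>Theta\<close>, and the diagonal of \<open>Theta\<close> is 1. Hence an
  error depends on observations up to its own time only, and on the current one with coefficient
  1.\<close>

lemma minv_Theta_triangular:
  assumes "\<theta> 0 = 1" "j < T" "i \<le> j"
  shows "minv (Theta q T \<theta>) $$ (i, j) = (if i = j then 1 else 0)"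
  using assms(3)
proof (induction i rule: less_induct)
  case (less i)
  note m = minv_props[OF Theta_carrier invertible_Theta[of \<theta> q T, OF assms(1)]]
  let ?N = "minv (Theta q T \<theta>)"
  have iT: "i < T" using less.prems assms by simp
  have "(if i = j then 1 else 0) = (Theta q T \<theta> * ?N) $$ (i, j)"
    using iT assms m by simp
  also have "\<dots> = (\<Sum>l<T. Theta q T \<theta> $$ (i, l) * ?N $$ (l, j))"
    using iT assms m(1) by (simp add: scalar_prod_def atLeast0LessThan)
  also have "\<dots> = (\<Sum>l\<in>{i}. Theta q T \<theta> $$ (i, l) * ?N $$ (l, j))"
  proof (rule sum.mono_neutral_right)
    show "\<forall>l\<in>{..<T} - {i}. Theta q T \<theta> $$ (i, l) * ?N $$ (l, j) = 0"
    proof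
      fix l assume l: "l \<in> {..<T} - {i}"
      show "Theta q T \<theta> $$ (i, l) * ?N $$ (l, j) = 0"
      proof (cases "l < i")
        case True
        thus ?thesis using less.IH[of l] less.prems by simp
      next
        case False
        thus ?thesis using l iT by (simp add: Theta_def)
      qed
    qed
  qed (use iT in auto)
  also have "\<dots> = ?N $$ (i, j)" using iT assms by (simp add: Theta_def)
  finally show ?case ..
qed

lemma Sigma_eq:
  assumes "q \<le> T"
  shows "Sigma_mat q T \<theta> = Theta q T \<theta> * (Theta q T \<theta>)\<^sup>T + Theta_star_ext q T \<theta> * (Theta_star_ext q T \<theta>)\<^sup>T"
    (is "_ = ?R")
proof -
  note Ec = Theta_star_ext_carrier[OF assms, of \<theta>]
  text \<open>Both products are sums over the times of the errors; numbering these times from -q,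
    the extended row i of the moving average has entry c i m at time m - q.\<close>
  define c where "c = (\<lambda>i m. if i \<le> m \<and> m \<le> i + q then \<theta> (q + i - m) else 0)"
  have R: "?R $$ (i, j) = (\<Sum>m<q + T. c i m * c j m)" if ij: "i < T" "j < T" for i j
  proof -
    have "?R $$ (i, j) = (\<Sum>m<T. Theta q T \<theta> $$ (i, m) * Theta q T \<theta> $$ (j, m)) +
        (\<Sum>m<q. Theta_star_ext q T \<theta> $$ (i, m) * Theta_star_ext q T \<theta> $$ (j, m))"
      using ij Ec carrier_matD[OF Theta_carrier] by (simp add: scalar_prod_def atLeast0LessThan)
    also have "(\<Sum>m<T. Theta q T \<theta> $$ (i, m) * Theta q T \<theta> $$ (j, m)) = (\<Sum>m\<in>{q..<q+T}. c i m * c j m)"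
      by (rule sum.reindex_bij_witness[of _ "\<lambda>m. m - q" "\<lambda>m. m + q"])
        (use ij in \<open>auto simp: c_def Theta_def\<close>)
    also have "(\<Sum>m<q. Theta_star_ext q T \<theta> $$ (i, m) * Theta_star_ext q T \<theta> $$ (j, m)) = (\<Sum>m\<in>{0..<q}. c i m * c j m)"
      by (rule sum.cong) (use ij assms in \<open>auto simp: c_def Theta_star_ext_index algebra_simps\<close>)
    also have "(\<Sum>m\<in>{q..<q+T}. c i m * c j m) + (\<Sum>m\<in>{0..<q}. c i m * c j m) = (\<Sum>m<q + T. c i m * c j m)"
      using sum.atLeastLessThan_concat[of 0 q "q + T" "\<lambda>m. c i m * c j m"] by (simp add: lessThan_atLeast0)
    finally show ?thesis .
  qed
  have S: "(\<Sum>m<q + T. c i m * c j m) = gamma_cov q \<theta> (i - j)" if ij: "j \<le> i" "i < T" for i j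
  proof -
    have "(\<Sum>m<q + T. c i m * c j m) = (\<Sum>m\<in>{i..j + q}. \<theta> (q + i - m) * \<theta> (q + j - m))"
      by (rule sum.mono_neutral_cong_right) (use ij in \<open>auto simp: c_def add.commute\<close>)
    also have "\<dots> = gamma_cov q \<theta> (i - j)"
    proof (cases "i - j \<le> q")
      case True
      \<comment> \<open>The new index s = q + j - m is the lag of the error at time m - q seen from
        the earlier row \<open>j\<close>.\<close>
      have "(\<Sum>m\<in>{i..j + q}. \<theta> (q + i - m) * \<theta> (q + j - m)) = (\<Sum>s=0..q - (i - j). \<theta> s * \<theta> (i - j + s))"
        by (rule sum.reindex_bij_witness[of _ "\<lambda>s. q + j - s" "\<lambda>m. q + j - m"])
          (use ij True in \<open>auto simp: mult.commute add.commute\<close>)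
      thus ?thesis using True by (simp add: gamma_cov_def)
    next
      case False
      thus ?thesis using ij by (simp add: gamma_cov_def)
    qed
    finally show ?thesis .
  qed
  show ?thesis
  proof (rule eq_matI)
    fix i j assume "i < dim_row ?R" "j < dim_col ?R"
    hence ij: "i < T" "j < T" using Ec by auto
    have "(\<Sum>m<q + T. c i m * c j m) = (\<Sum>m<q + T. c j m * c i m)" by (simp add: mult.commute)
    thus "Sigma_mat q T \<theta> $$ (i, j) = ?R $$ (i, j)"
      unfolding R[OF ij] using S[of i j] S[of j i] ij by (auto simp: Sigma_mat_def)
  qed (use Ec in \<open>auto simp: Sigma_mat_def\<close>)
qed

section \<open>The matrices lambda, K and Sigma\<close>

context
  fixes p q k T :: nat and \<theta> :: "nat \<Rightarrow> real"
  assumes \<theta>0: "\<theta> 0 = 1" and qT: "q \<le> T"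
begin

lemmas minv_Theta = minv_props[OF Theta_carrier invertible_Theta[of \<theta> q T, OF \<theta>0]]

lemma lambda_carrier: "lambda_mat q T \<theta> \<in> carrier_mat T q"
  using minv_Theta(1) Theta_star_ext_carrier[OF qT] by (simp add: lambda_mat_def)

lemma Theta_lambda: "Theta q T \<theta> * lambda_mat q T \<theta> = Theta_star_ext q T \<theta>"
  using minv_Theta carrier_matD[OF Theta_star_ext_carrier[OF qT, of \<theta>]]
  unfolding lambda_mat_def by (intro mult_cancel_mid) auto

lemma gram_lambda_pos_def: "pos_def q (gram_lambda q T \<theta>)"
  unfolding gram_lambda_def using woodbury(2)[OF lambda_carrier] .

lemma gram_lambda_carrier: "gram_lambda q T \<theta> \<in> carrier_mat q q"
  using gram_lambda_pos_def by (simp add: pos_def_def)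

lemma K_carrier: "K_mat q T \<theta> \<in> carrier_mat T T"
  using lambda_carrier minv_props(1)[OF gram_lambda_carrier pos_def_invertible[OF gram_lambda_pos_def]]
  unfolding K_mat_def by (intro minus_carrier_mat) auto

lemma update_pos_def: "pos_def T (1\<^sub>m T + lambda_mat q T \<theta> * (lambda_mat q T \<theta>)\<^sup>T)"
  using pos_def_one_plus_gram[of "(lambda_mat q T \<theta>)\<^sup>T" q T] lambda_carrier by simp

lemma update_carrier: "1\<^sub>m T + lambda_mat q T \<theta> * (lambda_mat q T \<theta>)\<^sup>T \<in> carrier_mat T T"
  using update_pos_def by (simp add: pos_def_def)

lemma update_mult_K: "(1\<^sub>m T + lambda_mat q T \<theta> * (lambda_mat q T \<theta>)\<^sup>T) * K_mat q T \<theta> = 1\<^sub>m T"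
  unfolding K_mat_def gram_lambda_def by (rule woodbury(1)[OF lambda_carrier])

lemma minv_update: "minv (1\<^sub>m T + lambda_mat q T \<theta> * (lambda_mat q T \<theta>)\<^sup>T) = K_mat q T \<theta>"
  by (rule minv_eqI[OF update_carrier K_carrier update_mult_K])

lemma K_mult_update: "K_mat q T \<theta> * (1\<^sub>m T + lambda_mat q T \<theta> * (lambda_mat q T \<theta>)\<^sup>T) = 1\<^sub>m T"
  by (rule mat_mult_left_right_inverse[OF update_carrier K_carrier update_mult_K])

lemma invertible_K: "invertible_mat (K_mat q T \<theta>)"
  by (rule invertible_matI[OF K_carrier update_carrier K_mult_update])

lemma minv_K: "minv (K_mat q T \<theta>) = 1\<^sub>m T + lambda_mat q T \<theta> * (lambda_mat q T \<theta>)\<^sup>T"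
  by (rule minv_eqI[OF K_carrier update_carrier K_mult_update])

lemma K_gram:
  obtains C where "C \<in> carrier_mat T T" "K_mat q T \<theta> = C\<^sup>T * C"
proof -
  from pos_def_minv[OF update_pos_def] obtain D where
    "D \<in> carrier_mat T T" "K_mat q T \<theta> = D * D\<^sup>T" unfolding minv_update by metis
  thus thesis using that[of "D\<^sup>T"] by simp
qed

text \<open>Since \<open>Theta\<close> maps \<open>lambda_mat\<close> to
  \<open>Theta_star_ext\<close>, conjugating the update of the identity by \<open>Theta\<close>
  produces exactly the two products in \<open>Sigma_eq\<close>.\<close>

lemma Sigma_factor: "Sigma_mat q T \<theta> = Theta q T \<theta> * minv (K_mat q T \<theta>) * (Theta q T \<theta>)\<^sup>T"
  unfolding Sigma_eq[OF qT] minv_K Theta_lambda[symmetric]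
  using lambda_carrier carrier_matD[OF Theta_carrier, of q T \<theta>] by (simp add: mat_dim_simps mult_assoc_dim)

lemma Sigma_inverse:
  "invertible_mat (Sigma_mat q T \<theta>)"
  "minv (Sigma_mat q T \<theta>) = (minv (Theta q T \<theta>))\<^sup>T * K_mat q T \<theta> * minv (Theta q T \<theta>)"
proof -
  let ?\<Theta> = "Theta q T \<theta>"
  have \<Theta>: "?\<Theta> \<in> carrier_mat T T" "invertible_mat ?\<Theta>" by (auto simp: invertible_Theta \<theta>0)
  have \<Theta>t: "?\<Theta>\<^sup>T \<in> carrier_mat T T" "invertible_mat (?\<Theta>\<^sup>T)"
    using \<Theta> by (auto intro: invertible_mat_transpose[OF Theta_carrier])
  have K: "minv (K_mat q T \<theta>) \<in> carrier_mat T T" "invertible_mat (minv (K_mat q T \<theta>))"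
    unfolding minv_K using update_carrier pos_def_invertible[OF update_pos_def] by auto
  have \<Theta>K: "?\<Theta> * minv (K_mat q T \<theta>) \<in> carrier_mat T T" using \<Theta> K by auto
  note i = invertible_mat_mult[OF \<Theta> K]
  show "invertible_mat (Sigma_mat q T \<theta>)" unfolding Sigma_factor
    by (rule invertible_mat_mult(1)[OF \<Theta>K i(1) \<Theta>t])
  have "minv (Sigma_mat q T \<theta>) = (minv ?\<Theta>)\<^sup>T * (K_mat q T \<theta> * minv ?\<Theta>)"
    unfolding Sigma_factor invertible_mat_mult(2)[OF \<Theta>K i(1) \<Theta>t] i(2) minv_transpose[OF \<Theta>]
    by (simp add: minv_K minv_update)
  also have "\<dots> = (minv ?\<Theta>)\<^sup>T * K_mat q T \<theta> * minv ?\<Theta>"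
    using minv_Theta(1) K_carrier by (simp add: mult_assoc_dim)
  finally show "minv (Sigma_mat q T \<theta>) = (minv ?\<Theta>)\<^sup>T * K_mat q T \<theta> * minv ?\<Theta>" .
qed

text \<open>\<open>Theta\<close> has determinant 1, so the determinant of \<open>Sigma_mat\<close>
  is that of the T by T update of the identity; Sylvester's identity reduces it to the q by q matrix
  \<open>gram_lambda\<close>.\<close>

lemma det_Sigma:
  "mdet (gram_lambda q T \<theta>) = mdet (Sigma_mat q T \<theta>)"
  "mdet (Sigma_mat q T \<theta>) = 1 / mdet (K_mat q T \<theta>)"
proof -
  have "1\<^sub>m q + (lambda_mat q T \<theta>)\<^sup>T * lambda_mat q T \<theta> = gram_lambda q T \<theta>"
    unfolding gram_lambda_def using lambda_carrier by (intro eq_matI) auto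
  hence g: "mdet (gram_lambda q T \<theta>) = mdet (1\<^sub>m T + lambda_mat q T \<theta> * (lambda_mat q T \<theta>)\<^sup>T)"
    using det_one_plus_mult_swap[of "lambda_mat q T \<theta>" T q "(lambda_mat q T \<theta>)\<^sup>T"] lambda_carrier by simp
  have s: "mdet (Sigma_mat q T \<theta>) = mdet (1\<^sub>m T + lambda_mat q T \<theta> * (lambda_mat q T \<theta>)\<^sup>T)"
    unfolding Sigma_factor minv_K
    using det_mult[OF mult_carrier_mat[OF Theta_carrier update_carrier], of "(Theta q T \<theta>)\<^sup>T"]
      det_mult[OF Theta_carrier[of q T \<theta>] update_carrier] det_Theta[where \<theta> = \<theta>, OF \<theta>0, of q T]
      det_transpose[OF Theta_carrier[of q T \<theta>]] by simp
  show "mdet (gram_lambda q T \<theta>) = mdet (Sigma_mat q T \<theta>)" by (simp add: g s)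
  have "mdet (1\<^sub>m T + lambda_mat q T \<theta> * (lambda_mat q T \<theta>)\<^sup>T) * mdet (K_mat q T \<theta>) = 1"
    using det_mult[OF update_carrier K_carrier] update_mult_K by simp
  thus "mdet (Sigma_mat q T \<theta>) = 1 / mdet (K_mat q T \<theta>)"
    unfolding s by (metis mult_zero_right nonzero_eq_divide_eq zero_neq_one)
qed

subsection \<open>Maximising the likelihood\<close>

lemma lag_mat_carrier [simp]: "lag_mat p k T r x \<in> carrier_mat T k"
  by (simp add: lag_mat_def)

lemma lag_blocks_carrier: "lag_blocks p q k T \<theta> x n \<in> carrier_mat T (1 + n * k)"
proof (induction n)
  case 0
  show ?case using minv_Theta(1) by (auto simp: ones_mat_def)
next
  case (Suc n)
  thus ?case using minv_Theta(1)
    by (intro carrier_matI) (simp_all add: append_columns_def lag_mat_def add.commute)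
qed

lemma stack_coeffs_carrier:
  assumes "\<mu> \<in> carrier_mat 1 k" "\<forall>i\<in>{1..n}. \<Phi> i \<in> carrier_mat k k"
  shows "stack_coeffs \<mu> \<Phi> n \<in> carrier_mat (1 + n * k) k"
  using assms(2)
proof (induction n)
  case (Suc n)
  hence "stack_coeffs \<mu> \<Phi> n \<in> carrier_mat (1 + n * k) k" "\<Phi> (Suc n) \<in> carrier_mat k k" by auto
  thus ?case using carrier_append_rows[of _ "1 + n * k" k _ k] by (simp add: add.commute add.left_commute)
qed (use assms in simp)

lemma stack_coeffs_cong: "(\<And>i. i \<in> {1..n} \<Longrightarrow> \<Phi> i = \<Phi>' i) \<Longrightarrow> stack_coeffs \<mu> \<Phi> n = stack_coeffs \<mu> \<Phi>' n"
  by (induction n) auto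

text \<open>The least squares solution comes as one tall matrix; this cuts it into a mean and lag
  coefficients.\<close>

lemma stack_coeffs_surj:
  assumes "B \<in> carrier_mat (1 + n * k) k"
  shows "\<exists>\<mu> \<Phi>. \<mu> \<in> carrier_mat 1 k \<and> (\<forall>i\<in>{1..n}. \<Phi> i \<in> carrier_mat k k) \<and> stack_coeffs \<mu> \<Phi> n = B"
  using assms
proof (induction n arbitrary: B)
  case 0
  thus ?case by auto
next
  case (Suc n)
  define U where "U = mat (1 + n * k) k (\<lambda>(i, j). B $$ (i, j))"
  define V where "V = mat k k (\<lambda>(i, j). B $$ (1 + n * k + i, j))"
  have "U \<in> carrier_mat (1 + n * k) k" by (simp add: U_def)
  from Suc.IH[OF this] obtain \<mu> \<Phi> where i: "\<mu> \<in> carrier_mat 1 k" "\<forall>i\<in>{1..n}. \<Phi> i \<in> carrier_mat k k"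
    "stack_coeffs \<mu> \<Phi> n = U" by blast
  have "stack_coeffs \<mu> (\<Phi>(Suc n := V)) n = U"
    unfolding i(3)[symmetric] by (rule stack_coeffs_cong) auto
  moreover have "U @\<^sub>r V = B"
    using Suc.prems by (intro eq_matI) (auto simp: U_def V_def append_rows_def)
  ultimately have "stack_coeffs \<mu> (\<Phi>(Suc n := V)) (Suc n) = B" by simp
  moreover have "\<forall>i\<in>{1..Suc n}. (\<Phi>(Suc n := V)) i \<in> carrier_mat k k"
    using i(2) by (auto simp: V_def)
  ultimately show ?case using i(1) by blast
qed

lemma minv_Theta_Z:
  assumes "\<mu> \<in> carrier_mat 1 k" "\<forall>i\<in>{1..p}. \<Phi> i \<in> carrier_mat k k"
  shows "minv (Theta q T \<theta>) * Z_mat p k T \<mu> \<Phi> x =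
    X_theta p q k T \<theta> x - X_theta_lag p q k T \<theta> x * stack_coeffs \<mu> \<Phi> p"
proof -
  let ?N = "minv (Theta q T \<theta>)"
  \<comment> \<open>The number \<open>n\<close> of subtracted lags is separated from
    \<open>p\<close>, because \<open>p\<close> also fixes the times of the rows;
    \<open>Z_mat\<close> with \<open>n\<close> in place of \<open>p\<close> would refer to a
    different stretch of the sample.\<close>
  define Z where "Z = (\<lambda>n. mat T k (\<lambda>(i, j). lag_mat p k T 0 x $$ (i, j)
     - (ones_mat T * \<mu>) $$ (i, j) - (\<Sum>r = 1..n. (lag_mat p k T r x * \<Phi> r) $$ (i, j))))"
  have Zc: "Z n \<in> carrier_mat T k" for n by (simp add: Z_def)
  note N = minv_Theta(1)
  have "?N * Z n = ?N * lag_mat p k T 0 x - lag_blocks p q k T \<theta> x n * stack_coeffs \<mu> \<Phi> n"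
    if "n \<le> p" for n using that
  proof (induction n)
    case 0
    have "Z 0 = lag_mat p k T 0 x - ones_mat T * \<mu>"
      using assms by (intro eq_matI) (auto simp: Z_def ones_mat_def lag_mat_def)
    thus ?case using N assms carrier_matD[OF lag_mat_carrier] by (simp add: mult_minus_distrib_dim mult_assoc_dim ones_mat_def)
  next
    case (Suc n)
    let ?L = "lag_mat p k T (Suc n) x" and ?F = "\<Phi> (Suc n)"
    have F: "?F \<in> carrier_mat k k" using assms Suc.prems by auto
    have st: "stack_coeffs \<mu> \<Phi> n \<in> carrier_mat (1 + n * k) k"
      using assms Suc.prems by (intro stack_coeffs_carrier) auto
    have "Z (Suc n) = Z n - ?L * ?F"
      using F by (intro eq_matI) (auto simp: Z_def lag_mat_def)
    hence "?N * Z (Suc n) = ?N * Z n - ?N * ?L * ?F"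
      using N F Zc[of n] carrier_matD[OF lag_mat_carrier] by (simp add: mult_minus_distrib_dim mult_assoc_dim)
    also have "\<dots> = ?N * lag_mat p k T 0 x - lag_blocks p q k T \<theta> x n * stack_coeffs \<mu> \<Phi> n - ?N * ?L * ?F"
      using Suc by simp
    also have "\<dots> = ?N * lag_mat p k T 0 x - (lag_blocks p q k T \<theta> x n * stack_coeffs \<mu> \<Phi> n + ?N * ?L * ?F)"
      using N F carrier_matD[OF lag_mat_carrier] carrier_matD[OF lag_blocks_carrier] carrier_matD[OF st]
      by (intro eq_matI) auto
    also have "lag_blocks p q k T \<theta> x n * stack_coeffs \<mu> \<Phi> n + ?N * ?L * ?F =
        lag_blocks p q k T \<theta> x (Suc n) * stack_coeffs \<mu> \<Phi> (Suc n)"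
      using append_cols_mult_append_rows[OF lag_blocks_carrier mult_carrier_mat[OF N lag_mat_carrier] st F] by simp
    finally show ?case .
  qed
  from this[of p] show ?thesis by (simp add: Z_def Z_mat_def X_theta_def X_theta_lag_def)
qed

lemma loglik_quadratic:
  fixes x :: "int \<Rightarrow> nat \<Rightarrow> real"
  assumes "\<mu> \<in> carrier_mat 1 k" "\<forall>i\<in>{1..p}. \<Phi> i \<in> carrier_mat k k" "\<Omega> \<in> carrier_mat k k" "invertible_mat \<Omega>"
    and C: "C \<in> carrier_mat T T" "K_mat q T \<theta> = C\<^sup>T * C"
  defines "W \<equiv> C * X_theta p q k T \<theta> x - C * X_theta_lag p q k T \<theta> x * stack_coeffs \<mu> \<Phi> p"
  shows "varma_loglik p q k T \<theta> \<mu> \<Phi> \<Omega> x =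
     - (real (T * k) / 2) * ln (2 * pi) - (real T / 2) * ln (mdet \<Omega>)
     - (real k / 2) * ln (mdet (gram_lambda q T \<theta>)) - (1 / 2) * mtrace (W\<^sup>T * W * minv \<Omega>)"
proof -
  let ?N = "minv (Theta q T \<theta>)" and ?Z = "Z_mat p k T \<mu> \<Phi> x"
  have Z: "?Z \<in> carrier_mat T k" by (simp add: Z_mat_def)
  note N = minv_Theta(1) and O = minv_props(1)[OF assms(3,4)]
  have "W = C * (?N * ?Z)"
    unfolding minv_Theta_Z[OF assms(1,2)] W_def
    using C N carrier_matD[OF lag_blocks_carrier, of x p] carrier_matD[OF stack_coeffs_carrier[OF assms(1,2)]]
    by (simp add: mult_minus_distrib_dim mult_assoc_dim X_theta_def X_theta_lag_def lag_mat_def)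
  hence "W\<^sup>T * W * minv \<Omega> = ?Z\<^sup>T * ?N\<^sup>T * K_mat q T \<theta> * ?N * ?Z * minv \<Omega>"
    unfolding C(2) using C(1) N Z O by (simp add: mat_dim_simps mult_assoc_dim)
  thus ?thesis by (simp add: varma_loglik_def)
qed

lemma maximum_likelihood:
  assumes inv: "invertible_mat ((X_theta_lag p q k T \<theta> x)\<^sup>T * K_mat q T \<theta> * X_theta_lag p q k T \<theta> x)"
  shows "pos_semidef k (Omega_opt p q k T \<theta> x) \<and>
        (\<exists>\<mu> \<Phi>. (\<mu>, \<Phi>) \<in> coeff_space p k \<and>
           stack_coeffs \<mu> \<Phi> p = coeffs_opt p q k T \<theta> x \<and>
           (\<forall>\<Omega>. pos_def k \<Omega> \<longrightarrow>
              is_arg_max (\<lambda>(m, F). varma_loglik p q k T \<theta> m F \<Omega> x)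
                (\<lambda>c. c \<in> coeff_space p k) (\<mu>, \<Phi>)) \<and>
           (invertible_mat (Omega_opt p q k T \<theta> x) \<longrightarrow>
              is_arg_max (\<lambda>((m, F), \<Omega>). varma_loglik p q k T \<theta> m F \<Omega> x)
                (\<lambda>(c, \<Omega>). c \<in> coeff_space p k \<and> pos_def k \<Omega>)
                ((\<mu>, \<Phi>), Omega_opt p q k T \<theta> x) \<and>
              varma_loglik p q k T \<theta> \<mu> \<Phi> (Omega_opt p q k T \<theta> x) x =
                - (real (T * k) / 2) * ln (2 * pi)
                - (real T / 2) * ln (mdet (Omega_opt p q k T \<theta> x))
                - (real k / 2) * ln (mdet (gram_lambda q T \<theta>)) - real (T * k) / 2))"
proof -
  obtain C where C: "C \<in> carrier_mat T T" "K_mat q T \<theta> = C\<^sup>T * C" by (rule K_gram)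
  let ?L = "X_theta_lag p q k T \<theta> x" and ?Y = "X_theta p q k T \<theta> x" and ?K = "K_mat q T \<theta>"
  let ?O = "Omega_opt p q k T \<theta> x"
  have Lc: "?L \<in> carrier_mat T (1 + p * k)" unfolding X_theta_lag_def by (rule lag_blocks_carrier)
  have Yc: "?Y \<in> carrier_mat T k" using minv_Theta(1) by (simp add: X_theta_def)
  define l where "l = C * ?L"
  define y where "y = C * ?Y"
  have l: "l \<in> carrier_mat T (1 + p * k)" and y: "y \<in> carrier_mat T k"
    using C Lc Yc by (auto simp: l_def y_def)
  have H: "?L\<^sup>T * ?K * ?L = l\<^sup>T * l" unfolding C(2) l_def using C(1) Lc by (simp add: mat_dim_simps mult_assoc_dim)
  have inv': "invertible_mat (l\<^sup>T * l)" using inv H by simp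
  \<comment> \<open>The regressors always include the column for the mean, so with no rows their
    Gram matrix would be a zero matrix of positive size. The factor 1 / T in the covariance estimate
    can therefore be inverted.\<close>
  have "0 < T"
  proof (rule ccontr)
    assume "\<not> 0 < T"
    hence z: "l\<^sup>T * l = 0\<^sub>m (1 + p * k) (1 + p * k)" using l by (intro eq_matI) (auto simp: scalar_prod_def)
    have "l\<^sup>T * l * minv (l\<^sup>T * l) = 1\<^sub>m (1 + p * k)" "minv (l\<^sup>T * l) \<in> carrier_mat (1 + p * k) (1 + p * k)"
      using minv_props[of "l\<^sup>T * l" "1 + p * k"] inv' l by auto
    hence "0\<^sub>m (1 + p * k) (1 + p * k) = (1\<^sub>m (1 + p * k) :: real mat)" unfolding z by simp
    from arg_cong[OF this, of "\<lambda>A. A $$ (0, 0)"] show False by simp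
  qed
  define B where "B = minv (l\<^sup>T * l) * l\<^sup>T * y"
  define R where "R = y - l * B"
  note ne = normal_equations[OF l y inv', folded B_def, folded R_def]
  have mc: "minv (l\<^sup>T * l) \<in> carrier_mat (1 + p * k) (1 + p * k)"
    using minv_props(1)[of "l\<^sup>T * l" "1 + p * k"] inv' l by auto
  have Bopt: "coeffs_opt p q k T \<theta> x = B"
    unfolding coeffs_opt_def Let_def H B_def unfolding C(2) using C(1) Lc Yc mc
    by (simp add: l_def y_def mat_dim_simps mult_assoc_dim)
  have "?Y\<^sup>T * ?K * ?Y - ?Y\<^sup>T * ?K * ?L * minv (?L\<^sup>T * ?K * ?L) * ?L\<^sup>T * ?K * ?Y = R\<^sup>T * R"
    unfolding H ne(3) unfolding C(2) using C(1) Lc Yc mc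
    by (simp add: l_def y_def mat_dim_simps mult_assoc_dim)
  hence Oopt: "?O = (1 / real T) \<cdot>\<^sub>m (R\<^sup>T * R)" by (simp add: Omega_opt_def)
  have RR: "R\<^sup>T * R = real T \<cdot>\<^sub>m ?O" unfolding Oopt using \<open>0 < T\<close> by (intro eq_matI) auto
  have Oc: "?O \<in> carrier_mat k k" unfolding Oopt using ne(2) by auto
  obtain \<mu> \<Phi> where co: "\<mu> \<in> carrier_mat 1 k" "\<forall>i\<in>{1..p}. \<Phi> i \<in> carrier_mat k k" "stack_coeffs \<mu> \<Phi> p = B"
    using stack_coeffs_surj[OF ne(1)] by blast
  have cs: "(\<mu>, \<Phi>) \<in> coeff_space p k" using co by (simp add: coeff_space_def)
  define c where "c = - (real (T * k) / 2) * ln (2 * pi) - (real k / 2) * ln (mdet (gram_lambda q T \<theta>))"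
  have ll: "varma_loglik p q k T \<theta> m F \<Omega> x = c - (real T / 2) * ln (mdet \<Omega>)
      - (1 / 2) * mtrace ((y - l * stack_coeffs m F p)\<^sup>T * (y - l * stack_coeffs m F p) * minv \<Omega>)"
    if "(m, F) \<in> coeff_space p k" "\<Omega> \<in> carrier_mat k k" "invertible_mat \<Omega>" for m F \<Omega>
    using loglik_quadratic[OF _ _ that(2,3) C, of m F x] that(1) by (auto simp: coeff_space_def y_def l_def c_def)
  have ll_opt: "varma_loglik p q k T \<theta> \<mu> \<Phi> \<Omega> x = c - (real T / 2) * ln (mdet \<Omega>)
      - (1 / 2) * mtrace (R\<^sup>T * R * minv \<Omega>)"
    if "\<Omega> \<in> carrier_mat k k" "invertible_mat \<Omega>" for \<Omega>
    using ll[OF cs that] by (simp add: co R_def)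
  \<comment> \<open>The least squares point is optimal for every \<Omega> simultaneously, so the
    joint maximisation splits into this step and one over \<Omega> alone.\<close>
  have le: "varma_loglik p q k T \<theta> m F \<Omega> x \<le> varma_loglik p q k T \<theta> \<mu> \<Phi> \<Omega> x"
    if mF: "(m, F) \<in> coeff_space p k" and pd: "pos_def k \<Omega>" for m F \<Omega>
  proof -
    have Wc: "\<Omega> \<in> carrier_mat k k" using pd by (simp add: pos_def_def)
    have Wi: "invertible_mat \<Omega>" by (rule pos_def_invertible[OF pd])
    note mW = minv_props(1)[OF Wc Wi]
    have st: "stack_coeffs m F p \<in> carrier_mat (1 + p * k) k"
      using mF by (intro stack_coeffs_carrier) (auto simp: coeff_space_def)
    define E where "E = l * (B - stack_coeffs m F p)"
    have E: "E \<in> carrier_mat T k" using l ne(1) st by (auto simp: E_def)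
    have "mtrace ((R\<^sup>T * R + E\<^sup>T * E) * minv \<Omega>) = mtrace (R\<^sup>T * R * minv \<Omega>) + mtrace (E\<^sup>T * E * minv \<Omega>)"
      using E ne(2) mW by (subst add_mult_distrib_dim) (auto intro!: mtrace_add)
    moreover have "0 \<le> mtrace (E\<^sup>T * E * minv \<Omega>)" by (rule mtrace_gram_minv_nonneg[OF E pd])
    ultimately show ?thesis
      unfolding ll[OF mF Wc Wi] ll_opt[OF Wc Wi] ne(4)[OF st] E_def[symmetric] by simp
  qed
  have trRR: "mtrace (R\<^sup>T * R * minv \<Omega>) = real T * mtrace (?O * minv \<Omega>)" if "minv \<Omega> \<in> carrier_mat k k" for \<Omega>
  proof -
    have "R\<^sup>T * R * minv \<Omega> = real T \<cdot>\<^sub>m (?O * minv \<Omega>)"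
      unfolding RR using Oc that by (intro mult_smult_assoc_mat) auto
    thus ?thesis using Oc that by (simp add: mtrace_def sum_distrib_left)
  qed
  have opt: "is_arg_max (\<lambda>((m, F), \<Omega>). varma_loglik p q k T \<theta> m F \<Omega> x)
       (\<lambda>(c, \<Omega>). c \<in> coeff_space p k \<and> pos_def k \<Omega>) ((\<mu>, \<Phi>), ?O)" (is ?A)
    "varma_loglik p q k T \<theta> \<mu> \<Phi> ?O x = c - (real T / 2) * ln (mdet ?O) - real (T * k) / 2" (is ?B)
    if invO: "invertible_mat ?O"
  proof -
    have pdO: "pos_def k ?O"
      using pos_def_if_invertible_gram[OF ne(2), of "1 / real T"] invO \<open>0 < T\<close> unfolding Oopt by simp
    have "mtrace (?O * minv ?O) = real k" using minv_props(2)[OF Oc invO] by (simp add: mtrace_def)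
    thus v: ?B using ll_opt[OF Oc invO] trRR[of ?O] minv_props(1)[OF Oc invO] by simp
    have "varma_loglik p q k T \<theta> m F \<Omega> x \<le> varma_loglik p q k T \<theta> \<mu> \<Phi> ?O x"
      if mF: "(m, F) \<in> coeff_space p k" and pd: "pos_def k \<Omega>" for m F \<Omega>
    proof -
      have Wc: "\<Omega> \<in> carrier_mat k k" using pd by (simp add: pos_def_def)
      have Wi: "invertible_mat \<Omega>" by (rule pos_def_invertible[OF pd])
      \<comment> \<open>Multiplying by T matches the identity
        \<open>R\<^sup>T * R = real T \<cdot>\<^sub>m ?O\<close>: the right side becomes the trace
        term at \<Omega> minus its value at the optimum.\<close>
      have "real T * (ln (mdet ?O) - ln (mdet \<Omega>)) \<le> real T * (mtrace (?O * minv \<Omega>) - real k)"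
        by (intro mult_left_mono ln_det_diff_le[OF pdO pd]) simp
      hence "varma_loglik p q k T \<theta> \<mu> \<Phi> \<Omega> x \<le> varma_loglik p q k T \<theta> \<mu> \<Phi> ?O x"
        unfolding v ll_opt[OF Wc Wi] trRR[OF minv_props(1)[OF Wc Wi]] by (simp add: algebra_simps)
      with le[OF mF pd] show ?thesis by simp
    qed
    thus ?A using cs pdO by (auto simp: is_arg_max_def not_less)
  qed
  have "pos_semidef k ?O"
    unfolding pos_semidef_def
  proof (intro conjI ballI)
    have "(?O)\<^sup>T = (1 / real T) \<cdot>\<^sub>m (R\<^sup>T * R)\<^sup>T" unfolding Oopt by (intro eq_matI) auto
    also have "(R\<^sup>T * R)\<^sup>T = R\<^sup>T * R" using ne(2) by (simp add: transpose_mult_dim)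
    finally show "(?O)\<^sup>T = ?O" by (simp add: Oopt)
    fix v :: "real vec" assume v: "v \<in> carrier_vec k"
    have "?O *\<^sub>v v = (1 / real T) \<cdot>\<^sub>v (R\<^sup>T * R *\<^sub>v v)"
      unfolding Oopt using ne(2) v by (intro smult_mult_mat_vec) auto
    thus "0 \<le> scalar_prod v (?O *\<^sub>v v)"
      using scalar_prod_gram[OF ne(2) v] scalar_prod_self_nonneg[of "R *\<^sub>v v"] v ne(2)
      by (simp del: assoc_mult_mat_vec)
  qed (rule Oc)
  moreover have "\<forall>\<Omega>. pos_def k \<Omega> \<longrightarrow>
      is_arg_max (\<lambda>(m, F). varma_loglik p q k T \<theta> m F \<Omega> x) (\<lambda>c. c \<in> coeff_space p k) (\<mu>, \<Phi>)"
    using le cs by (auto simp: is_arg_max_def not_less)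
  ultimately show ?thesis
    using opt cs co(3) Bopt by (intro conjI exI[of _ \<mu>] exI[of _ \<Phi>]) (auto simp: c_def)
qed

end

subsection \<open>Triangular changes of variables\<close>

interpretation lborel_prod: product_sigma_finite "\<lambda>_. lborel :: real measure" by standard

lemma sigma_finite_lebesgue_space: "sigma_finite_measure (lebesgue_space k)"
  by (rule lborel_prod.sigma_finite) simp

interpretation lebesgue_prod: product_sigma_finite "\<lambda>_ :: int. lebesgue_space k" for k
  by (simp add: product_sigma_finite_def sigma_finite_lebesgue_space)

lemma nn_integral_lborel_affine:
  assumes "c > 0" "F \<in> borel_measurable borel"
  shows "ennreal c * (\<integral>\<^sup>+v. F (c * v + a) \<partial>lborel) = (\<integral>\<^sup>+v. F v \<partial>lborel)"
  using nn_integral_real_affine[of F c a] assms by (simp add: add.commute)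

text \<open>Induction on \<open>k\<close>: Fubini isolates the last coordinate, whose
  one-dimensional substitution contributes one factor \<open>c\<close>. The factor stands on the
  side of the transformed integral to avoid division in \<open>ennreal\<close>.\<close>

lemma nn_integral_lebesgue_space_affine:
  assumes c: "c > 0" and "F \<in> borel_measurable (lebesgue_space k)"
  shows "ennreal (c ^ k) * (\<integral>\<^sup>+v. F (\<lambda>j\<in>{..<k}. c * v j + a j) \<partial>lebesgue_space k) = (\<integral>\<^sup>+v. F v \<partial>lebesgue_space k)"
  using assms(2)
proof (induction k arbitrary: F)
  case 0
  show ?case by (simp add: PiM_empty nn_integral_count_space_finite)
next
  case (Suc k)
  have [simp]: "{..<Suc k} = insert k {..<k}" by auto
  have F [measurable]: "F \<in> borel_measurable (Pi\<^sub>M (insert k {..<k}) (\<lambda>_. lborel))"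
    using Suc.prems by simp
  have m1: "(\<lambda>v. F (\<lambda>j\<in>insert k {..<k}. c * v j + a j)) \<in> borel_measurable (Pi\<^sub>M (insert k {..<k}) (\<lambda>_. lborel))"
    by measurable
  have "(\<integral>\<^sup>+v. F (\<lambda>j\<in>insert k {..<k}. c * v j + a j) \<partial>Pi\<^sub>M (insert k {..<k}) (\<lambda>_. lborel)) =
    (\<integral>\<^sup>+x. \<integral>\<^sup>+v. F (\<lambda>j\<in>insert k {..<k}. c * (x(k := v)) j + a j) \<partial>lborel \<partial>lebesgue_space k)"
    using m1 by (subst lborel_prod.product_nn_integral_insert) auto
  also have "\<dots> = (\<integral>\<^sup>+x. \<integral>\<^sup>+v. F ((\<lambda>j\<in>{..<k}. c * x j + a j)(k := c * v + a k)) \<partial>lborel \<partial>lebesgue_space k)"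
    by (intro nn_integral_cong arg_cong[of _ _ F]) (auto simp: fun_eq_iff)
  finally have e1: "(\<integral>\<^sup>+v. F (\<lambda>j\<in>insert k {..<k}. c * v j + a j) \<partial>Pi\<^sub>M (insert k {..<k}) (\<lambda>_. lborel)) = \<dots>" .
  define H where "H = (\<lambda>x. \<integral>\<^sup>+v. F (x(k := v)) \<partial>lborel)"
  have upd: "(\<lambda>(x, v). F (x(k := v))) \<in> borel_measurable (lebesgue_space k \<Otimes>\<^sub>M lborel)"
    by measurable
  have Hm: "H \<in> borel_measurable (lebesgue_space k)"
    unfolding H_def using upd by (intro lborel.borel_measurable_nn_integral) auto
  have inner: "ennreal c * (\<integral>\<^sup>+v. F (y(k := c * v + a k)) \<partial>lborel) = H y" if "y \<in> space (lebesgue_space k)" for y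
  proof -
    have "(\<lambda>v. F (y(k := v))) \<in> borel_measurable borel"
      using measurable_compose[OF measurable_Pair1'[OF that, of lborel] upd] by simp
    thus ?thesis unfolding H_def by (rule nn_integral_lborel_affine[OF c])
  qed
  have sp: "(\<lambda>j\<in>{..<k}. c * x j + a j) \<in> space (lebesgue_space k)" for x by (auto simp: space_PiM)
  have "ennreal (c ^ Suc k) * (\<integral>\<^sup>+v. F (\<lambda>j\<in>insert k {..<k}. c * v j + a j) \<partial>Pi\<^sub>M (insert k {..<k}) (\<lambda>_. lborel))
    = ennreal (c ^ k) * (ennreal c * (\<integral>\<^sup>+x. \<integral>\<^sup>+v. F ((\<lambda>j\<in>{..<k}. c * x j + a j)(k := c * v + a k)) \<partial>lborel \<partial>lebesgue_space k))"
    unfolding e1 using c by (simp add: ennreal_mult mult_ac)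
  also have "ennreal c * (\<integral>\<^sup>+x. \<integral>\<^sup>+v. F ((\<lambda>j\<in>{..<k}. c * x j + a j)(k := c * v + a k)) \<partial>lborel \<partial>lebesgue_space k)
     = (\<integral>\<^sup>+x. ennreal c * \<integral>\<^sup>+v. F ((\<lambda>j\<in>{..<k}. c * x j + a j)(k := c * v + a k)) \<partial>lborel \<partial>lebesgue_space k)"
  proof (rule nn_integral_cmult[symmetric])
    have "(\<lambda>(x, v). F ((\<lambda>j\<in>{..<k}. c * x j + a j)(k := c * v + a k))) \<in> borel_measurable (lebesgue_space k \<Otimes>\<^sub>M lborel)"
      by measurable
    thus "(\<lambda>x. \<integral>\<^sup>+v. F ((\<lambda>j\<in>{..<k}. c * x j + a j)(k := c * v + a k)) \<partial>lborel) \<in> borel_measurable (lebesgue_space k)"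
      by (intro lborel.borel_measurable_nn_integral) auto
  qed
  also have "\<dots> = (\<integral>\<^sup>+x. H (\<lambda>j\<in>{..<k}. c * x j + a j) \<partial>lebesgue_space k)"
    by (intro nn_integral_cong inner sp)
  also have "ennreal (c ^ k) * \<dots> = (\<integral>\<^sup>+x. H x \<partial>lebesgue_space k)"
    by (rule Suc.IH[OF Hm])
  also have "\<dots> = (\<integral>\<^sup>+v. F v \<partial>Pi\<^sub>M (insert k {..<k}) (\<lambda>_. lborel))"
    unfolding H_def using F by (subst lborel_prod.product_nn_integral_insert) auto
  finally show ?case by simp
qed

text \<open>The index \<open>i\<close> is an integer time from \<open>a\<close> onwards, while
  \<open>c\<close> and \<open>G\<close> are numbered from 0. The scale is shared by all k components
  of a time, so each scale enters the Jacobian with power k.\<close>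

definition tri_map :: "nat \<Rightarrow> int \<Rightarrow> (nat \<Rightarrow> real) \<Rightarrow> (nat \<Rightarrow> (int \<Rightarrow> nat \<Rightarrow> real) \<Rightarrow> nat \<Rightarrow> real) \<Rightarrow> nat \<Rightarrow>
    (int \<Rightarrow> nat \<Rightarrow> real) \<Rightarrow> int \<Rightarrow> nat \<Rightarrow> real" where
  "tri_map k a c G n y = (\<lambda>i\<in>{a..<a + int n}. \<lambda>j\<in>{..<k}. c (nat (i - a)) * y i j + G (nat (i - a)) y j)"

lemma measurable_lebesgue_spaceI:
  assumes "\<And>x j. x \<in> space M \<Longrightarrow> \<not> j < k \<Longrightarrow> f x j = undefined" "\<And>j. j < k \<Longrightarrow> (\<lambda>x. f x j) \<in> borel_measurable M"
  shows "f \<in> measurable M (lebesgue_space k)"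
  using assms by (intro measurable_PiM_single') (auto simp: PiE_def extensional_def)

lemma measurable_lebesgue_space_component:
  assumes "f \<in> measurable M (lebesgue_space k)" "j < k"
  shows "(\<lambda>x. f x j) \<in> borel_measurable M"
  using measurable_compose[OF assms(1) measurable_component_singleton[of j "{..<k}" "\<lambda>_. lborel"]] assms(2) by simp

lemma measurable_PiM_lebesgue_component:
  assumes "f \<in> measurable M (PiM I (\<lambda>_. lebesgue_space k))" "i \<in> I" "j < k"
  shows "(\<lambda>x. f x i j) \<in> borel_measurable M"
  by (rule measurable_lebesgue_space_component[OF measurable_compose[OF assms(1) measurable_component_singleton] assms(3)])
    (use assms in auto)

text \<open>\<open>G_cong\<close> is the triangularity: the translation at step \<open>n\<close>
  reads only components at times before \<open>a + int n\<close>. Measurability is required on the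
  full time range and transferred to initial segments afterwards.\<close>

locale triangular =
  fixes k T :: nat and a :: int and c :: "nat \<Rightarrow> real" and G :: "nat \<Rightarrow> (int \<Rightarrow> nat \<Rightarrow> real) \<Rightarrow> nat \<Rightarrow> real"
  assumes c_pos: "\<And>n. n < T \<Longrightarrow> 0 < c n"
    and G_cong: "\<And>n y y' j. n < T \<Longrightarrow> j < k \<Longrightarrow> (\<And>i. a \<le> i \<Longrightarrow> i < a + int n \<Longrightarrow> y i = y' i) \<Longrightarrow> G n y j = G n y' j"
    and G_meas: "\<And>n j. n < T \<Longrightarrow> j < k \<Longrightarrow>
      (\<lambda>y. G n y j) \<in> borel_measurable (PiM {a..<a + int T} (\<lambda>_. lebesgue_space k))"
begin

abbreviation "P n \<equiv> PiM {a..<a + int n} (\<lambda>_. lebesgue_space k)"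

text \<open>Padding a path on an initial segment with zeros by \<open>e\<close> does not change
  \<open>G m\<close>, which does not read the padded times.\<close>

lemma G_meas_restrict:
  assumes "m \<le> n" "m < T" "j < k"
  shows "(\<lambda>y. G m y j) \<in> borel_measurable (P n)"
proof -
  define e :: "(int \<Rightarrow> nat \<Rightarrow> real) \<Rightarrow> int \<Rightarrow> nat \<Rightarrow> real" where "e = (\<lambda>y. \<lambda>i\<in>{a..<a + int T}. if i < a + int n then y i else (\<lambda>j\<in>{..<k}. 0))"
  have "e \<in> measurable (P n) (P T)"
    unfolding e_def
  proof (rule measurable_restrict)
    fix i assume i: "i \<in> {a..<a + int T}"
    show "(\<lambda>y. if i < a + int n then y i else (\<lambda>j\<in>{..<k}. 0)) \<in> measurable (P n) (lebesgue_space k)"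
      by (cases "i < a + int n") (use i in \<open>auto simp: space_PiM intro!: measurable_component_singleton\<close>)
  qed
  from measurable_compose[OF this G_meas[OF assms(2,3)]]
  have "(\<lambda>y. G m (e y) j) \<in> borel_measurable (P n)" .
  also have "(\<lambda>y. G m (e y) j) = (\<lambda>y. G m y j)"
    using assms by (intro ext G_cong) (auto simp: e_def)
  finally show ?thesis .
qed

lemma tri_map_meas:
  assumes "n \<le> T"
  shows "tri_map k a c G n \<in> measurable (P n) (P n)"
  unfolding tri_map_def
proof (rule measurable_restrict)
  fix i assume i: "i \<in> {a..<a + int n}"
  have n: "nat (i - a) \<le> n" "nat (i - a) < T" using i assms by auto
  show "(\<lambda>y. \<lambda>j\<in>{..<k}. c (nat (i - a)) * y i j + G (nat (i - a)) y j) \<in> measurable (P n) (lebesgue_space k)"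
  proof (rule measurable_lebesgue_spaceI)
    fix j assume j: "j < k"
    have "(\<lambda>y. y i j) \<in> borel_measurable (P n)"
      by (rule measurable_PiM_lebesgue_component[OF _ i j]) simp
    with j G_meas_restrict[OF n j] show "(\<lambda>y. (\<lambda>j\<in>{..<k}. c (nat (i - a)) * y i j + G (nat (i - a)) y j) j) \<in> borel_measurable (P n)"
      by simp
  qed simp
qed

text \<open>Induction on the number of times. Once the earlier times are fixed, the last component
  undergoes an affine substitution with constant translation, so integrating it first removes
  \<open>G n\<close> and leaves the factor \<open>c n ^ k\<close>; what remains is the map of length
  \<open>n\<close> applied to the integrated function \<open>H\<close>.\<close>

lemma nn_integral_tri_map:
  assumes "n \<le> T" "F \<in> borel_measurable (P n)"
  shows "ennreal (\<Prod>m<n. c m ^ k) * (\<integral>\<^sup>+y. F (tri_map k a c G n y) \<partial>P n) = (\<integral>\<^sup>+y. F y \<partial>P n)"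
  using assms
proof (induction n arbitrary: F)
  case 0
  show ?case by (simp add: PiM_empty tri_map_def nn_integral_count_space_finite)
next
  case (Suc n)
  let ?t = "tri_map k a c G"
  let ?N = "lebesgue_space k"
  have I: "{a..<a + int (Suc n)} = insert (a + int n) {a..<a + int n}" by auto
  have ni: "a + int n \<notin> {a..<a + int n}" by auto
  have PI: "P (Suc n) = PiM (insert (a + int n) {a..<a + int n}) (\<lambda>_. ?N)" unfolding I ..
  have F: "F \<in> borel_measurable (PiM (insert (a + int n) {a..<a + int n}) (\<lambda>_. ?N))"
    using Suc.prems(2) unfolding PI .
  have nT: "n < T" using Suc.prems by simp
  \<comment> \<open>Changing the last component does not affect the images at earlier times, nor the
    translation at the last time.\<close>
  have step: "?t (Suc n) (x(a + int n := v)) = (?t n x)(a + int n := (\<lambda>j\<in>{..<k}. c n * v j + G n x j))" for x v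
  proof
    fix i
    consider "i \<in> {a..<a + int n}" | "i = a + int n" | "i \<notin> {a..<a + int (Suc n)}" "i \<noteq> a + int n" unfolding I by auto
    thus "?t (Suc n) (x(a + int n := v)) i = ((?t n x)(a + int n := (\<lambda>j\<in>{..<k}. c n * v j + G n x j))) i"
    proof cases
      case 1
      have "G (nat (i - a)) (x(a + int n := v)) j = G (nat (i - a)) x j" if "j < k" for j
        using 1 nT that by (intro G_cong) auto
      thus ?thesis using 1 by (auto simp: tri_map_def fun_eq_iff)
    next
      case 2
      have "G n (x(a + int n := v)) j = G n x j" if "j < k" for j
        using nT that by (intro G_cong) auto
      thus ?thesis using 2 by (auto simp: tri_map_def fun_eq_iff)
    next
      case 3
      thus ?thesis by (auto simp: tri_map_def)
    qed
  qed
  define H where "H = (\<lambda>x. \<integral>\<^sup>+v. F (x(a + int n := v)) \<partial>?N)"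
  have upd: "(\<lambda>(x, v). F (x(a + int n := v))) \<in> borel_measurable (P n \<Otimes>\<^sub>M ?N)"
    using measurable_compose[OF measurable_add_dim F] by (simp add: case_prod_beta' comp_def)
  have Hm: "H \<in> borel_measurable (P n)"
    unfolding H_def using upd by (intro sigma_finite_measure.borel_measurable_nn_integral[OF sigma_finite_lebesgue_space]) auto
  have tm: "?t n \<in> measurable (P n) (P n)" using Suc.prems by (intro tri_map_meas) simp
  have inner: "ennreal (c n ^ k) * (\<integral>\<^sup>+v. F (y(a + int n := (\<lambda>j\<in>{..<k}. c n * v j + b j))) \<partial>?N) = H y"
    if "y \<in> space (P n)" for y b
  proof -
    have "(\<lambda>v. F (y(a + int n := v))) \<in> borel_measurable ?N"
      using measurable_compose[OF measurable_Pair1'[OF that, of ?N] upd] by simp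
    from nn_integral_lebesgue_space_affine[OF c_pos[OF nT] this] show ?thesis unfolding H_def .
  qed
  have Ft: "(\<lambda>y. F (?t (Suc n) y)) \<in> borel_measurable (PiM (insert (a + int n) {a..<a + int n}) (\<lambda>_. ?N))"
    using measurable_compose[OF tri_map_meas[OF Suc.prems(1)] Suc.prems(2)] unfolding PI .
  have "(\<integral>\<^sup>+y. F (?t (Suc n) y) \<partial>P (Suc n)) =
     (\<integral>\<^sup>+x. \<integral>\<^sup>+v. F (?t (Suc n) (x(a + int n := v))) \<partial>?N \<partial>P n)"
    unfolding PI by (rule lebesgue_prod.product_nn_integral_insert[OF _ ni Ft]) simp
  hence "ennreal (c n ^ k) * (\<integral>\<^sup>+y. F (?t (Suc n) y) \<partial>P (Suc n)) =
     (\<integral>\<^sup>+x. ennreal (c n ^ k) * \<integral>\<^sup>+v. F (?t (Suc n) (x(a + int n := v))) \<partial>?N \<partial>P n)"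
  proof (subst nn_integral_cmult)
    have "(\<lambda>(x, v). F (?t (Suc n) (x(a + int n := v)))) \<in> borel_measurable (P n \<Otimes>\<^sub>M ?N)"
      using measurable_compose[OF measurable_add_dim Ft] by (simp add: case_prod_beta' comp_def)
    thus "(\<lambda>x. \<integral>\<^sup>+v. F (?t (Suc n) (x(a + int n := v))) \<partial>?N) \<in> borel_measurable (P n)"
      by (intro sigma_finite_measure.borel_measurable_nn_integral[OF sigma_finite_lebesgue_space]) auto
  qed simp
  also have "\<dots> = (\<integral>\<^sup>+x. H (?t n x) \<partial>P n)"
    unfolding step by (intro nn_integral_cong inner measurable_space[OF tm])
  finally have e: "ennreal (c n ^ k) * (\<integral>\<^sup>+y. F (?t (Suc n) y) \<partial>P (Suc n)) = (\<integral>\<^sup>+x. H (?t n x) \<partial>P n)" .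
  have "ennreal (\<Prod>m<Suc n. c m ^ k) * (\<integral>\<^sup>+y. F (?t (Suc n) y) \<partial>P (Suc n)) =
    ennreal (\<Prod>m<n. c m ^ k) * (ennreal (c n ^ k) * (\<integral>\<^sup>+y. F (?t (Suc n) y) \<partial>P (Suc n)))"
  proof -
    have "0 \<le> (\<Prod>m<n. c m ^ k)" "0 \<le> c n ^ k"
      using c_pos nT by (auto intro!: prod_nonneg less_imp_le[OF zero_less_power])
    from ennreal_mult[OF this] show ?thesis by (simp only: prod.lessThan_Suc mult.assoc)
  qed
  also have "\<dots> = (\<integral>\<^sup>+x. H x \<partial>P n)"
    unfolding e using Suc.prems by (intro Suc.IH[OF _ Hm]) simp
  also have "\<dots> = (\<integral>\<^sup>+y. F y \<partial>P (Suc n))"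
    unfolding H_def PI by (rule lebesgue_prod.product_nn_integral_insert[OF _ ni F, symmetric]) simp
  finally show ?case .
qed

end

text \<open>Forward substitution, the inverse of a triangular map with unit diagonal.  The initial zeros
  are never read.\<close>

primrec tri_inv :: "nat \<Rightarrow> int \<Rightarrow> nat \<Rightarrow> (nat \<Rightarrow> (int \<Rightarrow> nat \<Rightarrow> real) \<Rightarrow> nat \<Rightarrow> real) \<Rightarrow> nat \<Rightarrow>
    (int \<Rightarrow> nat \<Rightarrow> real) \<Rightarrow> int \<Rightarrow> nat \<Rightarrow> real" where
  "tri_inv k a T G 0 e = (\<lambda>i\<in>{a..<a + int T}. \<lambda>j\<in>{..<k}. 0)"
| "tri_inv k a T G (Suc n) e = (\<lambda>i\<in>{a..<a + int T}. if i = a + int n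
     then \<lambda>j\<in>{..<k}. e i j - G n (tri_inv k a T G n e) j else tri_inv k a T G n e i)"

text \<open>The parameter \<open>s\<close> stands for initial observations together with pre-sample
  errors. Joint measurability makes the sample a measurable function of the conditioning variable
  and all errors.\<close>

lemma tri_inv_meas:
  assumes G: "\<And>n j. n < T \<Longrightarrow> j < k \<Longrightarrow>
      (\<lambda>(s, y). G s n y j) \<in> borel_measurable (S \<Otimes>\<^sub>M PiM {a..<a + int T} (\<lambda>_. lebesgue_space k))"
    and "n \<le> T"
  shows "(\<lambda>(s, e). tri_inv k a T (G s) n e) \<in>
    measurable (S \<Otimes>\<^sub>M PiM {a..<a + int T} (\<lambda>_. lebesgue_space k)) (PiM {a..<a + int T} (\<lambda>_. lebesgue_space k))"
  using assms(2)
proof (induction n)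
  case 0
  show ?case by (simp add: case_prod_beta') (intro measurable_const, auto simp: space_PiM split: if_splits)
next
  case (Suc n)
  let ?P = "PiM {a..<a + int T} (\<lambda>_. lebesgue_space k)"
  have IH: "(\<lambda>z. tri_inv k a T (G (fst z)) n (snd z)) \<in> measurable (S \<Otimes>\<^sub>M ?P) ?P"
    using Suc by (simp add: case_prod_beta')
  have "(\<lambda>z. tri_inv k a T (G (fst z)) (Suc n) (snd z)) \<in> measurable (S \<Otimes>\<^sub>M ?P) ?P"
    unfolding tri_inv.simps
  proof (rule measurable_restrict)
    fix i assume i: "i \<in> {a..<a + int T}"
    show "(\<lambda>z. if i = a + int n then \<lambda>j\<in>{..<k}. snd z i j - G (fst z) n (tri_inv k a T (G (fst z)) n (snd z)) j
       else tri_inv k a T (G (fst z)) n (snd z) i) \<in> measurable (S \<Otimes>\<^sub>M ?P) (lebesgue_space k)"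
    proof (cases "i = a + int n")
      case True
      have nT: "n < T" using i True by simp
      have "(\<lambda>z. \<lambda>j\<in>{..<k}. snd z i j - G (fst z) n (tri_inv k a T (G (fst z)) n (snd z)) j)
        \<in> measurable (S \<Otimes>\<^sub>M ?P) (lebesgue_space k)"
      proof (rule measurable_lebesgue_spaceI)
        fix j assume j: "j < k"
        have "(\<lambda>z. (fst z, tri_inv k a T (G (fst z)) n (snd z))) \<in> measurable (S \<Otimes>\<^sub>M ?P) (S \<Otimes>\<^sub>M ?P)"
          using IH by measurable
        from measurable_compose[OF this G[OF nT j]]
        have "(\<lambda>z. G (fst z) n (tri_inv k a T (G (fst z)) n (snd z)) j) \<in> borel_measurable (S \<Otimes>\<^sub>M ?P)" by simp
        moreover have "(\<lambda>z. snd z i j) \<in> borel_measurable (S \<Otimes>\<^sub>M ?P)"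
          by (rule measurable_PiM_lebesgue_component[OF measurable_snd i j])
        ultimately show "(\<lambda>z. (\<lambda>j\<in>{..<k}. snd z i j - G (fst z) n (tri_inv k a T (G (fst z)) n (snd z)) j) j)
          \<in> borel_measurable (S \<Otimes>\<^sub>M ?P)" using j by simp
      qed simp
      thus ?thesis using True by simp
    next
      case False
      thus ?thesis using measurable_compose[OF IH measurable_component_singleton[OF i]] by simp
    qed
  qed
  thus ?case by (simp only: case_prod_beta')
qed

text \<open>After \<open>n\<close> steps the first \<open>n\<close> components have been recovered,
  so the translation subtracted at the next step is the one that was added.\<close>

lemma tri_inv_tri_map:
  assumes G: "\<And>n y y' j. n < T \<Longrightarrow> j < k \<Longrightarrow> (\<And>i. a \<le> i \<Longrightarrow> i < a + int n \<Longrightarrow> y i = y' i) \<Longrightarrow> G n y j = G n y' j"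
    and y: "y \<in> space (PiM {a..<a + int T} (\<lambda>_. lebesgue_space k))"
  shows "tri_inv k a T G T (tri_map k a (\<lambda>_. 1) G T y) = y"
proof -
  have *: "\<forall>i. a \<le> i \<longrightarrow> i < a + int n \<longrightarrow> tri_inv k a T G n (tri_map k a (\<lambda>_. 1) G T y) i = y i" if "n \<le> T" for n
    using that
  proof (induction n)
    case (Suc n)
    show ?case
    proof (intro allI impI)
      fix i assume i: "a \<le> i" "i < a + int (Suc n)"
      show "tri_inv k a T G (Suc n) (tri_map k a (\<lambda>_. 1) G T y) i = y i"
      proof (cases "i = a + int n")
        case True
        \<comment> \<open>Equality of the components as functions includes their value
          \<open>undefined\<close> outside the first k arguments.\<close>
        have yi: "y i \<in> extensional {..<k}" using y i Suc.prems by (auto simp: space_PiM PiE_def Pi_def)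
        have "G n (tri_inv k a T G n (tri_map k a (\<lambda>_. 1) G T y)) j = G n y j" if "j < k" for j
          by (rule G) (use Suc that in auto)
        thus ?thesis using True i Suc.prems yi
          by (auto simp: tri_map_def fun_eq_iff extensional_def)
      next
        case False
        thus ?thesis using Suc i by simp
      qed
    qed
  qed simp
  have ext: "tri_inv k a T G n e \<in> extensional {a..<a + int T}" for n e by (cases n) auto
  show ?thesis
  proof (rule extensionalityI[OF ext])
    show "y \<in> extensional {a..<a + int T}" using y by (auto simp: space_PiM PiE_def)
  qed (use *[of T] in auto)
qed

subsection \<open>Measurable families of matrices\<close>

text \<open>Entrywise, because the type \<open>real mat\<close> mixes all dimensions. Fixing the
  shape on the whole space lets entries of products be written as finite sums with constant
  bounds.\<close>

definition mat_meas :: "'a measure \<Rightarrow> nat \<Rightarrow> nat \<Rightarrow> ('a \<Rightarrow> real mat) \<Rightarrow> bool" where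
  "mat_meas M r c F \<longleftrightarrow> (\<forall>x\<in>space M. F x \<in> carrier_mat r c) \<and>
     (\<forall>i<r. \<forall>j<c. (\<lambda>x. F x $$ (i, j)) \<in> borel_measurable M)"

lemma mat_meas_const: "A \<in> carrier_mat r c \<Longrightarrow> mat_meas M r c (\<lambda>_. A)"
  by (simp add: mat_meas_def)

lemma mat_meas_mat:
  assumes "\<And>i j. i < r \<Longrightarrow> j < c \<Longrightarrow> (\<lambda>x. f x i j) \<in> borel_measurable M"
  shows "mat_meas M r c (\<lambda>x. mat r c (\<lambda>(i, j). f x i j))"
  using assms by (simp add: mat_meas_def)

lemma mat_meas_transpose: "mat_meas M r c F \<Longrightarrow> mat_meas M c r (\<lambda>x. (F x)\<^sup>T)"
  unfolding mat_meas_def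
proof (elim conjE, intro conjI ballI allI impI)
  fix i j assume F: "\<forall>x\<in>space M. F x \<in> carrier_mat r c"
    "\<forall>i<r. \<forall>j<c. (\<lambda>x. F x $$ (i, j)) \<in> borel_measurable M" and ij: "i < c" "j < r"
  have "(\<lambda>x. (F x)\<^sup>T $$ (i, j)) \<in> borel_measurable M \<longleftrightarrow> (\<lambda>x. F x $$ (j, i)) \<in> borel_measurable M"
    using F(1) ij by (intro measurable_cong) force
  thus "(\<lambda>x. (F x)\<^sup>T $$ (i, j)) \<in> borel_measurable M" using F ij by simp
qed simp

lemma mat_meas_minus: "mat_meas M r c F \<Longrightarrow> mat_meas M r c G \<Longrightarrow> mat_meas M r c (\<lambda>x. F x - G x)"
  unfolding mat_meas_def
proof (elim conjE, intro conjI ballI allI impI)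
  fix i j assume F: "\<forall>x\<in>space M. F x \<in> carrier_mat r c"
    "\<forall>i<r. \<forall>j<c. (\<lambda>x. F x $$ (i, j)) \<in> borel_measurable M"
    and G: "\<forall>x\<in>space M. G x \<in> carrier_mat r c"
    "\<forall>i<r. \<forall>j<c. (\<lambda>x. G x $$ (i, j)) \<in> borel_measurable M" and ij: "i < r" "j < c"
  have "(\<lambda>x. (F x - G x) $$ (i, j)) \<in> borel_measurable M \<longleftrightarrow> (\<lambda>x. F x $$ (i, j) - G x $$ (i, j)) \<in> borel_measurable M"
    using F(1) G(1) ij by (intro measurable_cong) force
  moreover have "(\<lambda>x. F x $$ (i, j) - G x $$ (i, j)) \<in> borel_measurable M"
    using F(2) G(2) ij by (intro borel_measurable_diff) auto
  ultimately show "(\<lambda>x. (F x - G x) $$ (i, j)) \<in> borel_measurable M" by (rule iffD2)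
qed (simp add: minus_carrier_mat)

lemma mat_meas_mult: "mat_meas M r m F \<Longrightarrow> mat_meas M m c G \<Longrightarrow> mat_meas M r c (\<lambda>x. F x * G x)"
  unfolding mat_meas_def
proof (elim conjE, intro conjI ballI allI impI)
  fix i j assume F: "\<forall>x\<in>space M. F x \<in> carrier_mat r m"
    "\<forall>i<r. \<forall>j<m. (\<lambda>x. F x $$ (i, j)) \<in> borel_measurable M"
    and G: "\<forall>x\<in>space M. G x \<in> carrier_mat m c"
    "\<forall>i<m. \<forall>j<c. (\<lambda>x. G x $$ (i, j)) \<in> borel_measurable M" and ij: "i < r" "j < c"
  have "(F x * G x) $$ (i, j) = (\<Sum>l<m. F x $$ (i, l) * G x $$ (l, j))" if "x \<in> space M" for x
    using bspec[OF F(1) that] bspec[OF G(1) that] ij by (simp add: scalar_prod_def atLeast0LessThan)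
  hence "(\<lambda>x. (F x * G x) $$ (i, j)) \<in> borel_measurable M \<longleftrightarrow>
    (\<lambda>x. \<Sum>l<m. F x $$ (i, l) * G x $$ (l, j)) \<in> borel_measurable M"
    by (intro measurable_cong)
  moreover have "(\<lambda>x. \<Sum>l<m. F x $$ (i, l) * G x $$ (l, j)) \<in> borel_measurable M"
    using F(2) G(2) ij by (intro borel_measurable_sum borel_measurable_times) auto
  ultimately show "(\<lambda>x. (F x * G x) $$ (i, j)) \<in> borel_measurable M" by (rule iffD2)
qed (metis mult_carrier_mat)

lemma mat_meas_mtrace:
  assumes "mat_meas M r r F"
  shows "(\<lambda>x. mtrace (F x)) \<in> borel_measurable M"
proof -
  have "mtrace (F x) = (\<Sum>i<r. F x $$ (i, i))" if "x \<in> space M" for x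
    using assms that by (auto simp: mat_meas_def mtrace_def)
  hence "(\<lambda>x. mtrace (F x)) \<in> borel_measurable M \<longleftrightarrow> (\<lambda>x. \<Sum>i<r. F x $$ (i, i)) \<in> borel_measurable M"
    by (intro measurable_cong)
  moreover have "(\<lambda>x. \<Sum>i<r. F x $$ (i, i)) \<in> borel_measurable M"
    using assms by (intro borel_measurable_sum) (auto simp: mat_meas_def)
  ultimately show ?thesis by (rule iffD2)
qed

lemma mat_measD: "mat_meas M r c F \<Longrightarrow> i < r \<Longrightarrow> j < c \<Longrightarrow> (\<lambda>x. F x $$ (i, j)) \<in> borel_measurable M"
  by (simp add: mat_meas_def)

lemma mat_meas_Z:
  assumes \<mu>: "\<mu> \<in> carrier_mat 1 k" and \<Phi>: "\<forall>i\<in>{1..p}. \<Phi> i \<in> carrier_mat k k"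
    and x: "\<And>t j. t \<in> {1..int p + int T} \<Longrightarrow> j < k \<Longrightarrow> (\<lambda>s. x s t j) \<in> borel_measurable M"
  shows "mat_meas M T k (\<lambda>s. Z_mat p k T \<mu> \<Phi> (x s))"
proof -
  have lag: "mat_meas M T k (\<lambda>s. lag_mat p k T r (x s))" if "r \<le> p" for r
    unfolding lag_mat_def using that by (intro mat_meas_mat x) auto
  have "mat_meas M T k (\<lambda>s. lag_mat p k T r (x s) * \<Phi> r)" if "r \<in> {1..p}" for r
    using that \<Phi> by (intro mat_meas_mult[OF lag] mat_meas_const) auto
  note LP = mat_measD[OF this]
  thus ?thesis unfolding Z_mat_def
    by (intro mat_meas_mat borel_measurable_diff borel_measurable_sum borel_measurable_const)
      (auto intro: mat_measD[OF lag] LP)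
qed

lemma varma_loglik_meas:
  assumes "\<theta> 0 = 1" "q \<le> T" and \<mu>: "\<mu> \<in> carrier_mat 1 k" and \<Phi>: "\<forall>i\<in>{1..p}. \<Phi> i \<in> carrier_mat k k"
    and \<Omega>: "\<Omega> \<in> carrier_mat k k" "invertible_mat \<Omega>"
    and x: "\<And>t j. t \<in> {1..int p + int T} \<Longrightarrow> j < k \<Longrightarrow> (\<lambda>s. x s t j) \<in> borel_measurable M"
  shows "(\<lambda>s. varma_loglik p q k T \<theta> \<mu> \<Phi> \<Omega> (x s)) \<in> borel_measurable M"
proof -
  note Z = mat_meas_Z[OF \<mu> \<Phi> x]
  note N = minv_Theta(1)[where \<theta> = \<theta> and q = q and T = T, OF assms(1,2)]
  have "mat_meas M k k (\<lambda>s. (Z_mat p k T \<mu> \<Phi> (x s))\<^sup>T * (minv (Theta q T \<theta>))\<^sup>T * K_mat q T \<theta>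
         * minv (Theta q T \<theta>) * Z_mat p k T \<mu> \<Phi> (x s) * minv \<Omega>)"
    using N K_carrier[where \<theta> = \<theta> and q = q and T = T, OF assms(1,2)] minv_props(1)[OF \<Omega>]
    by (intro mat_meas_mult[of _ _ k] mat_meas_mult[of _ _ T] mat_meas_transpose Z mat_meas_const) auto
  from mat_meas_mtrace[OF this] show ?thesis unfolding varma_loglik_def
    by (intro borel_measurable_diff borel_measurable_const borel_measurable_times)
qed

subsection \<open>Products of Gaussian densities\<close>

lemma gaussian_density_cong: "(\<And>j. j < k \<Longrightarrow> v j = w j) \<Longrightarrow> gaussian_density k \<Omega> v = gaussian_density k \<Omega> w"
proof -
  assume "\<And>j. j < k \<Longrightarrow> v j = w j"
  hence "row_mat k v = row_mat k w" by (intro eq_matI) (auto simp: row_mat_def)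
  thus ?thesis by (simp add: gaussian_density_def)
qed

lemma gaussian_density_meas:
  assumes "\<Omega> \<in> carrier_mat k k" "invertible_mat \<Omega>"
    and v: "\<And>j. j < k \<Longrightarrow> (\<lambda>s. v s j) \<in> borel_measurable M"
  shows "(\<lambda>s. gaussian_density k \<Omega> (v s)) \<in> borel_measurable M"
proof -
  have r: "mat_meas M 1 k (\<lambda>s. row_mat k (v s))" unfolding row_mat_def using v by (intro mat_meas_mat)
  have "mat_meas M 1 1 (\<lambda>s. row_mat k (v s) * minv \<Omega> * (row_mat k (v s))\<^sup>T)"
    using minv_props(1)[OF assms(1,2)] by (intro mat_meas_mult[of _ _ k] mat_meas_transpose r mat_meas_const) auto
  from mat_measD[OF this, of 0 0] show ?thesis unfolding gaussian_density_def by simp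
qed

lemma gaussian_density_nonneg: "0 < mdet \<Omega> \<Longrightarrow> 0 \<le> gaussian_density k \<Omega> v"
  by (simp add: gaussian_density_def)

text \<open>The quadratic forms of the rows are the diagonal entries of
  \<open>R * minv \<Omega> * R\<^sup>T\<close>; cyclicity of the trace moves
  \<open>R\<^sup>T\<close> to the front.\<close>

lemma gaussian_density_rows:
  assumes \<Omega>: "\<Omega> \<in> carrier_mat k k" "invertible_mat \<Omega>" and R: "R \<in> carrier_mat n k"
  shows "(\<Prod>i<n. gaussian_density k \<Omega> (\<lambda>j. R $$ (i, j))) =
    exp (- mtrace (R\<^sup>T * R * minv \<Omega>) / 2) / sqrt ((2 * pi) ^ k * mdet \<Omega>) ^ n"
proof -
  note W = minv_props(1)[OF \<Omega>]
  have "mtrace (R\<^sup>T * R * minv \<Omega>) = mtrace (R * minv \<Omega> * R\<^sup>T)"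
    using mtrace_comm[of "R\<^sup>T" "R * minv \<Omega>"] R W by (simp add: mult_assoc_dim)
  also have "\<dots> = (\<Sum>i<n. (row_mat k (\<lambda>j. R $$ (i, j)) * minv \<Omega> * (row_mat k (\<lambda>j. R $$ (i, j)))\<^sup>T) $$ (0, 0))"
    using R W by (auto simp: mtrace_def row_mat_def scalar_prod_def simp del: assoc_mult_mat intro!: sum.cong)
  finally show ?thesis
    by (simp add: gaussian_density_def prod_dividef exp_sum[symmetric] sum_divide_distrib[symmetric] sum_negf)
qed

definition rows_mat :: "nat \<Rightarrow> nat \<Rightarrow> int \<Rightarrow> (int \<Rightarrow> nat \<Rightarrow> real) \<Rightarrow> real mat" where
  "rows_mat n k a y = mat n k (\<lambda>(i, j). y (a + int i) j)"

lemma rows_mat_carrier [simp]: "rows_mat n k a y \<in> carrier_mat n k"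
  by (simp add: rows_mat_def)

lemma prod_int_interval: "(\<Prod>i\<in>{a..<a + int n}. f i) = (\<Prod>i<n. f (a + int i))" for f :: "int \<Rightarrow> 'b :: comm_monoid_mult"
  by (rule prod.reindex_bij_witness[of _ "\<lambda>i. a + int i" "\<lambda>i. nat (i - a)"]) auto

lemma gaussian_density_rows_mat:
  assumes \<Omega>: "\<Omega> \<in> carrier_mat k k" "invertible_mat \<Omega>"
  shows "(\<Prod>i\<in>{a..<a + int n}. gaussian_density k \<Omega> (y i)) =
    exp (- mtrace ((rows_mat n k a y)\<^sup>T * rows_mat n k a y * minv \<Omega>) / 2) / sqrt ((2 * pi) ^ k * mdet \<Omega>) ^ n"
proof -
  have "(\<Prod>i\<in>{a..<a + int n}. gaussian_density k \<Omega> (y i)) = (\<Prod>i<n. gaussian_density k \<Omega> (\<lambda>j. rows_mat n k a y $$ (i, j)))"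
    unfolding prod_int_interval by (intro prod.cong gaussian_density_cong) (auto simp: rows_mat_def)
  thus ?thesis using gaussian_density_rows[OF \<Omega> rows_mat_carrier] by simp
qed

text \<open>As a quadratic in \<open>P\<close> the left side has leading coefficient
  \<open>A\<^sup>T * A + 1\<^sub>m q\<close> and centre \<open>m\<close>, as in ridge regression;
  the value at the centre produces the weight of \<open>K_mat\<close>. In use, \<open>A\<close> is
  lambda, \<open>P\<close> holds the pre-sample errors and \<open>H\<close> is
  \<open>minv (Theta q T \<theta>)\<close> times \<open>Z_mat\<close>.\<close>

lemma complete_the_square:
  fixes A H P L :: "real mat"
  assumes A: "A \<in> carrier_mat T q" and H: "H \<in> carrier_mat T k" and P: "P \<in> carrier_mat q k"
    and L: "L \<in> carrier_mat q q" and LL: "A\<^sup>T * A + 1\<^sub>m q = L\<^sup>T * L"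
    and inv: "invertible_mat (A\<^sup>T * A + 1\<^sub>m q)"
  defines "m \<equiv> minv (A\<^sup>T * A + 1\<^sub>m q) * A\<^sup>T * H"
  shows "P\<^sup>T * P + (H - A * P)\<^sup>T * (H - A * P) =
    H\<^sup>T * (1\<^sub>m T - A * minv (A\<^sup>T * A + 1\<^sub>m q) * A\<^sup>T) * H + (L * (P - m))\<^sup>T * (L * (P - m))"
proof -
  let ?G = "A\<^sup>T * A + 1\<^sub>m q"
  have Gc: "?G \<in> carrier_mat q q" using A by auto
  have Gt: "(?G)\<^sup>T = ?G" using A by (simp add: mat_dim_simps)
  note i = minv_props[OF Gc inv]
  have m: "m \<in> carrier_mat q k" using i A H by (auto simp: m_def)
  have Gm: "?G * m = A\<^sup>T * H"
  proof -
    have "?G * m = ?G * (minv ?G * (A\<^sup>T * H))" unfolding m_def using i(1) A H by (simp only: mult_assoc_dim carrier_matD index_transpose_mat)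
    also have "\<dots> = A\<^sup>T * H" by (rule mult_cancel_mid) (use i A H in auto)
    finally show ?thesis .
  qed
  have mG: "m\<^sup>T * ?G = H\<^sup>T * A"
  proof -
    have "m\<^sup>T * ?G = (?G * m)\<^sup>T" using m Gc by (subst transpose_mult_dim) (simp_all only: Gt carrier_matD)
    thus ?thesis unfolding Gm using A H by (simp add: transpose_mult_dim)
  qed
  have "(L * (P - m))\<^sup>T * (L * (P - m)) = (P - m)\<^sup>T * (L\<^sup>T * L) * (P - m)"
    using L P m by (simp add: transpose_mult_dim mult_assoc_dim)
  also have "\<dots> = (P\<^sup>T * ?G * P - P\<^sup>T * (?G * m)) - (m\<^sup>T * ?G * P - m\<^sup>T * (?G * m))"
  proof -
    \<comment> \<open>A variable \<open>S\<close> in place of \<open>?G\<close> keeps the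
      distributive laws from splitting the sum inside \<open>?G\<close>.\<close>
    have "(P - m)\<^sup>T * S * (P - m) = (P\<^sup>T * S * P - P\<^sup>T * (S * m)) - (m\<^sup>T * S * P - m\<^sup>T * (S * m))"
      if "S \<in> carrier_mat q q" for S
    proof -
      have "(P - m)\<^sup>T * S * (P - m) = P\<^sup>T * (S * P) - m\<^sup>T * (S * P) - (P\<^sup>T * (S * m) - m\<^sup>T * (S * m))"
        using that P m by (simp add: mat_dim_simps mult_assoc_dim)
      also have "\<dots> = (P\<^sup>T * (S * P) - P\<^sup>T * (S * m)) - (m\<^sup>T * (S * P) - m\<^sup>T * (S * m))"
      proof -
        have "X - Y - (U - V) = (X - U) - (Y - V)" if "X \<in> carrier_mat k k" "Y \<in> carrier_mat k k"
          "U \<in> carrier_mat k k" "V \<in> carrier_mat k k" for X Y U V :: "real mat"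
          using that by (intro eq_matI) auto
        thus ?thesis using that P m by (meson mult_carrier_mat transpose_carrier_mat)
      qed
      finally show ?thesis using that P m by (simp add: mult_assoc_dim)
    qed
    thus ?thesis using LL Gc by metis
  qed
  also have "\<dots> = (P\<^sup>T * ?G * P - P\<^sup>T * A\<^sup>T * H) - (H\<^sup>T * A * P - H\<^sup>T * A * minv ?G * A\<^sup>T * H)"
  proof -
    have "m\<^sup>T * (?G * m) = H\<^sup>T * A * minv ?G * A\<^sup>T * H"
    proof -
      have "m\<^sup>T * (?G * m) = (m\<^sup>T * ?G) * m" using m Gc by (subst mult_assoc_dim) (simp_all only: carrier_matD index_transpose_mat)
      also have "\<dots> = H\<^sup>T * A * minv ?G * A\<^sup>T * H" unfolding mG unfolding m_def
        using i(1) A H by (simp only: mult_assoc_dim carrier_matD index_transpose_mat index_mult_mat)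
      finally show ?thesis .
    qed
    moreover have "P\<^sup>T * (A\<^sup>T * H) = P\<^sup>T * A\<^sup>T * H" using P A H by (simp add: mult_assoc_dim)
    ultimately show ?thesis by (simp only: Gm mG)
  qed
  finally have 1: "(L * (P - m))\<^sup>T * (L * (P - m)) =
    (P\<^sup>T * ?G * P - P\<^sup>T * A\<^sup>T * H) - (H\<^sup>T * A * P - H\<^sup>T * A * minv ?G * A\<^sup>T * H)" .
  have 2: "P\<^sup>T * ?G * P = P\<^sup>T * A\<^sup>T * A * P + P\<^sup>T * P" using P A by (simp add: mat_dim_simps mult_assoc_dim)
  have 3: "(H - A * P)\<^sup>T * (H - A * P) = (H\<^sup>T * H - P\<^sup>T * A\<^sup>T * H) - (H\<^sup>T * A * P - P\<^sup>T * A\<^sup>T * A * P)"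
    using P A H by (simp add: mat_dim_simps mult_assoc_dim)
  have 4: "H\<^sup>T * (1\<^sub>m T - A * minv ?G * A\<^sup>T) * H = H\<^sup>T * H - H\<^sup>T * A * minv ?G * A\<^sup>T * H"
    using i(1) A H by (simp add: mat_dim_simps mult_assoc_dim)
  \<comment> \<open>Only additive bookkeeping of six matrices of equal shape remains; naming them
    lets it be checked entrywise.\<close>
  have "PP + (HH - PAH - (HAP - PAAP)) = (HH - HKH) + (PAAP + PP - PAH - (HAP - HKH))"
    if "PP \<in> carrier_mat k k" "HH \<in> carrier_mat k k" "PAH \<in> carrier_mat k k" "HAP \<in> carrier_mat k k"
      "PAAP \<in> carrier_mat k k" "HKH \<in> carrier_mat k k" for PP HH PAH HAP PAAP HKH :: "real mat"
    using that by (intro eq_matI) auto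
  from this[of "P\<^sup>T * P" "H\<^sup>T * H" "P\<^sup>T * A\<^sup>T * H" "H\<^sup>T * A * P" "P\<^sup>T * A\<^sup>T * A * P" "H\<^sup>T * A * minv ?G * A\<^sup>T * H"]
  show ?thesis unfolding 1 2 3 4 using A H P i(1) by (meson mult_carrier_mat transpose_carrier_mat)
qed

text \<open>Time 0 is the first sample time. Lags l up to i fall on sample errors and are collected
  by \<open>Theta\<close>; larger lags fall on pre-sample errors, where column \<open>m\<close> has
  time m - q and lag q + i - m.\<close>

lemma Theta_sums:
  fixes f :: "int \<Rightarrow> real"
  assumes "q \<le> T" "i < T"
  shows "(\<Sum>m<T. Theta q T \<theta> $$ (i, m) * f (int m)) + (\<Sum>m<q. Theta_star_ext q T \<theta> $$ (i, m) * f (int m - int q))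
    = (\<Sum>l=0..q. \<theta> l * f (int i - int l))"
proof -
  have "(\<Sum>m<T. Theta q T \<theta> $$ (i, m) * f (int m)) = (\<Sum>m\<in>{m. m \<le> i \<and> i - m \<le> q}. \<theta> (i - m) * f (int m))"
    by (rule sum.mono_neutral_cong_right) (use assms in \<open>auto simp: Theta_def\<close>)
  also have "\<dots> = (\<Sum>l\<in>{l\<in>{0..q}. l \<le> i}. \<theta> l * f (int i - int l))"
    by (rule sum.reindex_bij_witness[of _ "\<lambda>l. i - l" "\<lambda>m. i - m"]) (auto simp: of_nat_diff)
  finally have 1: "(\<Sum>m<T. Theta q T \<theta> $$ (i, m) * f (int m)) = \<dots>" .
  have "(\<Sum>m<q. Theta_star_ext q T \<theta> $$ (i, m) * f (int m - int q)) =
      (\<Sum>m\<in>{i..<q}. \<theta> (q - (m - i)) * f (int m - int q))"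
    by (rule sum.mono_neutral_cong_right) (use assms in \<open>auto simp: Theta_star_ext_index\<close>)
  also have "\<dots> = (\<Sum>l\<in>{l\<in>{0..q}. \<not> l \<le> i}. \<theta> l * f (int i - int l))"
    by (rule sum.reindex_bij_witness[of _ "\<lambda>l. q + i - l" "\<lambda>m. q - (m - i)"])
      (auto simp: of_nat_diff algebra_simps)
  finally have 2: "(\<Sum>m<q. Theta_star_ext q T \<theta> $$ (i, m) * f (int m - int q)) = \<dots>" .
  have "(\<Sum>l=0..q. \<theta> l * f (int i - int l)) = (\<Sum>l\<in>{l\<in>{0..q}. l \<le> i} \<union> {l\<in>{0..q}. \<not> l \<le> i}. \<theta> l * f (int i - int l))"
    by (intro sum.cong) auto
  also have "\<dots> = (\<Sum>l\<in>{l\<in>{0..q}. l \<le> i}. \<theta> l * f (int i - int l)) + (\<Sum>l\<in>{l\<in>{0..q}. \<not> l \<le> i}. \<theta> l * f (int i - int l))"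
    by (rule sum.union_disjoint) auto
  finally show ?thesis unfolding 1 2 by simp
qed

text \<open>The normalising constant \<open>u\<close> of the pre-sample errors passes to the
  completed square, while \<open>v\<close>, that of the sample, stays with the remaining quadratic
  form.\<close>

lemma exp_half_swap:
  fixes x y t z u v :: real
  assumes "x + y = t + z"
  shows "exp (- x / 2) / u * (exp (- y / 2) / v) = exp (- t / 2) / v * (exp (- z / 2) / u)"
proof -
  have "- x / 2 + - y / 2 = - t / 2 + - z / 2" using assms by argo
  hence "exp (- x / 2) * exp (- y / 2) = exp (- t / 2) * exp (- z / 2)" by (simp only: exp_add[symmetric])
  thus ?thesis by (simp only: times_divide_times_eq mult.commute[of v u])
qed

text \<open>After completing the square the integrand is a constant times the product density at
  \<open>L * (P - m)\<close>. The substitution contributes the inverse of the k-th power of det L,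
  and the square of det L is the determinant of \<open>gram_lambda\<close>; this is the origin of
  the factor k / 2 before its logarithm. The normalisation \<open>one\<close> is requested only if
  there is a pre-sample error, whose law will supply it.\<close>

lemma gaussian_marginal:
  fixes \<theta> :: "nat \<Rightarrow> real" and a :: int
  assumes \<theta>0: "\<theta> 0 = 1" and qT: "q \<le> T" and pd: "pos_def k \<Omega>" and H: "H \<in> carrier_mat T k"
    and one: "0 < q \<Longrightarrow> (\<integral>\<^sup>+v. ennreal (gaussian_density k \<Omega> v) \<partial>lebesgue_space k) = 1"
  shows "(\<integral>\<^sup>+P. ennreal ((\<Prod>s\<in>{a..<a + int q}. gaussian_density k \<Omega> (P s)) *
      (\<Prod>i<T. gaussian_density k \<Omega> (\<lambda>j. (H - lambda_mat q T \<theta> * rows_mat q k a P) $$ (i, j))))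
      \<partial>PiM {a..<a + int q} (\<lambda>_. lebesgue_space k)) =
    ennreal (exp (- (real (T * k) / 2) * ln (2 * pi) - (real T / 2) * ln (mdet \<Omega>)
     - (real k / 2) * ln (mdet (gram_lambda q T \<theta>)) - (1 / 2) * mtrace (H\<^sup>T * K_mat q T \<theta> * H * minv \<Omega>)))"
proof -
  let ?A = "lambda_mat q T \<theta>" and ?G = "gram_lambda q T \<theta>" and ?gd = "gaussian_density k \<Omega>"
  let ?J = "{a..<a + int q}"
  let ?PJ = "PiM ?J (\<lambda>_. lebesgue_space k)"
  note ctx = \<theta>0 qT
  have A: "?A \<in> carrier_mat T q" by (rule lambda_carrier[where \<theta> = \<theta>, OF ctx])
  have Gpd: "pos_def q ?G" by (rule gram_lambda_pos_def[where \<theta> = \<theta>, OF ctx])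
  have Gc: "?G \<in> carrier_mat q q" using Gpd by (simp add: pos_def_def)
  have \<Omega>: "\<Omega> \<in> carrier_mat k k" "invertible_mat \<Omega>" "0 < mdet \<Omega>"
    using pos_def_invertible[OF pd] pos_def_det_pos[OF pd] pd by (simp_all add: pos_def_def)
  note W = minv_props(1)[OF \<Omega>(1,2)]
  obtain L where L: "L \<in> carrier_mat q q" "?G = L\<^sup>T * L"
    "\<And>i j. i < j \<Longrightarrow> j < q \<Longrightarrow> L $$ (i, j) = 0" "\<And>i. i < q \<Longrightarrow> 0 < L $$ (i, i)"
    "invertible_mat L" "mdet L = (\<Prod>i<q. L $$ (i, i))" "0 < mdet L"
  proof (rule cholesky[OF Gpd])
    fix L assume a: "L \<in> carrier_mat q q" "?G = L\<^sup>T * L"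
      "\<And>i j. i < j \<Longrightarrow> j < q \<Longrightarrow> L $$ (i, j) = 0" "\<And>i. i < q \<Longrightarrow> 0 < L $$ (i, i)"
      "invertible_mat L" "mdet L = (\<Prod>i<q. L $$ (i, i))" "0 < mdet L"
    show thesis by (rule that[OF a])
  qed
  define m where "m = minv ?G * ?A\<^sup>T * H"
  have m: "m \<in> carrier_mat q k" using A H minv_props(1)[OF Gc pos_def_invertible[OF Gpd]] by (auto simp: m_def)
  define c0 where "c0 = sqrt ((2 * pi) ^ k * mdet \<Omega>)"
  have c0: "0 < c0" using \<Omega> by (simp add: c0_def)
  define t where "t = mtrace (H\<^sup>T * K_mat q T \<theta> * H * minv \<Omega>)"
  define C where "C = exp (- t / 2) / c0 ^ T"
  \<comment> \<open>Row \<open>n\<close> of \<open>L * (P - m)\<close> without its diagonal term;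
    the sum stops before \<open>n\<close> because \<open>L\<close> is lower triangular.\<close>
  define g where "g = (\<lambda>n (y :: int \<Rightarrow> nat \<Rightarrow> real) j. (\<Sum>l<n. L $$ (n, l) * y (a + int l) j) - (L * m) $$ (n, j))"
  have comp: "(\<lambda>y. y i j) \<in> borel_measurable ?PJ" if "i \<in> ?J" "j < k" for i j
    by (rule measurable_PiM_lebesgue_component[of "\<lambda>y. y", OF _ that]) simp
  interpret triangular k q a "\<lambda>n. L $$ (n, n)" g
  proof
    show "0 < L $$ (n, n)" if "n < q" for n using L(4) that .
    show "g n y j = g n y' j" if "\<And>i. a \<le> i \<Longrightarrow> i < a + int n \<Longrightarrow> y i = y' i" for n y y' j
      using that by (auto simp: g_def intro!: sum.cong)
    show "(\<lambda>y. g n y j) \<in> borel_measurable ?PJ" if "n < q" "j < k" for n j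
      unfolding g_def using that
      by (intro borel_measurable_diff borel_measurable_sum borel_measurable_times borel_measurable_const comp) auto
  qed
  let ?t = "tri_map k a (\<lambda>n. L $$ (n, n)) g q"
  have rows_t: "rows_mat q k a (?t P) = L * (rows_mat q k a P - m)" for P
  proof (rule eq_matI)
    fix i j assume "i < dim_row (L * (rows_mat q k a P - m))" "j < dim_col (L * (rows_mat q k a P - m))"
    hence ij: "i < q" "j < k" using L(1) m by auto
    have "(L * rows_mat q k a P) $$ (i, j) = (\<Sum>l<q. L $$ (i, l) * P (a + int l) j)"
      using ij L(1) by (simp add: scalar_prod_def atLeast0LessThan rows_mat_def)
    also have "\<dots> = (\<Sum>l<Suc i. L $$ (i, l) * P (a + int l) j)"
      by (rule sum.mono_neutral_right) (use ij L(3) in auto)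
    finally have "(L * rows_mat q k a P) $$ (i, j) = \<dots>" .
    moreover have "L * (rows_mat q k a P - m) = L * rows_mat q k a P - L * m"
      using L(1) m by (simp add: mult_minus_distrib_dim rows_mat_def)
    moreover have "(L * rows_mat q k a P - L * m) $$ (i, j) = (L * rows_mat q k a P) $$ (i, j) - (L * m) $$ (i, j)"
      using ij L(1) m by simp
    ultimately show "rows_mat q k a (?t P) $$ (i, j) = (L * (rows_mat q k a P - m)) $$ (i, j)"
      using ij by (simp add: rows_mat_def tri_map_def g_def)
  qed (use L(1) m in \<open>auto simp: rows_mat_def\<close>)
  have integrand: "(\<Prod>s\<in>?J. ?gd (P s)) * (\<Prod>i<T. ?gd (\<lambda>j. (H - ?A * rows_mat q k a P) $$ (i, j))) =
      C * (\<Prod>s\<in>?J. ?gd (?t P s))" for P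
  proof -
    let ?P = "rows_mat q k a P"
    have R: "H - ?A * ?P \<in> carrier_mat T k" using A H by (intro minus_carrier_mat mult_carrier_mat) auto
    have sq: "?P\<^sup>T * ?P + (H - ?A * ?P)\<^sup>T * (H - ?A * ?P) =
        H\<^sup>T * K_mat q T \<theta> * H + (L * (?P - m))\<^sup>T * (L * (?P - m))"
      using complete_the_square[OF A H rows_mat_carrier L(1), of a P] L(2) pos_def_invertible[OF Gpd]
      unfolding K_mat_def m_def gram_lambda_def by simp
    have K: "K_mat q T \<theta> \<in> carrier_mat T T" by (rule K_carrier[where \<theta> = \<theta>, OF ctx])
    have LP: "L * (?P - m) \<in> carrier_mat q k" using L(1) m by (intro mult_carrier_mat[of _ _ q] minus_carrier_mat) auto
    have tr: "mtrace ((X + Y) * minv \<Omega>) = mtrace (X * minv \<Omega>) + mtrace (Y * minv \<Omega>)"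
      if "X \<in> carrier_mat k k" "Y \<in> carrier_mat k k" for X Y
      using that W by (subst add_mult_distrib_dim) (auto intro!: mtrace_add)
    have eq: "mtrace (?P\<^sup>T * ?P * minv \<Omega>) + mtrace ((H - ?A * ?P)\<^sup>T * (H - ?A * ?P) * minv \<Omega>) =
        t + mtrace ((L * (?P - m))\<^sup>T * (L * (?P - m)) * minv \<Omega>)"
    proof -
      have c: "?P\<^sup>T * ?P \<in> carrier_mat k k" "(H - ?A * ?P)\<^sup>T * (H - ?A * ?P) \<in> carrier_mat k k"
        "H\<^sup>T * K_mat q T \<theta> * H \<in> carrier_mat k k" "(L * (?P - m))\<^sup>T * (L * (?P - m)) \<in> carrier_mat k k"
        using R K H LP by (meson mult_carrier_mat transpose_carrier_mat rows_mat_carrier)+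
      show ?thesis using arg_cong[OF sq, of "\<lambda>X. mtrace (X * minv \<Omega>)"]
        unfolding tr[OF c(1,2)] tr[OF c(3,4)] t_def .
    qed
    show ?thesis
      unfolding gaussian_density_rows_mat[OF \<Omega>(1,2)] gaussian_density_rows[OF \<Omega>(1,2) R] rows_t C_def
        c0_def[symmetric]
      by (rule exp_half_swap[OF eq])
  qed
  have gd0: "0 \<le> ?gd v" for v using gaussian_density_nonneg[OF \<Omega>(3)] .
  have gdm: "(\<lambda>v. ennreal (?gd v)) \<in> borel_measurable (lebesgue_space k)"
    using gaussian_density_meas[OF \<Omega>(1,2), of "\<lambda>v. v" "lebesgue_space k"] measurable_lebesgue_space_component[OF measurable_ident]
    by simp
  define F where "F = (\<lambda>P. \<Prod>s\<in>?J. ennreal (?gd (P s)))"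
  have Fm: "F \<in> borel_measurable ?PJ"
  proof -
    have "(\<lambda>P. ennreal (?gd (P s))) \<in> borel_measurable ?PJ" if "s \<in> ?J" for s
      using gaussian_density_meas[OF \<Omega>(1,2), of "\<lambda>P. P s" ?PJ] comp that by simp
    thus ?thesis unfolding F_def by (intro borel_measurable_prod_ennreal)
  qed
  define D where "D = (\<Prod>i<q. L $$ (i, i) ^ k)"
  have D: "D = mdet L ^ k" unfolding D_def L(6) by (simp add: prod_power_distrib)
  have Dpos: "0 < D" unfolding D using L(7) by simp
  have "ennreal D * (\<integral>\<^sup>+P. F (?t P) \<partial>?PJ) = (\<integral>\<^sup>+P. F P \<partial>?PJ)"
    unfolding D_def by (rule nn_integral_tri_map[OF order_refl Fm])
  also have "\<dots> = (\<Prod>s\<in>?J. \<integral>\<^sup>+v. ennreal (?gd v) \<partial>lebesgue_space k)"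
    unfolding F_def by (rule lebesgue_prod.product_nn_integral_prod) (use gdm in auto)
  \<comment> \<open>For q = 0 the product is empty; otherwise \<open>one\<close> applies to each
    factor.\<close>
  also have "\<dots> = 1" by (rule prod.neutral) (use one in auto)
  finally have I: "ennreal D * (\<integral>\<^sup>+P. F (?t P) \<partial>?PJ) = 1" .
  have "(\<integral>\<^sup>+P. F (?t P) \<partial>?PJ) = ennreal (1 / D) * (ennreal D * (\<integral>\<^sup>+P. F (?t P) \<partial>?PJ))"
    using Dpos by (simp add: mult.assoc[symmetric] ennreal_mult[symmetric])
  hence I': "(\<integral>\<^sup>+P. F (?t P) \<partial>?PJ) = ennreal (1 / D)" unfolding I by simp
  have C0: "0 \<le> C" using c0 by (simp add: C_def)
  have "(\<integral>\<^sup>+P. ennreal ((\<Prod>s\<in>?J. ?gd (P s)) * (\<Prod>i<T. ?gd (\<lambda>j. (H - ?A * rows_mat q k a P) $$ (i, j)))) \<partial>?PJ)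
     = (\<integral>\<^sup>+P. ennreal C * F (?t P) \<partial>?PJ)"
    unfolding integrand F_def using C0 gd0 by (simp add: ennreal_mult prod_nonneg prod_ennreal)
  also have "\<dots> = ennreal C * (\<integral>\<^sup>+P. F (?t P) \<partial>?PJ)"
    by (rule nn_integral_cmult) (rule measurable_compose[OF tri_map_meas[OF order_refl] Fm])
  also have "\<dots> = ennreal (C / D)"
    unfolding I' using C0 Dpos by (simp add: ennreal_mult[symmetric])
  also have "C / D = exp (- (real (T * k) / 2) * ln (2 * pi) - (real T / 2) * ln (mdet \<Omega>)
     - (real k / 2) * ln (mdet ?G) - (1 / 2) * t)"
  proof -
    have detG: "mdet ?G = mdet L * mdet L"
      unfolding L(2) using L(1) by (simp add: det_mult[of _ q] det_transpose[of _ q])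
    have "ln (mdet ?G) = 2 * ln (mdet L)" unfolding detG using L(7) by (simp add: ln_mult)
    hence lnD: "ln D = real k / 2 * ln (mdet ?G)" unfolding D using L(7) by (simp add: ln_realpow)
    have "ln c0 = (real k * ln (2 * pi) + ln (mdet \<Omega>)) / 2"
      unfolding c0_def using \<Omega>(3) by (simp add: ln_sqrt ln_mult ln_realpow distrib_left distrib_right)
    hence lnc: "ln (c0 ^ T) = real (T * k) / 2 * ln (2 * pi) + real T / 2 * ln (mdet \<Omega>)"
      using c0 by (simp add: ln_realpow field_simps)
    have "0 < C / D" using c0 Dpos by (simp add: C_def)
    hence "C / D = exp (ln (C / D))" by simp
    also have "ln (C / D) = - t / 2 - ln (c0 ^ T) - ln D"
    proof -
      have "C / D = exp (- t / 2) / (c0 ^ T * D)" by (simp add: C_def)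
      moreover have "ln (exp (- t / 2) / (c0 ^ T * D)) = ln (exp (- t / 2)) - ln (c0 ^ T * D)"
        using c0 Dpos by (subst ln_div) simp_all
      moreover have "ln (c0 ^ T * D) = ln (c0 ^ T) + ln D" using c0 Dpos by (subst ln_mult) simp_all
      ultimately show ?thesis by simp
    qed
    finally show ?thesis unfolding lnc lnD by (simp add: algebra_simps)
  qed
  finally show ?thesis unfolding t_def .
qed

text \<open>Independence of \<open>W\<close> from the error path factors the joint law, and
  independence among the errors gives the path a product density with respect to the product of
  Lebesgue measures.\<close>

lemma nn_integral_indep_density:
  fixes E :: "int set" and g :: "(nat \<Rightarrow> real) \<Rightarrow> ennreal"
  assumes "prob_space M" and fin: "finite E"
    and dens: "\<And>s. s \<in> E \<Longrightarrow> distributed M (lebesgue_space k) (\<epsilon> s) g"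
    and ind: "prob_space.indep_vars M (\<lambda>_. lebesgue_space k) \<epsilon> E"
    and indW: "prob_space.indep_var M S W (PiM E (\<lambda>_. lebesgue_space k)) (obs_path E \<epsilon>)"
    and F: "F \<in> borel_measurable (S \<Otimes>\<^sub>M PiM E (\<lambda>_. lebesgue_space k))"
  shows "(\<integral>\<^sup>+\<omega>. F (W \<omega>, obs_path E \<epsilon> \<omega>) \<partial>M) =
    (\<integral>\<^sup>+w. \<integral>\<^sup>+e. (\<Prod>s\<in>E. g (e s)) * F (w, e) \<partial>PiM E (\<lambda>_. lebesgue_space k) \<partial>distr M S W)"
proof -
  interpret prob_space M by fact
  let ?N = "lebesgue_space k"
  let ?P = "PiM E (\<lambda>_. ?N)"
  have rv: "random_variable S W" "random_variable ?P (obs_path E \<epsilon>)"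
    and joint: "distr M S W \<Otimes>\<^sub>M distr M ?P (obs_path E \<epsilon>) = distr M (S \<Otimes>\<^sub>M ?P) (\<lambda>x. (W x, obs_path E \<epsilon> x))"
    using indW unfolding indep_var_distribution_eq by auto
  have \<epsilon>: "s \<in> E \<Longrightarrow> random_variable ?N (\<epsilon> s)" for s using dens distributed_measurable by blast
  have gm: "g \<in> borel_measurable ?N" if "s \<in> E" for s using dens[OF that] distributed_borel_measurable by blast
  have gs: "(\<lambda>e. g (e s)) \<in> borel_measurable ?P" if "s \<in> E" for s
    using measurable_compose[OF measurable_component_singleton[OF that] gm[OF that]] .
  have gprod: "(\<lambda>e. \<Prod>s\<in>E. g (e s)) \<in> borel_measurable ?P" using gs by (intro borel_measurable_prod_ennreal)
  have law: "distr M ?P (obs_path E \<epsilon>) = density ?P (\<lambda>e. \<Prod>s\<in>E. g (e s))"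
  proof (cases "E = {}")
    \<comment> \<open>Without any error times (q = T = 0 in the application) the path space is a
      single point and both measures give it mass 1; the product criterion for independence used in
      the other case needs a nonempty index set.\<close>
    case True
    have o: "obs_path E \<epsilon> = (\<lambda>_ _. undefined)" using True by (intro ext) (simp add: obs_path_def)
    have "distr M ?P (obs_path E \<epsilon>) = ?P"
    proof (rule lebesgue_prod.PiM_eqI[OF fin])
      fix A assume "\<And>i. i \<in> E \<Longrightarrow> A i \<in> sets ?N"
      show "emeasure (distr M ?P (obs_path E \<epsilon>)) (Pi\<^sub>E E A) = (\<Prod>i\<in>E. emeasure ?N (A i))"
        using rv(2) True o by (subst emeasure_distr) (auto simp: emeasure_space_1 PiM_empty)
    qed simp
    moreover have "density ?P (\<lambda>e. \<Prod>s\<in>E. g (e s)) = ?P" using True by (simp add: density_1)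
    ultimately show ?thesis by simp
  next
    case False
    then obtain s0 where s0: "s0 \<in> E" by blast
    have dN: "distr M ?N (\<epsilon> s) = density ?N g" if "s \<in> E" for s
      using dens[OF that] by (rule distributed_distr_eq_density)
    interpret g: prob_space "density ?N g"
      unfolding dN[OF s0, symmetric] by (rule prob_space_distr[OF \<epsilon>[OF s0]])
    interpret gp: product_sigma_finite "\<lambda>_ :: int. density ?N g" by standard
    have "distr M ?P (obs_path E \<epsilon>) = PiM E (\<lambda>s. distr M ?N (\<epsilon> s))"
      using iffD1[OF indep_vars_iff_distr_eq_PiM'[OF False \<epsilon>] ind] by (simp add: obs_path_def[abs_def])
    also have "\<dots> = PiM E (\<lambda>_. density ?N g)" by (intro PiM_cong dN) auto
    also have "\<dots> = density ?P (\<lambda>e. \<Prod>s\<in>E. g (e s))"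
    proof (rule gp.PiM_eqI[OF fin, symmetric])
      show "sets (density ?P (\<lambda>e. \<Prod>s\<in>E. g (e s))) = sets (PiM E (\<lambda>_. density ?N g))"
        by (simp cong: sets_PiM_cong)
      fix A assume "\<And>i. i \<in> E \<Longrightarrow> A i \<in> sets (density ?N g)"
      hence A: "\<And>i. i \<in> E \<Longrightarrow> A i \<in> sets ?N" by simp
      have "emeasure (density ?P (\<lambda>e. \<Prod>s\<in>E. g (e s))) (Pi\<^sub>E E A) =
          (\<integral>\<^sup>+e. (\<Prod>s\<in>E. g (e s)) * indicator (Pi\<^sub>E E A) e \<partial>?P)"
        using gprod A fin by (intro emeasure_density sets_PiM_I_finite) auto
      also have "\<dots> = (\<integral>\<^sup>+e. (\<Prod>s\<in>E. g (e s) * indicator (A s) (e s)) \<partial>?P)"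
      proof (rule nn_integral_cong)
        fix e assume "e \<in> space ?P"
        hence "e \<in> Pi\<^sub>E E A \<longleftrightarrow> (\<forall>s\<in>E. e s \<in> A s)" by (auto simp: space_PiM PiE_def)
        \<comment> \<open>The indicator of a box factors over the times, which lets the product rule
          for integrals apply.\<close>
        hence "indicator (Pi\<^sub>E E A) e = (\<Prod>s\<in>E. indicator (A s) (e s) :: ennreal)"
          using fin by (auto simp: indicator_def prod_zero_iff)
        thus "(\<Prod>s\<in>E. g (e s)) * indicator (Pi\<^sub>E E A) e = (\<Prod>s\<in>E. g (e s) * indicator (A s) (e s))"
          by (simp add: prod.distrib)
      qed
      also have "\<dots> = (\<Prod>s\<in>E. \<integral>\<^sup>+v. g v * indicator (A s) v \<partial>?N)"
        using gm A by (intro lebesgue_prod.product_nn_integral_prod fin borel_measurable_times) auto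
      also have "\<dots> = (\<Prod>s\<in>E. emeasure (density ?N g) (A s))"
        using gm A by (intro prod.cong refl emeasure_density[symmetric]) auto
      finally show "emeasure (density ?P (\<lambda>e. \<Prod>s\<in>E. g (e s))) (Pi\<^sub>E E A) = (\<Prod>s\<in>E. emeasure (density ?N g) (A s))" .
    qed
    finally show ?thesis .
  qed
  have sf: "sigma_finite_measure (distr M ?P (obs_path E \<epsilon>))"
    by (intro prob_space_imp_sigma_finite prob_space_distr rv)
  have meas: "(\<lambda>x. (W x, obs_path E \<epsilon> x)) \<in> measurable M (S \<Otimes>\<^sub>M ?P)" using rv by measurable
  have "(\<integral>\<^sup>+\<omega>. F (W \<omega>, obs_path E \<epsilon> \<omega>) \<partial>M) = (\<integral>\<^sup>+z. F z \<partial>(distr M S W \<Otimes>\<^sub>M distr M ?P (obs_path E \<epsilon>)))"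
    unfolding joint by (rule nn_integral_distr[OF meas, symmetric]) (use F in simp)
  also have "\<dots> = (\<integral>\<^sup>+w. \<integral>\<^sup>+e. F (w, e) \<partial>distr M ?P (obs_path E \<epsilon>) \<partial>distr M S W)"
    by (rule sigma_finite_measure.nn_integral_fst[OF sf, symmetric])
      (use F in \<open>simp cong: measurable_cong_sets sets_pair_measure_cong\<close>)
  also have "\<dots> = (\<integral>\<^sup>+w. \<integral>\<^sup>+e. (\<Prod>s\<in>E. g (e s)) * F (w, e) \<partial>?P \<partial>distr M S W)"
    unfolding law
  proof (rule nn_integral_cong)
    fix w assume "w \<in> space (distr M S W)"
    hence "(\<lambda>e. F (w, e)) \<in> borel_measurable ?P"
      using measurable_compose[OF measurable_Pair1' F] by simp
    thus "(\<integral>\<^sup>+e. F (w, e) \<partial>density ?P (\<lambda>e. \<Prod>s\<in>E. g (e s))) = (\<integral>\<^sup>+e. (\<Prod>s\<in>E. g (e s)) * F (w, e) \<partial>?P)"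
      by (rule nn_integral_density[OF gprod])
  qed
  finally show ?thesis .
qed

subsection \<open>The conditional likelihood\<close>

text \<open>For given initial observations w and pre-sample errors P, the errors at the times
  p + 1, ..., p + T as functions of the observations y at these times.\<close>

definition innovations :: "nat \<Rightarrow> nat \<Rightarrow> nat \<Rightarrow> nat \<Rightarrow> (nat \<Rightarrow> real) \<Rightarrow> real mat \<Rightarrow> (nat \<Rightarrow> real mat) \<Rightarrow>
    (int \<Rightarrow> nat \<Rightarrow> real) \<Rightarrow> (int \<Rightarrow> nat \<Rightarrow> real) \<Rightarrow> (int \<Rightarrow> nat \<Rightarrow> real) \<Rightarrow> real mat" where
  "innovations p q k T \<theta> \<mu> \<Phi> w P y = minv (Theta q T \<theta>) *
     (Z_mat p k T \<mu> \<Phi> (merge {1..int p} {int p + 1..<int p + 1 + int T} (w, y))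
       - Theta_star_ext q T \<theta> * rows_mat q k (int p + 1 - int q) P)"

locale varma_coefficients =
  fixes p q k T :: nat and \<theta> :: "nat \<Rightarrow> real" and \<mu> :: "real mat" and \<Phi> :: "nat \<Rightarrow> real mat"
  assumes \<theta>0: "\<theta> 0 = 1" and qT: "q \<le> T"
    and \<mu>: "\<mu> \<in> carrier_mat 1 k" and \<Phi>: "\<forall>i\<in>{1..p}. \<Phi> i \<in> carrier_mat k k"
begin

abbreviation "a \<equiv> int p + 1"
abbreviation "Ip \<equiv> {1..int p}"
abbreviation "I \<equiv> {int p + 1..<int p + 1 + int T}"
text \<open>The right end point is left unsimplified to match the interval shape of the triangular
  maps, with q steps starting at p + 1 - q.\<close>

abbreviation "J \<equiv> {int p + 1 - int q..<int p + 1 - int q + int q}"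
abbreviation "inn \<equiv> innovations p q k T \<theta> \<mu> \<Phi>"
abbreviation "NS K \<equiv> PiM K (\<lambda>_ :: int. lebesgue_space k)"
text \<open>The translation part of the map from observations to errors: what remains of row
  \<open>n\<close> after removing the current observation.\<close>

abbreviation "Gf w P n y j \<equiv> inn w P y $$ (n, j) - y (a + int n) j"

lemmas N = minv_Theta[where \<theta> = \<theta> and q = q and T = T, OF \<theta>0 qT]

lemma Z_carrier [simp]: "Z_mat p k T \<mu> \<Phi> x \<in> carrier_mat T k"
  by (simp add: Z_mat_def)

lemma D_carrier: "Z_mat p k T \<mu> \<Phi> x - Theta_star_ext q T \<theta> * rows_mat q k b P \<in> carrier_mat T k"
  using Theta_star_ext_carrier[OF qT, of \<theta>] by (intro minus_carrier_mat mult_carrier_mat) auto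

text \<open>Separates the pre-sample errors from the observations, in the form
  \<open>H - A * P\<close> integrated in \<open>gaussian_marginal\<close>.\<close>

lemma innovations_affine:
  "inn w P y = minv (Theta q T \<theta>) * Z_mat p k T \<mu> \<Phi> (merge Ip I (w, y)) -
     lambda_mat q T \<theta> * rows_mat q k (a - int q) P"
  unfolding innovations_def lambda_mat_def
  using carrier_matD[OF N(1)] carrier_matD[OF Z_carrier] carrier_matD[OF rows_mat_carrier]
    carrier_matD[OF Theta_star_ext_carrier[OF qT, of \<theta>]]
  by (simp add: mult_minus_distrib_dim mult_assoc_dim)

lemma Z_index:
  assumes "m < T" "j < k"
  shows "Z_mat p k T \<mu> \<Phi> x $$ (m, j) = x (a + int m) j - \<mu> $$ (0, j)
     - (\<Sum>r = 1..p. (row_mat k (x (a + int m - int r)) * \<Phi> r) $$ (0, j))"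
proof -
  have "(lag_mat p k T r x * \<Phi> r) $$ (m, j) = (row_mat k (x (a + int m - int r)) * \<Phi> r) $$ (0, j)"
    if "r \<in> {1..p}" for r
    using that \<Phi> assms carrier_matD[of "\<Phi> r" k k]
    by (auto simp: scalar_prod_def lag_mat_def row_mat_def intro!: sum.cong)
  moreover have "(ones_mat T * \<mu>) $$ (m, j) = \<mu> $$ (0, j)"
    using \<mu> assms by (simp add: ones_mat_def scalar_prod_def)
  ultimately show ?thesis
    using assms by (simp add: Z_mat_def lag_mat_def)
qed

text \<open>The current observation enters row \<open>n\<close> of \<open>Z_mat\<close> with
  coefficient 1, and the inverse of \<open>Theta\<close> is unit lower triangular, so subtracting
  that observation cancels its only occurrence. This is the triangularity required of the
  substitution.\<close>

lemma innovations_cong: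
  assumes n: "n < T" "j < k" and y: "\<And>i. a \<le> i \<Longrightarrow> i < a + int n \<Longrightarrow> y i = y' i"
  shows "Gf w P n y j = Gf w P n y' j"
proof -
  define D where "D = (\<lambda>y. Z_mat p k T \<mu> \<Phi> (merge Ip I (w, y)) - Theta_star_ext q T \<theta> * rows_mat q k (a - int q) P)"
  have Dc: "D y \<in> carrier_mat T k" for y unfolding D_def by (rule D_carrier)
  \<comment> \<open>The lagged regressors of row \<open>m\<close> lie strictly before time
    \<open>a + int m\<close>, hence among initial observations or at times where \<open>y\<close>
    and \<open>y'\<close> agree.\<close>
  have D: "D y $$ (m, j) - y (a + int m) j = D y' $$ (m, j) - y' (a + int m) j" if "m \<le> n" for m
  proof -
    have m: "m < T" using that n by simp
    have "merge Ip I (w, y) (a + int m - int r) = merge Ip I (w, y') (a + int m - int r)" if "r \<in> {1..p}" for r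
      using that \<open>m \<le> n\<close> y by (auto simp: merge_def)
    hence "(\<Sum>r = 1..p. (row_mat k (merge Ip I (w, y) (a + int m - int r)) * \<Phi> r) $$ (0, j)) =
      (\<Sum>r = 1..p. (row_mat k (merge Ip I (w, y') (a + int m - int r)) * \<Phi> r) $$ (0, j))"
      by (intro sum.cong) auto
    moreover have "merge Ip I (w, y) (a + int m) = y (a + int m)" "merge Ip I (w, y') (a + int m) = y' (a + int m)"
      using m by (auto simp: merge_def)
    ultimately show ?thesis
      using m n(2) carrier_matD[OF Theta_star_ext_carrier[OF qT, of \<theta>]]
      by (simp add: D_def Z_index rows_mat_def)
  qed
  have E: "inn w P y $$ (n, j) = (\<Sum>m<n. minv (Theta q T \<theta>) $$ (n, m) * D y $$ (m, j)) + D y $$ (n, j)" for y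
  proof -
    have "inn w P y $$ (n, j) = (\<Sum>m<T. minv (Theta q T \<theta>) $$ (n, m) * D y $$ (m, j))"
    proof -
      have "inn w P y = minv (Theta q T \<theta>) * D y" by (simp add: innovations_def D_def)
      thus ?thesis using n carrier_matD[OF N(1)] carrier_matD[OF Dc[of y]]
        by (simp add: scalar_prod_def atLeast0LessThan)
    qed
    also have "\<dots> = (\<Sum>m<Suc n. minv (Theta q T \<theta>) $$ (n, m) * D y $$ (m, j))"
      by (rule sum.mono_neutral_right) (use n in \<open>auto simp: minv_Theta_triangular[where \<theta> = \<theta>, OF \<theta>0]\<close>)
    finally show ?thesis using n by (simp add: minv_Theta_triangular[where \<theta> = \<theta>, OF \<theta>0])
  qed
  have Dm: "D y $$ (m, j) = D y' $$ (m, j)" if "m < n" for m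
  proof -
    have "y (a + int m) j = y' (a + int m) j" using y[of "a + int m"] that by simp
    thus ?thesis using D[of m] that by linarith
  qed
  have "(\<Sum>m<n. minv (Theta q T \<theta>) $$ (n, m) * D y $$ (m, j)) = (\<Sum>m<n. minv (Theta q T \<theta>) $$ (n, m) * D y' $$ (m, j))"
    by (intro sum.cong refl) (simp only: Dm lessThan_iff)
  thus ?thesis unfolding E using D[of n] by linarith
qed

lemma innovations_meas:
  assumes w: "w \<in> measurable Q (NS Ip)" and P: "P \<in> measurable Q (NS J)" and y: "y \<in> measurable Q (NS I)"
  shows "mat_meas Q T k (\<lambda>z. inn (w z) (P z) (y z))"
proof -
  have m: "(\<lambda>z. merge Ip I (w z, y z) t j) \<in> borel_measurable Q" if "t \<in> {1..int p + int T}" "j < k" for t j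
  proof (cases "t \<in> Ip")
    case True
    thus ?thesis using measurable_PiM_lebesgue_component[OF w True that(2)] by (simp add: merge_def)
  next
    case False
    hence "t \<in> I" using that by auto
    thus ?thesis using measurable_PiM_lebesgue_component[OF y \<open>t \<in> I\<close> that(2)] False by (simp add: merge_def)
  qed
  have r: "mat_meas Q q k (\<lambda>z. rows_mat q k (a - int q) (P z))"
    unfolding rows_mat_def by (intro mat_meas_mat measurable_PiM_lebesgue_component[OF P]) auto
  show ?thesis unfolding innovations_def
    by (intro mat_meas_mult[of _ _ T] mat_meas_mult[of _ _ q] mat_meas_minus mat_meas_const mat_meas_Z \<mu> \<Phi> m r N(1)
      Theta_star_ext_carrier[OF qT])
qed

lemma innovations_remainder_meas:
  assumes "n < T" "j < k"
  shows "(\<lambda>(s, y). Gf (fst s) (snd s) n y j) \<in> borel_measurable ((NS Ip \<Otimes>\<^sub>M NS J) \<Otimes>\<^sub>M NS I)"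
proof -
  let ?Q = "(NS Ip \<Otimes>\<^sub>M NS J) \<Otimes>\<^sub>M NS I"
  have "mat_meas ?Q T k (\<lambda>z. inn (fst (fst z)) (snd (fst z)) (snd z))"
    by (rule innovations_meas) measurable
  from mat_measD[OF this assms] have 1: "(\<lambda>z. inn (fst (fst z)) (snd (fst z)) (snd z) $$ (n, j)) \<in> borel_measurable ?Q" .
  have 2: "(\<lambda>z. snd z (a + int n) j) \<in> borel_measurable ?Q"
    by (rule measurable_PiM_lebesgue_component[OF measurable_snd]) (use assms in auto)
  show ?thesis using borel_measurable_diff[OF 1 2] by (simp add: case_prod_beta')
qed

lemma innovations_eq_errors:
  fixes x e :: "int \<Rightarrow> nat \<Rightarrow> real"
  assumes model: "\<And>t j. t \<in> {int p + 1..int p + int T} \<Longrightarrow> j < k \<Longrightarrow>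
     x t j = \<mu> $$ (0, j) + (\<Sum>i = 1..p. (row_mat k (x (t - int i)) * \<Phi> i) $$ (0, j))
           + e t j + (\<Sum>i = 1..q. \<theta> i * e (t - int i) j)"
  shows "inn (restrict x Ip) (restrict e J) (restrict x I) = rows_mat T k a (restrict e I)"
proof -
  let ?Z = "Z_mat p k T \<mu> \<Phi> (merge Ip I (restrict x Ip, restrict x I))"
  let ?RI = "rows_mat T k a (restrict e I)" and ?RJ = "rows_mat q k (a - int q) (restrict e J)"
  have "?Z - Theta_star_ext q T \<theta> * ?RJ = Theta q T \<theta> * ?RI"
  proof (rule eq_matI)
    fix m j assume "m < dim_row (Theta q T \<theta> * ?RI)" "j < dim_col (Theta q T \<theta> * ?RI)"
    hence mj: "m < T" "j < k" by (auto simp: rows_mat_def)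
    have mg: "merge Ip I (restrict x Ip, restrict x I) t = x t" if "t \<in> {1..int p + int T}" for t
      using that by (auto simp: merge_def)
    have "(\<Sum>r = 1..p. (row_mat k (merge Ip I (restrict x Ip, restrict x I) (a + int m - int r)) * \<Phi> r) $$ (0, j)) =
      (\<Sum>r = 1..p. (row_mat k (x (a + int m - int r)) * \<Phi> r) $$ (0, j))"
      using mj by (intro sum.cong) (auto simp: mg)
    hence "?Z $$ (m, j) = x (a + int m) j - \<mu> $$ (0, j) - (\<Sum>r = 1..p. (row_mat k (x (a + int m - int r)) * \<Phi> r) $$ (0, j))"
      using mj by (simp only: Z_index) (simp add: mg)
    also have "\<dots> = e (a + int m) j + (\<Sum>i = 1..q. \<theta> i * e (a + int m - int i) j)"
      using model[of "a + int m" j] mj by simp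
    also have "\<dots> = (\<Sum>l=0..q. \<theta> l * e (a + (int m - int l)) j)"
      using \<theta>0 by (subst sum.atLeast_Suc_atMost) (auto simp: algebra_simps)
    also have "\<dots> = (\<Sum>i<T. Theta q T \<theta> $$ (m, i) * e (a + int i) j) + (\<Sum>i<q. Theta_star_ext q T \<theta> $$ (m, i) * e (a + (int i - int q)) j)"
      using Theta_sums[OF qT mj(1), of \<theta> "\<lambda>d. e (a + d) j"] by simp
    also have "(\<Sum>i<T. Theta q T \<theta> $$ (m, i) * e (a + int i) j) = (Theta q T \<theta> * ?RI) $$ (m, j)"
      using mj by (simp add: scalar_prod_def atLeast0LessThan rows_mat_def)
    also have "(\<Sum>i<q. Theta_star_ext q T \<theta> $$ (m, i) * e (a + (int i - int q)) j) = (Theta_star_ext q T \<theta> * ?RJ) $$ (m, j)"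
      using mj carrier_matD[OF Theta_star_ext_carrier[OF qT, of \<theta>]]
      by (simp add: scalar_prod_def atLeast0LessThan rows_mat_def algebra_simps)
    finally have "?Z $$ (m, j) = (Theta q T \<theta> * ?RI) $$ (m, j) + (Theta_star_ext q T \<theta> * ?RJ) $$ (m, j)" .
    moreover have "(?Z - Theta_star_ext q T \<theta> * ?RJ) $$ (m, j) = ?Z $$ (m, j) - (Theta_star_ext q T \<theta> * ?RJ) $$ (m, j)"
      using mj carrier_matD[OF Theta_star_ext_carrier[OF qT, of \<theta>]]
      by (intro index_minus_mat) (auto simp: rows_mat_def)
    ultimately show "(?Z - Theta_star_ext q T \<theta> * ?RJ) $$ (m, j) = (Theta q T \<theta> * ?RI) $$ (m, j)" by linarith
  qed (use carrier_matD[OF Theta_star_ext_carrier[OF qT, of \<theta>]] in \<open>auto simp: rows_mat_def\<close>)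
  hence "inn (restrict x Ip) (restrict e J) (restrict x I) = minv (Theta q T \<theta>) * (Theta q T \<theta> * ?RI)"
    by (simp add: innovations_def)
  also have "\<dots> = ?RI" by (rule mult_cancel_mid) (use N in \<open>auto simp: rows_mat_def\<close>)
  finally show ?thesis .
qed

lemma tri_map_innovations:
  "tri_map k a (\<lambda>_. 1) (\<lambda>n y j. Gf w P n y j) T y = (\<lambda>i\<in>I. \<lambda>j\<in>{..<k}. inn w P y $$ (nat (i - a), j))"
  unfolding tri_map_def by (auto simp: fun_eq_iff)

abbreviation "Gfun s \<equiv> (\<lambda>n y j. Gf (fst s) (snd s) n y j)"

text \<open>\<open>F\<close> is a test function of the sample, written through the errors by
  \<open>tri_inv\<close>. For fixed \<open>P\<close> the errors are replaced by observations; only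
  after exchanging the integrals are the pre-sample errors integrated out, for a fixed sample, by
  \<open>gaussian_marginal\<close>.\<close>

lemma likelihood_integral:
  fixes F :: "(int \<Rightarrow> nat \<Rightarrow> real) \<Rightarrow> ennreal"
  assumes pd: "pos_def k \<Omega>" and w: "w \<in> space (NS Ip)" and F: "F \<in> borel_measurable (NS I)"
    and one: "0 < q \<Longrightarrow> (\<integral>\<^sup>+v. ennreal (gaussian_density k \<Omega> v) \<partial>lebesgue_space k) = 1"
  shows "(\<integral>\<^sup>+P. \<integral>\<^sup>+e. ennreal ((\<Prod>s\<in>J. gaussian_density k \<Omega> (P s)) * (\<Prod>s\<in>I. gaussian_density k \<Omega> (e s)))
         * F (tri_inv k a T (Gfun (w, P)) T e) \<partial>NS I \<partial>NS J) =
     (\<integral>\<^sup>+y. F y * ennreal (exp (varma_loglik p q k T \<theta> \<mu> \<Phi> \<Omega> (merge Ip I (w, y)))) \<partial>NS I)"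
proof -
  let ?gd = "gaussian_density k \<Omega>"
  have \<Omega>: "\<Omega> \<in> carrier_mat k k" "invertible_mat \<Omega>" "0 < mdet \<Omega>"
    using pos_def_invertible[OF pd] pos_def_det_pos[OF pd] pd by (simp_all add: pos_def_def)
  have gdm: "(\<lambda>z. ?gd (f z s)) \<in> borel_measurable Q" if "f \<in> measurable Q (NS K)" "s \<in> K" for f Q K s
    by (rule gaussian_density_meas[OF \<Omega>(1,2)]) (rule measurable_PiM_lebesgue_component[OF that])
  define h where "h = (\<lambda>P y. ennreal ((\<Prod>s\<in>J. ?gd (P s)) * (\<Prod>i<T. ?gd (\<lambda>j. inn w P y $$ (i, j)))))"
  have hm: "(\<lambda>(P, y). h P y * F y) \<in> borel_measurable (NS J \<Otimes>\<^sub>M NS I)"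
  proof -
    let ?Q = "NS J \<Otimes>\<^sub>M NS I"
    have "mat_meas ?Q T k (\<lambda>z. inn w (fst z) (snd z))"
      by (rule innovations_meas) (use w in measurable)
    hence "(\<lambda>z. ?gd (\<lambda>j. inn w (fst z) (snd z) $$ (i, j))) \<in> borel_measurable ?Q" if "i < T" for i
      by (intro gaussian_density_meas[OF \<Omega>(1,2)] mat_measD[OF _ that])
    moreover have "(\<lambda>z. ?gd (fst z s)) \<in> borel_measurable ?Q" if "s \<in> J" for s
      using that by (intro gdm[OF measurable_fst])
    ultimately have "(\<lambda>z. h (fst z) (snd z)) \<in> borel_measurable ?Q"
      unfolding h_def by (intro measurable_compose[OF _ measurable_ennreal] borel_measurable_times borel_measurable_prod) auto
    moreover have "(\<lambda>z. F (snd z)) \<in> borel_measurable ?Q" using F by measurable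
    ultimately show ?thesis by (simp add: case_prod_beta' borel_measurable_times_ennreal)
  qed
  have inner: "(\<integral>\<^sup>+e. ennreal ((\<Prod>s\<in>J. ?gd (P s)) * (\<Prod>s\<in>I. ?gd (e s))) * F (tri_inv k a T (Gfun (w, P)) T e) \<partial>NS I)
     = (\<integral>\<^sup>+y. h P y * F y \<partial>NS I)" if P: "P \<in> space (NS J)" for P
  proof -
    let ?t = "tri_map k a (\<lambda>_. 1) (Gfun (w, P)) T"
    interpret triangular k T a "\<lambda>_. 1" "Gfun (w, P)"
    proof
      show "Gfun (w, P) n y j = Gfun (w, P) n y' j"
        if "n < T" "j < k" "\<And>i. a \<le> i \<Longrightarrow> i < a + int n \<Longrightarrow> y i = y' i" for n y y' j
        using innovations_cong[OF that] .
      show "(\<lambda>y. Gfun (w, P) n y j) \<in> borel_measurable (NS I)" if "n < T" "j < k" for n j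
        using measurable_compose[OF measurable_Pair1'[of "(w, P)"] innovations_remainder_meas[OF that]] w P
        by (simp add: space_pair_measure)
    qed simp
    define K where "K = (\<lambda>e. ennreal ((\<Prod>s\<in>J. ?gd (P s)) * (\<Prod>s\<in>I. ?gd (e s))) * F (tri_inv k a T (Gfun (w, P)) T e))"
    have inv_m: "tri_inv k a T (Gfun (w, P)) T \<in> measurable (NS I) (NS I)"
    proof -
      have "(\<lambda>(s, e). tri_inv k a T (Gfun s) T e) \<in> measurable ((NS Ip \<Otimes>\<^sub>M NS J) \<Otimes>\<^sub>M NS I) (NS I)"
        by (rule tri_inv_meas[OF _ order_refl]) (rule innovations_remainder_meas)
      from measurable_compose[OF measurable_Pair1'[of "(w, P)"] this] show ?thesis using w P
        by (simp add: space_pair_measure)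
    qed
    have Km: "K \<in> borel_measurable (NS I)"
    proof -
      have "(\<lambda>e. ?gd (e s)) \<in> borel_measurable (NS I)" if "s \<in> I" for s
        using gdm[of "\<lambda>e. e" "NS I" I s] that by simp
      hence "(\<lambda>e. ennreal ((\<Prod>s\<in>J. ?gd (P s)) * (\<Prod>s\<in>I. ?gd (e s)))) \<in> borel_measurable (NS I)"
        by (intro measurable_compose[OF _ measurable_ennreal] borel_measurable_times borel_measurable_prod) auto
      thus ?thesis unfolding K_def by (intro borel_measurable_times_ennreal measurable_compose[OF inv_m F])
    qed
    \<comment> \<open>All scales are 1, so the Jacobian factor is 1.\<close>
    have "(\<integral>\<^sup>+e. K e \<partial>NS I) = (\<integral>\<^sup>+y. K (?t y) \<partial>NS I)"
      using nn_integral_tri_map[OF order_refl Km] by simp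
    also have "\<dots> = (\<integral>\<^sup>+y. h P y * F y \<partial>NS I)"
    proof (rule nn_integral_cong)
      fix y assume y: "y \<in> space (NS I)"
      have "tri_inv k a T (Gfun (w, P)) T (?t y) = y"
        by (rule tri_inv_tri_map[OF G_cong y])
      moreover have "(\<Prod>s\<in>I. ?gd (?t y s)) = (\<Prod>i<T. ?gd (\<lambda>j. inn w P y $$ (i, j)))"
        unfolding prod_int_interval fst_conv snd_conv tri_map_innovations
        by (intro prod.cong gaussian_density_cong) auto
      ultimately show "K (?t y) = h P y * F y" by (simp add: K_def h_def)
    qed
    finally show ?thesis unfolding K_def .
  qed
  have "(\<integral>\<^sup>+P. \<integral>\<^sup>+e. ennreal ((\<Prod>s\<in>J. ?gd (P s)) * (\<Prod>s\<in>I. ?gd (e s))) * F (tri_inv k a T (Gfun (w, P)) T e) \<partial>NS I \<partial>NS J)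
     = (\<integral>\<^sup>+P. \<integral>\<^sup>+y. h P y * F y \<partial>NS I \<partial>NS J)"
    by (intro nn_integral_cong inner)
  also have "\<dots> = (\<integral>\<^sup>+y. \<integral>\<^sup>+P. h P y * F y \<partial>NS J \<partial>NS I)"
  proof (rule pair_sigma_finite.Fubini'[symmetric])
    show "pair_sigma_finite (NS J) (NS I)"
      unfolding pair_sigma_finite_def by (auto intro: lebesgue_prod.sigma_finite)
    show "(\<lambda>(P, y). h P y * F y) \<in> borel_measurable (NS J \<Otimes>\<^sub>M NS I)" by (rule hm)
  qed
  also have "\<dots> = (\<integral>\<^sup>+y. F y * ennreal (exp (varma_loglik p q k T \<theta> \<mu> \<Phi> \<Omega> (merge Ip I (w, y)))) \<partial>NS I)"
  proof (rule nn_integral_cong)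
    fix y assume y: "y \<in> space (NS I)"
    let ?Z = "Z_mat p k T \<mu> \<Phi> (merge Ip I (w, y))" and ?N = "minv (Theta q T \<theta>)"
    have H: "?N * ?Z \<in> carrier_mat T k" by (rule mult_carrier_mat[OF N(1) Z_carrier])
    have "mtrace ((?N * ?Z)\<^sup>T * K_mat q T \<theta> * (?N * ?Z) * minv \<Omega>) =
        mtrace (?Z\<^sup>T * ?N\<^sup>T * K_mat q T \<theta> * ?N * ?Z * minv \<Omega>)"
      using N(1) carrier_matD[OF Z_carrier] carrier_matD[OF K_carrier[where \<theta> = \<theta>, OF \<theta>0 qT]]
        carrier_matD[OF minv_props(1)[OF \<Omega>(1,2)]]
      by (simp add: transpose_mult_dim mult_assoc_dim)
    hence "(\<integral>\<^sup>+P. h P y \<partial>NS J) = ennreal (exp (varma_loglik p q k T \<theta> \<mu> \<Phi> \<Omega> (merge Ip I (w, y))))"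
      unfolding h_def innovations_affine using gaussian_marginal[where \<theta> = \<theta>, OF \<theta>0 qT pd H one, of "a - int q"]
      by (simp add: varma_loglik_def)
    moreover have "(\<lambda>P. h P y * F y) = (\<lambda>P. F y * h P y)" by (simp add: mult.commute)
    moreover have "(\<lambda>P. h P y) \<in> borel_measurable (NS J)"
    proof -
      have "mat_meas (NS J) T k (\<lambda>P. inn w P y)"
        by (rule innovations_meas) (use w y in measurable)
      hence "(\<lambda>P. ?gd (\<lambda>j. inn w P y $$ (i, j))) \<in> borel_measurable (NS J)" if "i < T" for i
        by (intro gaussian_density_meas[OF \<Omega>(1,2)] mat_measD[OF _ that])
      moreover have "(\<lambda>P. ?gd (P s)) \<in> borel_measurable (NS J)" if "s \<in> J" for s
        using gdm[of "\<lambda>e. e" "NS J" J s] that by simp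
      ultimately show ?thesis
        unfolding h_def by (intro measurable_compose[OF _ measurable_ennreal] borel_measurable_times borel_measurable_prod) auto
    qed
    ultimately show "(\<integral>\<^sup>+P. h P y * F y \<partial>NS J) = F y * ennreal (exp (varma_loglik p q k T \<theta> \<mu> \<Phi> \<Omega> (merge Ip I (w, y))))"
      by (simp add: nn_integral_cmult)
  qed
  finally show ?thesis .
qed

text \<open>Almost surely the sample is a function of initial observations and errors, whose joint
  law is known. Expectations of test functions thus become integrals over error paths, which
  \<open>likelihood_integral\<close> rewrites as integrals over samples; indicators as test
  functions identify the joint law.\<close>

lemma conditional_loglik:
  fixes M :: "'a measure"
  assumes model: "varma_model M p q k T \<theta> \<mu> \<Phi> \<Omega> X \<epsilon>"
  shows "is_cond_loglik M (NS Ip) (obs_path Ip X) (NS I) (obs_path I X)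
      (\<lambda>w y. varma_loglik p q k T \<theta> \<mu> \<Phi> \<Omega> (merge Ip I (w, y)))"
proof -
  let ?gd = "gaussian_density k \<Omega>"
  define E where "E = {int p + 1 - int q..int p + int T}"
  have E: "E = J \<union> I" and JI: "J \<inter> I = {}" using qT by (auto simp: E_def)
  have finE: "finite E" by (simp add: E_def)
  from model have ps: "prob_space M" and pd: "pos_def k \<Omega>"
    and Xm: "\<And>t. t \<in> {1..int p + int T} \<Longrightarrow> X t \<in> measurable M (lebesgue_space k)"
    and dens: "\<And>s. s \<in> E \<Longrightarrow> distributed M (lebesgue_space k) (\<epsilon> s) (\<lambda>v. ennreal (?gd v))"
    and ind: "prob_space.indep_vars M (\<lambda>_. lebesgue_space k) \<epsilon> E"
    and indW: "prob_space.indep_var M (NS Ip) (obs_path Ip X) (NS E) (obs_path E \<epsilon>)"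
    and eqn: "AE \<omega> in M. \<forall>t \<in> {int p + 1..int p + int T}. \<forall>j < k.
         X t \<omega> j = \<mu> $$ (0, j)
           + (\<Sum>i = 1..p. (row_mat k (X (t - int i) \<omega>) * \<Phi> i) $$ (0, j))
           + \<epsilon> t \<omega> j + (\<Sum>i = 1..q. \<theta> i * \<epsilon> (t - int i) \<omega> j)"
    by (auto simp: varma_model_def Let_def E_def)
  interpret prob_space M by (rule ps)
  have \<Omega>: "\<Omega> \<in> carrier_mat k k" "invertible_mat \<Omega>" "0 < mdet \<Omega>"
    using pos_def_invertible[OF pd] pos_def_det_pos[OF pd] pd by (simp_all add: pos_def_def)
  have gd0: "0 \<le> ?gd v" for v using gaussian_density_nonneg[OF \<Omega>(3)] .
  have W: "obs_path Ip X \<in> measurable M (NS Ip)" and Y: "obs_path I X \<in> measurable M (NS I)"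
    unfolding obs_path_def by (intro measurable_restrict Xm; force)+
  have \<epsilon>m: "\<epsilon> s \<in> measurable M (lebesgue_space k)" if "s \<in> E" for s
    using distributed_measurable[OF dens[OF that]] .
  \<comment> \<open>Total mass 1 of the density comes from the law of the first pre-sample error,
    which exists because q is positive.\<close>
  have one: "(\<integral>\<^sup>+v. ennreal (?gd v) \<partial>lebesgue_space k) = 1" if "0 < q"
  proof -
    have "int p + 1 - int q \<in> E" using that qT by (simp add: E_def)
    from distributed_nn_integral[OF dens[OF this], of "\<lambda>_. 1"] show ?thesis by (simp add: emeasure_space_1)
  qed
  let ?ll = "\<lambda>w y. varma_loglik p q k T \<theta> \<mu> \<Phi> \<Omega> (merge Ip I (w, y))"
  have llm: "(\<lambda>(w, y). ennreal (exp (?ll w y))) \<in> borel_measurable (NS Ip \<Otimes>\<^sub>M NS I)"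
  proof -
    have "(\<lambda>z. merge Ip I (fst z, snd z) t j) \<in> borel_measurable (NS Ip \<Otimes>\<^sub>M NS I)"
      if "t \<in> {1..int p + int T}" "j < k" for t j
    proof (cases "t \<in> Ip")
      case True
      thus ?thesis using measurable_PiM_lebesgue_component[OF measurable_fst True that(2)] by (simp add: merge_def case_prod_beta)
    next
      case False
      hence "t \<in> I" using that by auto
      thus ?thesis using measurable_PiM_lebesgue_component[OF measurable_snd \<open>t \<in> I\<close> that(2)] False by (simp add: merge_def case_prod_beta)
    qed
    from varma_loglik_meas[where \<theta> = \<theta>, OF \<theta>0 qT \<mu> \<Phi> \<Omega>(1,2) this]
    have "(\<lambda>z. ?ll (fst z) (snd z)) \<in> borel_measurable (NS Ip \<Otimes>\<^sub>M NS I)" .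
    thus ?thesis by (simp add: case_prod_beta')
  qed
  \<comment> \<open>The model equation is solved forward: the triangular map sends the sample to the
    errors by \<open>innovations_eq_errors\<close>, and \<open>tri_inv\<close> undoes it.\<close>
  have Y_eq: "AE \<omega> in M. obs_path I X \<omega> = tri_inv k a T (Gfun (obs_path Ip X \<omega>, restrict (obs_path E \<epsilon> \<omega>) J)) T
      (restrict (obs_path E \<epsilon> \<omega>) I)"
    using eqn AE_space
  proof eventually_elim
    case (elim \<omega>)
    let ?x = "\<lambda>t. X t \<omega>" and ?e = "\<lambda>t. \<epsilon> t \<omega>"
    have r: "restrict (obs_path E \<epsilon> \<omega>) J = restrict ?e J" "restrict (obs_path E \<epsilon> \<omega>) I = restrict ?e I"
      by (auto simp: obs_path_def E restrict_def fun_eq_iff)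
    have em: "inn (restrict ?x Ip) (restrict ?e J) (restrict ?x I) = rows_mat T k a (restrict ?e I)"
      by (rule innovations_eq_errors) (use elim(1) in blast)
    have "tri_map k a (\<lambda>_. 1) (Gfun (restrict ?x Ip, restrict ?e J)) T (restrict ?x I) = restrict ?e I"
      unfolding fst_conv snd_conv tri_map_innovations em
    proof (rule extensionalityI[of _ I])
      fix i assume i: "i \<in> I"
      have "\<epsilon> i \<omega> \<in> space (lebesgue_space k)" using measurable_space[OF \<epsilon>m] i elim(2) E by blast
      thus "(\<lambda>i\<in>I. \<lambda>j\<in>{..<k}. rows_mat T k a (restrict ?e I) $$ (nat (i - a), j)) i = restrict ?e I i"
        using i by (auto simp: rows_mat_def space_PiM PiE_def extensional_def fun_eq_iff)
    qed auto
    moreover have "restrict ?x I \<in> space (NS I)"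
      using measurable_space[OF Y elim(2)] by (simp add: obs_path_def)
    hence "tri_inv k a T (Gfun (restrict ?x Ip, restrict ?e J)) T
       (tri_map k a (\<lambda>_. 1) (Gfun (restrict ?x Ip, restrict ?e J)) T (restrict ?x I)) = restrict ?x I"
    proof (rule tri_inv_tri_map[rotated])
      fix n j and y y' :: "int \<Rightarrow> nat \<Rightarrow> real"
      assume "n < T" "j < k" "\<And>i. a \<le> i \<Longrightarrow> i < a + int n \<Longrightarrow> y i = y' i"
      from innovations_cong[OF this] show "Gfun (restrict ?x Ip, restrict ?e J) n y j = Gfun (restrict ?x Ip, restrict ?e J) n y' j"
        by (simp only: fst_conv snd_conv)
    qed
    ultimately show ?case unfolding r by (simp add: obs_path_def)
  qed
  have key: "(\<integral>\<^sup>+\<omega>. F (obs_path Ip X \<omega>, obs_path I X \<omega>) \<partial>M) =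
     (\<integral>\<^sup>+w. \<integral>\<^sup>+y. F (w, y) * ennreal (exp (?ll w y)) \<partial>NS I \<partial>distr M (NS Ip) (obs_path Ip X))"
    if F: "F \<in> borel_measurable (NS Ip \<Otimes>\<^sub>M NS I)" for F
  proof -
    \<comment> \<open>The test function expressed in the initial observations and the full error
      path, which is then split into its pre-sample and sample parts.\<close>
    define F' where "F' = (\<lambda>(w, e). F (w, tri_inv k a T (Gfun (w, restrict e J)) T (restrict e I)))"
    have F'm: "F' \<in> borel_measurable (NS Ip \<Otimes>\<^sub>M NS E)"
    proof -
      have rJ: "(\<lambda>z. restrict (snd z) J) \<in> measurable (NS Ip \<Otimes>\<^sub>M NS E) (NS J)"
        and rI: "(\<lambda>z. restrict (snd z) I) \<in> measurable (NS Ip \<Otimes>\<^sub>M NS E) (NS I)"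
        by (auto intro!: measurable_compose[OF measurable_snd] measurable_restrict_subset simp: E)
      have "(\<lambda>(s, e). tri_inv k a T (Gfun s) T e) \<in> measurable ((NS Ip \<Otimes>\<^sub>M NS J) \<Otimes>\<^sub>M NS I) (NS I)"
        by (rule tri_inv_meas[OF _ order_refl]) (rule innovations_remainder_meas)
      from measurable_compose[OF measurable_Pair[OF measurable_Pair[OF measurable_fst rJ] rI] this]
      have "(\<lambda>z. tri_inv k a T (Gfun (fst z, restrict (snd z) J)) T (restrict (snd z) I)) \<in> measurable (NS Ip \<Otimes>\<^sub>M NS E) (NS I)"
        by simp
      from measurable_compose[OF measurable_Pair[OF measurable_fst this] F] show ?thesis
        by (simp add: F'_def case_prod_beta')
    qed
    have "(\<integral>\<^sup>+\<omega>. F (obs_path Ip X \<omega>, obs_path I X \<omega>) \<partial>M) = (\<integral>\<^sup>+\<omega>. F' (obs_path Ip X \<omega>, obs_path E \<epsilon> \<omega>) \<partial>M)"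
      by (rule nn_integral_cong_AE) (use Y_eq in eventually_elim, simp add: F'_def)
    also have "\<dots> = (\<integral>\<^sup>+w. \<integral>\<^sup>+e. (\<Prod>s\<in>E. ennreal (?gd (e s))) * F' (w, e) \<partial>NS E \<partial>distr M (NS Ip) (obs_path Ip X))"
      by (rule nn_integral_indep_density[OF ps finE dens ind indW F'm])
    also have "\<dots> = (\<integral>\<^sup>+w. \<integral>\<^sup>+y. F (w, y) * ennreal (exp (?ll w y)) \<partial>NS I \<partial>distr M (NS Ip) (obs_path Ip X))"
    proof (rule nn_integral_cong)
      fix w assume "w \<in> space (distr M (NS Ip) (obs_path Ip X))"
      hence w: "w \<in> space (NS Ip)" by simp
      have gs: "(\<lambda>e. ennreal (?gd (e s))) \<in> borel_measurable (NS E)" if "s \<in> E" for s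
        using measurable_compose[OF measurable_component_singleton[OF that] distributed_borel_measurable[OF dens[OF that]]] .
      have m: "(\<lambda>e. (\<Prod>s\<in>E. ennreal (?gd (e s))) * F' (w, e)) \<in> borel_measurable (NS (J \<union> I))"
        using gs measurable_compose[OF measurable_Pair1'[OF w] F'm] unfolding E[symmetric]
        by (intro borel_measurable_times_ennreal borel_measurable_prod_ennreal) auto
      have "(\<integral>\<^sup>+e. (\<Prod>s\<in>E. ennreal (?gd (e s))) * F' (w, e) \<partial>NS E) =
        (\<integral>\<^sup>+P. \<integral>\<^sup>+e. (\<Prod>s\<in>E. ennreal (?gd (merge J I (P, e) s))) * F' (w, merge J I (P, e)) \<partial>NS I \<partial>NS J)"
        using lebesgue_prod.product_nn_integral_fold[OF JI _ _ m] by (simp add: E)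
      also have "\<dots> = (\<integral>\<^sup>+P. \<integral>\<^sup>+e. ennreal ((\<Prod>s\<in>J. ?gd (P s)) * (\<Prod>s\<in>I. ?gd (e s)))
         * F (w, tri_inv k a T (Gfun (w, P)) T e) \<partial>NS I \<partial>NS J)"
      proof (intro nn_integral_cong)
        fix P e assume P: "P \<in> space (NS J)" and e: "e \<in> space (NS I)"
        have Pe: "P \<in> extensional J" "e \<in> extensional I" using P e by (auto simp: space_PiM PiE_def)
        have r: "restrict (merge J I (P, e)) J = P" "restrict (merge J I (P, e)) I = e"
          using JI Pe by (auto simp: restrict_merge extensional_restrict)
        have "(\<Prod>s\<in>E. ennreal (?gd (merge J I (P, e) s))) =
           (\<Prod>s\<in>J. ennreal (?gd (merge J I (P, e) s))) * (\<Prod>s\<in>I. ennreal (?gd (merge J I (P, e) s)))"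
          unfolding E using JI by (intro prod.union_disjoint) auto
        also have "\<dots> = (\<Prod>s\<in>J. ennreal (?gd (P s))) * (\<Prod>s\<in>I. ennreal (?gd (e s)))"
          using JI by (intro arg_cong2[of _ _ _ _ "(*)"] prod.cong) (auto simp: merge_def)
        also have "\<dots> = ennreal ((\<Prod>s\<in>J. ?gd (P s)) * (\<Prod>s\<in>I. ?gd (e s)))"
          by (simp add: ennreal_mult prod_nonneg gd0 prod_ennreal)
        finally show "(\<Prod>s\<in>E. ennreal (?gd (merge J I (P, e) s))) * F' (w, merge J I (P, e)) =
           ennreal ((\<Prod>s\<in>J. ?gd (P s)) * (\<Prod>s\<in>I. ?gd (e s))) * F (w, tri_inv k a T (Gfun (w, P)) T e)"
          by (simp only: F'_def prod.case r)
      qed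
      also have "\<dots> = (\<integral>\<^sup>+y. F (w, y) * ennreal (exp (?ll w y)) \<partial>NS I)"
        by (rule likelihood_integral[OF pd w measurable_compose[OF measurable_Pair1'[OF w] F] one])
      finally show "(\<integral>\<^sup>+e. (\<Prod>s\<in>E. ennreal (?gd (e s))) * F' (w, e) \<partial>NS E) = \<dots>" .
    qed
    finally show ?thesis .
  qed
  let ?D = "distr M (NS Ip) (obs_path Ip X)"
  have sets_D: "sets (?D \<Otimes>\<^sub>M NS I) = sets (NS Ip \<Otimes>\<^sub>M NS I)" by (intro sets_pair_measure_cong) auto
  have llD: "(\<lambda>(w, y). ennreal (exp (?ll w y))) \<in> borel_measurable (?D \<Otimes>\<^sub>M NS I)"
    using llm by (simp cong: measurable_cong_sets add: sets_D)
  have WY: "(\<lambda>\<omega>. (obs_path Ip X \<omega>, obs_path I X \<omega>)) \<in> measurable M (NS Ip \<Otimes>\<^sub>M NS I)"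
    using W Y by (rule measurable_Pair)
  have WYD: "(\<lambda>\<omega>. (obs_path Ip X \<omega>, obs_path I X \<omega>)) \<in> measurable M (?D \<Otimes>\<^sub>M NS I)"
    using WY measurable_cong_sets[OF refl sets_D] by blast
  have sf: "sigma_finite_measure (NS I)" by (rule lebesgue_prod.sigma_finite) simp
  have "distr M (?D \<Otimes>\<^sub>M NS I) (\<lambda>\<omega>. (obs_path Ip X \<omega>, obs_path I X \<omega>)) =
     density (?D \<Otimes>\<^sub>M NS I) (\<lambda>(w, y). ennreal (exp (?ll w y)))"
  proof (rule measure_eqI)
    fix A assume "A \<in> sets (distr M (?D \<Otimes>\<^sub>M NS I) (\<lambda>\<omega>. (obs_path Ip X \<omega>, obs_path I X \<omega>)))"
    hence AD: "A \<in> sets (?D \<Otimes>\<^sub>M NS I)" by simp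
    hence A: "A \<in> sets (NS Ip \<Otimes>\<^sub>M NS I)" by (simp only: sets_D)
    have iA: "(indicator A :: _ \<Rightarrow> ennreal) \<in> borel_measurable (NS Ip \<Otimes>\<^sub>M NS I)" using A by simp
    have iAD: "(indicator A :: _ \<Rightarrow> ennreal) \<in> borel_measurable (?D \<Otimes>\<^sub>M NS I)" using AD by simp
    have "emeasure (distr M (?D \<Otimes>\<^sub>M NS I) (\<lambda>\<omega>. (obs_path Ip X \<omega>, obs_path I X \<omega>))) A =
      (\<integral>\<^sup>+z. indicator A z \<partial>distr M (?D \<Otimes>\<^sub>M NS I) (\<lambda>\<omega>. (obs_path Ip X \<omega>, obs_path I X \<omega>)))"
      using AD by simp
    also have "\<dots> = (\<integral>\<^sup>+\<omega>. indicator A (obs_path Ip X \<omega>, obs_path I X \<omega>) \<partial>M)"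
      by (rule nn_integral_distr[OF WYD]) (use iAD in simp)
    also have "\<dots> = (\<integral>\<^sup>+w. \<integral>\<^sup>+y. indicator A (w, y) * ennreal (exp (?ll w y)) \<partial>NS I \<partial>?D)"
      by (rule key[OF iA])
    also have "\<dots> = (\<integral>\<^sup>+w. \<integral>\<^sup>+y. (\<lambda>z. (\<lambda>(w, y). ennreal (exp (?ll w y))) z * indicator A z) (w, y) \<partial>NS I \<partial>?D)"
      by (simp add: mult.commute)
    also have "\<dots> = (\<integral>\<^sup>+z. (\<lambda>(w, y). ennreal (exp (?ll w y))) z * indicator A z \<partial>(?D \<Otimes>\<^sub>M NS I))"
      by (rule sigma_finite_measure.nn_integral_fst[OF sf]) (intro borel_measurable_times_ennreal llD iAD)
    also have "\<dots> = emeasure (density (?D \<Otimes>\<^sub>M NS I) (\<lambda>(w, y). ennreal (exp (?ll w y)))) A"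
      by (rule emeasure_density[OF llD AD, symmetric])
    finally show "emeasure (distr M (?D \<Otimes>\<^sub>M NS I) (\<lambda>\<omega>. (obs_path Ip X \<omega>, obs_path I X \<omega>))) A = \<dots>" .
  qed simp
  thus ?thesis unfolding is_cond_loglik_def distributed_def using W llD WYD by simp
qed

end

theorem theorem1:
  fixes p q k T :: nat and \<theta> :: "nat \<Rightarrow> real"
  assumes "\<theta> 0 = 1" and "q \<le> T"
  shows
    "let \<Theta> = Theta q T \<theta>; \<Lambda> = lambda_mat q T \<theta>; G = gram_lambda q T \<theta>;
         K = K_mat q T \<theta>; S = Sigma_mat q T \<theta>
     in
     ((\<forall>(M :: 'a measure) \<mu> \<Phi> \<Omega> X \<epsilon>. varma_model M p q k T \<theta> \<mu> \<Phi> \<Omega> X \<epsilon> \<longrightarrow>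
        is_cond_loglik M
          (PiM {1..int p} (\<lambda>_. lebesgue_space k)) (obs_path {1..int p} X)
          (PiM {int p + 1..int p + int T} (\<lambda>_. lebesgue_space k)) (obs_path {int p + 1..int p + int T} X)
          (\<lambda>w y. varma_loglik p q k T \<theta> \<mu> \<Phi> \<Omega> (merge {1..int p} {int p + 1..int p + int T} (w, y)))) \<and>
      invertible_mat \<Theta> \<and> invertible_mat G \<and>
      invertible_mat (1\<^sub>m T + \<Lambda> * \<Lambda>\<^sup>T) \<and> K = minv (1\<^sub>m T + \<Lambda> * \<Lambda>\<^sup>T))
     \<and>
     (\<forall>x :: int \<Rightarrow> nat \<Rightarrow> real.
        invertible_mat ((X_theta_lag p q k T \<theta> x)\<^sup>T * K * X_theta_lag p q k T \<theta> x) \<longrightarrow>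
        pos_semidef k (Omega_opt p q k T \<theta> x) \<and>
        (\<exists>\<mu> \<Phi>. (\<mu>, \<Phi>) \<in> coeff_space p k \<and>
           stack_coeffs \<mu> \<Phi> p = coeffs_opt p q k T \<theta> x \<and>
           (\<forall>\<Omega>. pos_def k \<Omega> \<longrightarrow>
              is_arg_max (\<lambda>(m, F). varma_loglik p q k T \<theta> m F \<Omega> x)
                (\<lambda>c. c \<in> coeff_space p k) (\<mu>, \<Phi>)) \<and>
           (invertible_mat (Omega_opt p q k T \<theta> x) \<longrightarrow>
              is_arg_max (\<lambda>((m, F), \<Omega>). varma_loglik p q k T \<theta> m F \<Omega> x)
                (\<lambda>(c, \<Omega>). c \<in> coeff_space p k \<and> pos_def k \<Omega>)
                ((\<mu>, \<Phi>), Omega_opt p q k T \<theta> x) \<and>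
              varma_loglik p q k T \<theta> \<mu> \<Phi> (Omega_opt p q k T \<theta> x) x =
                - (real (T * k) / 2) * ln (2 * pi)
                - (real T / 2) * ln (mdet (Omega_opt p q k T \<theta> x))
                - (real k / 2) * ln (mdet G) - real (T * k) / 2)))
     \<and>
     (invertible_mat S \<and> minv S = (minv \<Theta>)\<^sup>T * K * minv \<Theta> \<and>
      invertible_mat K \<and> S = \<Theta> * minv K * \<Theta>\<^sup>T \<and>
      mdet G = mdet S \<and> mdet S = 1 / mdet K)"
proof -
  \<comment> \<open>The half-open form is the one in which the triangular maps index the sample
    times.\<close>
  have I_eq: "{int p + 1..int p + int T} = {int p + 1..<int p + 1 + int T}" by auto
  have cond: "is_cond_loglik M
          (PiM {1..int p} (\<lambda>_. lebesgue_space k)) (obs_path {1..int p} X)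
          (PiM {int p + 1..int p + int T} (\<lambda>_. lebesgue_space k)) (obs_path {int p + 1..int p + int T} X)
          (\<lambda>w y. varma_loglik p q k T \<theta> \<mu> \<Phi> \<Omega> (merge {1..int p} {int p + 1..int p + int T} (w, y)))"
    if model: "varma_model M p q k T \<theta> \<mu> \<Phi> \<Omega> X \<epsilon>" for M :: "'a measure" and \<mu> \<Phi> \<Omega> X \<epsilon>
  proof -
    have "\<mu> \<in> carrier_mat 1 k" "\<forall>i\<in>{1..p}. \<Phi> i \<in> carrier_mat k k"
      using model by (auto simp: varma_model_def Let_def coeff_space_def)
    then interpret varma_coefficients p q k T \<theta> \<mu> \<Phi>
      using assms by unfold_locales
    show ?thesis using conditional_loglik[OF model] unfolding I_eq .
  qed
  show ?thesis
    unfolding Let_def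
    by (intro conjI allI impI cond invertible_Theta[where \<theta> = \<theta>] assms
        pos_def_invertible[OF gram_lambda_pos_def[where \<theta> = \<theta>, OF assms]]
        pos_def_invertible[OF update_pos_def[where \<theta> = \<theta>, OF assms]]
        minv_update[where \<theta> = \<theta>, OF assms, symmetric]
        maximum_likelihood[where \<theta> = \<theta>, OF assms, THEN conjunct1]
        maximum_likelihood[where \<theta> = \<theta>, OF assms, THEN conjunct2]
        Sigma_inverse[where \<theta> = \<theta>, OF assms] invertible_K[where \<theta> = \<theta>, OF assms]
        Sigma_factor[where \<theta> = \<theta>, OF assms] det_Sigma[where \<theta> = \<theta>, OF assms])
qed

end
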